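(* Let $k$ and $m>1$ be fixed positive integers, and let $1=r_1<r_2<\dots<r_{\phi(m)}<m$ be the standard representatives of $(\mathbb{Z}/m\mathbb{Z})^\times$. For integers $0\le a_1,\dots,a_{\phi(m)}\le k$ with $a_1+\dots+a_{\phi(m)}=k$, let $\pi_k(X;m;a_1,\dots,a_{\phi(m)})$ be the number of square-free positive integers $n\le X$ with $\omega(n)=k$ having exactly $a_j$ prime factors congruent to $r_j\pmod m$ for each $1\le j\le\phi(m)$. Then, as $X\to\infty$, $$\pi_k(X;m;a_1,\dots,a_{\phi(m)})=(1+o(1))\frac{k!}{a_1!a_2!\cdots a_{\phi(m)}!}\cdot\frac{1}{\phi(m)^k(k-1)!}\cdot\frac{X(\log\log X)^{k-1}}{\log X}.$$
   Context: $\phi(m)$ is Euler's totient function and $\omega(n)$ is the number of distinct prime factors of $n$. *)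

theory Defs
  imports
    Complex_Main
    "HOL-Library.Landau_Symbols"
    "HOL-Computational_Algebra.Squarefree"
    "HOL-Number_Theory.Number_Theory"
begin

definition omega :: "nat \<Rightarrow> nat" where
  "omega n = card (prime_factors n)"

text \<open>
  The \<open>j\<close>-th standard representative \<open>r\<^sub>j\<close> of the unit group of the integers modulo \<open>m\<close>, in
  increasing order; meaningful for \<open>1 \<le> j \<le> totient m\<close>, and the index is 1-based. For \<open>m > 1\<close>
  all elements of \<open>totatives m\<close> are smaller than \<open>m\<close>.
\<close>
definition unit_rep :: "nat \<Rightarrow> nat \<Rightarrow> nat" where
  "unit_rep m j = sorted_list_of_set (totatives m) ! (j - 1)"

lemma strict_mono_on_unit_rep: "strict_mono_on {1..totient m} (unit_rep m)"
  by (rule strict_mono_onI)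
     (auto simp: unit_rep_def totient_def intro!: sorted_wrt_nth_less[of "(<)"])

lemma image_unit_rep: "unit_rep m ` {1..totient m} = totatives m"
proof -
  let ?xs = "sorted_list_of_set (totatives m)"
  have "unit_rep m ` {1..totient m} = (!) ?xs ` ((\<lambda>j. j - 1) ` {1..totient m})"
    by (simp add: unit_rep_def image_image)
  also have "(\<lambda>j. j - 1) ` {1..totient m} = {..<length ?xs}"
    by (force simp: totient_def image_iff Bex_def intro: exI[of _ "Suc _"])
  also have "(!) ?xs ` {..<length ?xs} = set ?xs"
    by (auto simp: set_conv_nth)
  finally show ?thesis by simp
qed

text \<open>The counting function \<open>\<pi>\<^sub>k(X; m; a\<^sub>1, \<dots>)\<close>; only the values \<open>a j\<close> with
  \<open>1 \<le> j \<le> totient m\<close> matter.\<close>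
definition pi_count :: "nat \<Rightarrow> real \<Rightarrow> nat \<Rightarrow> (nat \<Rightarrow> nat) \<Rightarrow> nat" where
  "pi_count k X m a = card {n :: nat. n > 0 \<and> real n \<le> X \<and> squarefree n \<and> omega n = k \<and>
     (\<forall>j\<in>{1..totient m}. card {p \<in> prime_factors n. [p = unit_rep m j] (mod m)} = a j)}"

end

theory Submission
  imports "HOL-Complex_Analysis.Complex_Analysis" "HOL-Real_Asymp.Real_Asymp" Defs
begin

text \<open>
  Write \<open>\<delta> = 1 / \<phi>(m)\<close> and let \<open>N\<^sub>a(X)\<close> be the set of \<open>n \<le> X\<close> that are counted. Since \<open>ln n\<close> is the sum of \<open>ln p\<close>
  over the primes \<open>p\<close> dividing a square-free \<open>n\<close>, removing one prime factor in every possible way gives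
  \<open>\<Sum> ln n = \<Sum>\<^sub>j \<Sum>\<^sub>n' (\<theta>\<^sub>j(X / n') + O(ln (X / n')))\<close>, where \<open>n\<close> runs over \<open>N\<^sub>a(X)\<close>, \<open>n'\<close> over \<open>N\<^sub>b(X)\<close> with \<open>b\<close> obtained
  from \<open>a\<close> by lowering \<open>a\<^sub>j\<close> by one, and \<open>\<theta>\<^sub>j\<close> is Chebyshev's function of the \<open>j\<close>-th residue class. As \<open>\<theta>\<^sub>j(y) \<sim> \<delta> y\<close>, the
  right-hand side is asymptotic to \<open>\<delta> X\<close> times the sum over \<open>j\<close> of \<open>\<Sum> 1 / n'\<close>, and the same removal of a prime factor
  shows by induction that \<open>\<Sum> 1 / n\<close> over \<open>N\<^sub>a(X)\<close> is asymptotic to \<open>(\<delta> ln (ln X))\<^sup>k / (a\<^sub>1! a\<^sub>2! \<dots>)\<close>. Nearly all \<open>n \<le> X\<close>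
  have \<open>ln n \<sim> ln X\<close>, so that dividing by \<open>ln X\<close> yields the count.

  The relation \<open>\<theta>\<^sub>j(y) \<sim> \<delta> y\<close> is the prime number theorem in arithmetic progressions. It is obtained from Newman's
  Tauberian theorem, the non-vanishing of \<open>L(s, \<xi>)\<close> on \<open>Re s = 1\<close> by the \<open>3 + 4 cos t + cos 2t\<close> inequality, and, for
  a real character at \<open>s = 1\<close>, Monsky's argument with the Lambert series \<open>\<Sum> \<xi>(n) t\<^sup>n / (1 - t\<^sup>n)\<close>.
\<close>

section \<open>Chebyshev's upper bound\<close>

text \<open>The weight \<open>ln n\<close> linearizes the problem. An unweighted count would bring
  in the number of primes up to \<open>X / n'\<close>, and its factor \<open>1 / ln (X / n')\<close>
  would have to be tracked through an induction; with the weight only \<theta>(X / n') appears, the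
  sum over \<open>n'\<close> becomes a pure sum of reciprocals, and a single division by
  \<open>ln X\<close> remains. The obstacle is that the prime number theorem enters without a rate
  and says nothing while \<open>X / n'\<close> stays bounded. For such \<open>n'\<close> Chebyshev's
  bound is used; it costs a constant times \<open>X\<close> times the sum of \<open>1 / n'\<close>
  over \<open>X / Y < n' \<le> X\<close>, which is of lower order because
  \<open>ln (ln (X / Y))\<close> is asymptotic to \<open>ln (ln X)\<close> for fixed
  \<open>Y\<close>. As for the constant: lowering \<open>a j\<close> by one multiplies the
  coefficient of the reciprocal sum by \<open>a j / \<delta>\<close>, so class \<open>j\<close>
  contributes \<open>a j\<close> times one common constant, and since the \<open>a j\<close> add up
  to \<open>k\<close>, the total is \<open>k\<close> times the coefficient belonging to
  \<open>a\<close>. As \<open>k = k! / (k - 1)!\<close>, this is the multinomial coefficient times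
  \<open>\<delta> ^ k / (k - 1)!\<close>.\<close>

lemma middle_binomial_le: "(2 * k + 1) choose k \<le> 4 ^ k"
proof -
  have "((2 * k + 1) choose k) + ((2 * k + 1) choose (k + 1)) = (\<Sum>i\<in>{k, k + 1}. (2 * k + 1) choose i)"
    by simp
  also have "\<dots> \<le> (\<Sum>i\<le>2 * k + 1. (2 * k + 1) choose i)"
    by (rule sum_mono2) auto
  also have "\<dots> = 2 * 4 ^ k"
    unfolding choose_row_sum by (simp add: power_mult)
  finally have "((2 * k + 1) choose k) + ((2 * k + 1) choose (k + 1)) \<le> 2 * 4 ^ k" .
  moreover have "(2 * k + 1) choose (k + 1) = (2 * k + 1) choose k"
    using binomial_symmetric[of k "2 * k + 1"] by simp
  ultimately show ?thesis by linarith
qed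

lemma prod_primes_dvd:
  fixes n :: nat
  assumes "finite A" "\<And>p. p \<in> A \<Longrightarrow> prime p" "\<And>p. p \<in> A \<Longrightarrow> p dvd n"
  shows "\<Prod>A dvd n"
  using assms
proof (induction A rule: finite_induct)
  case (insert p A)
  have "coprime p (\<Prod>A)"
    using insert by (intro prod_coprime_right primes_coprime) auto
  then show ?case using insert by (simp add: divides_mult)
qed simp

text \<open>Erdos' induction: an even \<open>n > 2\<close> is not prime and adds nothing. For
  \<open>n = 2 * k + 1\<close> the primes in \<open>(k + 1, 2 * k + 1]\<close> divide the numerator
  of \<open>(2 * k + 1) choose k\<close> but not the denominator, so their product is at most
  \<open>4 ^ k\<close>; the remaining primes are covered by the case \<open>k + 1\<close>.\<close>

lemma primorial_le: "(\<Prod>p | prime p \<and> p \<le> n. p) \<le> (4::nat) ^ n"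
proof (induction n rule: less_induct)
  case (less n)
  have "n \<le> 1 \<or> n = 2 \<or> n > 2 \<and> even n \<or> (\<exists>k. n = 2 * k + 1 \<and> k \<ge> 1)"
    by presburger
  then consider "n \<le> 1" | "n = 2" | "n > 2" "even n" | k where "n = 2 * k + 1" "k \<ge> 1"
    by blast
  then show ?case
  proof cases
    case 1
    then have "{p. prime p \<and> p \<le> n} = {}"
      by (auto dest: prime_ge_2_nat)
    then show ?thesis by (simp only: prod.empty) simp
  next
    case 2
    then have "{p. prime p \<and> p \<le> n} = {2}"
      by (auto dest: prime_ge_2_nat)
    then show ?thesis using 2 by simp
  next
    case 3
    then have "\<not> prime n" using prime_odd_nat by blast
    have "p \<le> n \<longleftrightarrow> p \<le> n - 1" if "prime p" for p
      using \<open>\<not> prime n\<close> that 3 by (cases "p = n") auto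
    then have "{p. prime p \<and> p \<le> n} = {p. prime p \<and> p \<le> n - 1}" by blast
    then have "(\<Prod>p | prime p \<and> p \<le> n. p) \<le> 4 ^ (n - 1)"
      using less.IH[of "n - 1"] 3 by simp
    also have "\<dots> \<le> 4 ^ n" by (rule power_increasing) auto
    finally show ?thesis .
  next
    case 4
    let ?A = "{p. prime p \<and> p \<le> k + 1}" and ?B = "{p. prime p \<and> k + 1 < p \<and> p \<le> 2 * k + 1}"
    let ?c = "(2 * k + 1) choose k"
    have "\<Prod>?B dvd ?c"
    proof (rule prod_primes_dvd)
      fix p assume p: "p \<in> ?B"
      have "fact k * fact (k + 1) * ?c = (fact (2 * k + 1) :: nat)"
        using binomial_fact_lemma[of k "2 * k + 1"] by simp
      moreover have "p dvd fact (2 * k + 1)" using p by (auto simp only: prime_dvd_fact_iff mem_Collect_eq)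
      ultimately have "p dvd fact k * fact (k + 1) * ?c" by simp
      moreover have "\<not> p dvd fact k" "\<not> p dvd fact (k + 1)"
        using p by (auto simp only: prime_dvd_fact_iff mem_Collect_eq)
      ultimately show "p dvd ?c" using p by (auto simp only: prime_dvd_mult_iff mem_Collect_eq)
    qed auto
    moreover have "?c > 0" by simp
    ultimately have "\<Prod>?B \<le> ?c" by (rule dvd_imp_le)
    then have B: "\<Prod>?B \<le> 4 ^ k"
      using middle_binomial_le[of k] by (rule order.trans)
    have A: "\<Prod>?A \<le> 4 ^ (k + 1)" using less.IH[of "k + 1"] 4 by simp
    have "{p. prime p \<and> p \<le> n} = ?A \<union> ?B" using 4 by auto
    then have "(\<Prod>p | prime p \<and> p \<le> n. p) = \<Prod>?A * \<Prod>?B"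
      by (simp only:) (rule prod.union_disjoint, auto)
    also have "\<dots> \<le> 4 ^ (k + 1) * 4 ^ k"
      by (rule mult_le_mono[OF A B])
    also have "\<dots> = 4 ^ n" using 4 by (simp add: mult_2 power_add)
    finally show ?thesis .
  qed
qed

text \<open>Serves both as the boundedness hypothesis of the Tauberian theorem and as control of
  \<theta> where its asymptotics give no information. The 2 rounds up
  \<open>ln 4 = 2 * ln 2\<close>.\<close>

lemma theta_le: "(\<Sum>p | prime p \<and> p \<le> n. ln (real p)) \<le> 2 * real n"
proof -
  have "(\<Sum>p | prime p \<and> p \<le> n. ln (real p)) = ln (\<Prod>p | prime p \<and> p \<le> n. real p)"
    by (rule ln_prod[symmetric]) (auto dest: prime_gt_0_nat)
  also have "\<dots> \<le> ln (4 ^ n)"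
  proof (rule ln_mono)
    have "real (\<Prod>p | prime p \<and> p \<le> n. p) \<le> real (4 ^ n)"
      using primorial_le[of n] by (rule of_nat_mono)
    then show "(\<Prod>p | prime p \<and> p \<le> n. real p) \<le> 4 ^ n" by simp
  qed (auto intro!: prod_pos dest: prime_gt_0_nat)
  also have "\<dots> = real n * (2 * ln 2)" using ln_realpow[of 2 2] by (simp add: ln_realpow)
  also have "ln (2::real) \<le> 1" using ln_add_one_self_le_self[of 1] by simp
  finally show ?thesis by (simp add: mult_left_mono)
qed

section \<open>Dirichlet characters\<close>

text \<open>Characters live on all of \<open>nat\<close>, extended by zero to arguments that share a
  factor with \<open>m\<close>, so that multiplicativity holds without side conditions.\<close>

definition dchar :: "nat \<Rightarrow> (nat \<Rightarrow> complex) set" where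
  "dchar m = {\<xi>. \<xi> 1 = 1 \<and> (\<forall>a b. \<xi> (a * b) = \<xi> a * \<xi> b) \<and> (\<forall>a b. [a = b] (mod m) \<longrightarrow> \<xi> a = \<xi> b) \<and>
    (\<forall>a. \<xi> a = 0 \<longleftrightarrow> \<not> coprime a m)}"

definition chi0 :: "nat \<Rightarrow> nat \<Rightarrow> complex" where
  "chi0 m a = (if coprime a m then 1 else 0)"

text \<open>\<open>H\<close> is a subgroup of the units modulo \<open>m\<close>, represented by the
  union of its residue classes. Closure under inverses follows, since the inverse of
  \<open>a\<close> is congruent to a power of \<open>a\<close>.\<close>

definition partial_char :: "nat \<Rightarrow> nat set \<Rightarrow> (nat \<Rightarrow> complex) \<Rightarrow> bool" where
  "partial_char m H \<xi> \<longleftrightarrow> 1 \<in> H \<and> \<xi> 1 = 1 \<and> (\<forall>a\<in>H. coprime a m) \<and>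
    (\<forall>a\<in>H. \<forall>b\<in>H. a * b \<in> H \<and> \<xi> (a * b) = \<xi> a * \<xi> b) \<and> (\<forall>a\<in>H. \<forall>b. [a = b] (mod m) \<longrightarrow> b \<in> H \<and> \<xi> b = \<xi> a)"

lemma dcharD:
  assumes "\<xi> \<in> dchar m"
  shows "\<xi> 1 = 1" "\<xi> (a * b) = \<xi> a * \<xi> b" "[a = b] (mod m) \<Longrightarrow> \<xi> a = \<xi> b" "\<xi> a = 0 \<longleftrightarrow> \<not> coprime a m"
  using assms by (auto simp: dchar_def)

lemma dchar_power: "\<xi> \<in> dchar m \<Longrightarrow> \<xi> (a ^ n) = \<xi> a ^ n"
  by (induction n) (simp_all add: dcharD(1)[simplified] dcharD(2))

section \<open>Extension of characters from a subgroup of the units\<close>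

lemma partial_charD:
  assumes "partial_char m H \<xi>"
  shows "1 \<in> H" "\<xi> 1 = 1" "a \<in> H \<Longrightarrow> coprime a m" "a \<in> H \<Longrightarrow> b \<in> H \<Longrightarrow> a * b \<in> H"
    "a \<in> H \<Longrightarrow> b \<in> H \<Longrightarrow> \<xi> (a * b) = \<xi> a * \<xi> b" "a \<in> H \<Longrightarrow> [a = b] (mod m) \<Longrightarrow> b \<in> H"
    "a \<in> H \<Longrightarrow> [a = b] (mod m) \<Longrightarrow> \<xi> b = \<xi> a"
  using assms unfolding partial_char_def by blast+

lemma partial_char_power:
  assumes "partial_char m H \<xi>" "a \<in> H"
  shows "a ^ n \<in> H \<and> \<xi> (a ^ n) = \<xi> a ^ n"
proof (induction n)
  case 0
  then show ?case using partial_charD(1,2)[OF assms(1)] by simp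
next
  case (Suc n)
  then show ?case using partial_charD(4,5)[OF assms(1), of a "a ^ n"] assms(2) by simp
qed

lemma cong_power_totient_minus_1:
  fixes a m :: nat
  assumes "coprime a m" "m > 0"
  shows "[a * a ^ (totient m - 1) = 1] (mod m)"
proof -
  have "a * a ^ (totient m - 1) = a ^ totient m"
    using assms(2) by (simp flip: power_Suc)
  then show ?thesis using euler_theorem[OF assms(1)] by simp
qed

lemma partial_char_inverse:
  assumes "partial_char m H \<xi>" "a \<in> H" "m > 0"
  obtains b where "b \<in> H" "[a * b = 1] (mod m)"
proof
  show "a ^ (totient m - 1) \<in> H" using partial_char_power[OF assms(1,2)] by blast
  show "[a * a ^ (totient m - 1) = 1] (mod m)"
    using partial_charD(3)[OF assms(1,2)] assms(3) by (rule cong_power_totient_minus_1)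
qed

lemma partial_char_cancel:
  assumes "partial_char m H \<xi>" "a \<in> H" "m > 0" "[a * x = b] (mod m)" "b \<in> H"
  shows "x \<in> H"
proof -
  obtain c where c: "c \<in> H" "[a * c = 1] (mod m)"
    using partial_char_inverse[OF assms(1-3)] .
  have "[(a * x) * c = b * c] (mod m)" using assms(4) by (rule cong_scalar_right)
  moreover have "[(a * c) * x = 1 * x] (mod m)" using c(2) by (rule cong_scalar_right)
  moreover have "a * x * c = a * c * x" by simp
  ultimately have "[b * c = x] (mod m)" by (metis cong_sym cong_trans mult_1)
  then show ?thesis using partial_charD(4,6)[OF assms(1)] assms(5) c(1) by blast
qed

text \<open>Adjoins to \<open>H\<close> one element \<open>g\<close> whose order modulo
  \<open>H\<close> is \<open>n\<close>. Any \<open>n\<close>-th root of \<open>\<xi> (g ^ n)\<close>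
  is admissible as the value at \<open>g\<close>; this freedom later produces a character that
  differs from 1 at a prescribed residue.\<close>

lemma partial_char_extend:
  assumes pc: "partial_char m H \<xi>" and m: "m > 0" and g: "coprime g m"
    and n: "n > 0" "g ^ n \<in> H" "\<And>d. 0 < d \<Longrightarrow> d < n \<Longrightarrow> g ^ d \<notin> H" and z: "z ^ n = \<xi> (g ^ n)"
  obtains H' \<xi>' where "partial_char m H' \<xi>'" "H \<subseteq> H'" "\<And>h. h \<in> H \<Longrightarrow> \<xi>' h = \<xi> h" "g \<in> H'" "\<xi>' g = z"
proof -
  note pcD = partial_charD[OF pc] and pw = partial_char_power[OF pc]
  have dvd: "n dvd d" if "g ^ d \<in> H" for d
  proof -
    have "g ^ d = (g ^ n) ^ (d div n) * g ^ (d mod n)"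
      by (simp flip: power_mult power_add)
    then have "g ^ (d mod n) \<in> H"
      using partial_char_cancel[OF pc _ m _ that, of "(g ^ n) ^ (d div n)"] pw[OF n(2)] by simp
    then have "d mod n = 0" using n(3)[of "d mod n"] n(1) by auto
    then show ?thesis by auto
  qed
  \<comment> \<open>An element of the enlarged group has many representations
    \<open>h * g ^ i\<close>. The exponents of two of them differ by a multiple of \<open>n\<close>,
    and \<open>z ^ n = \<xi> (g ^ n)\<close> absorbs the difference. The assumption
    \<open>i \<le> j\<close> keeps the exponent \<open>j - i\<close> a genuine difference.\<close>
  have wd_aux: "\<xi> h * z ^ i = \<xi> h' * z ^ j" if h: "h \<in> H" "h' \<in> H" "[h * g ^ i = h' * g ^ j] (mod m)" "i \<le> j" for h h' i j
  proof -
    have "g ^ j = g ^ (j - i) * g ^ i" using that(4) by (simp flip: power_add)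
    then have "[h * g ^ i = (h' * g ^ (j - i)) * g ^ i] (mod m)" using h(3) by (simp add: mult.assoc)
    moreover have "coprime (g ^ i) m" using g by simp
    ultimately have c: "[h = h' * g ^ (j - i)] (mod m)" by (simp add: cong_mult_rcancel_nat)
    then have "g ^ (j - i) \<in> H" using partial_char_cancel[OF pc h(2) m _ h(1)] by (simp add: cong_sym)
    then obtain q where q: "j - i = n * q" using dvd by auto
    have gq: "g ^ (j - i) = (g ^ n) ^ q" by (simp add: q power_mult)
    have "\<xi> h = \<xi> (h' * g ^ (j - i))"
      using pcD(7)[OF h(1) c] by simp
    also have "\<dots> = \<xi> h' * z ^ (j - i)"
      using pcD(5)[OF h(2) \<open>g ^ (j - i) \<in> H\<close>] pw[OF n(2), of q] unfolding gq by (simp add: z[symmetric] q power_mult)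
    finally show ?thesis using that(4) by (simp add: mult.assoc flip: power_add)
  qed
  have wd: "\<xi> h * z ^ i = \<xi> h' * z ^ j" if "h \<in> H" "h' \<in> H" "[h * g ^ i = h' * g ^ j] (mod m)" for h h' i j
    using wd_aux[OF that] wd_aux[OF that(2,1) cong_sym[OF that(3)]] by (metis nle_le)
  define H' where "H' = {x. \<exists>h\<in>H. \<exists>i. [x = h * g ^ i] (mod m)}"
  define \<xi>' where "\<xi>' x = (SOME w. \<exists>h\<in>H. \<exists>i. [x = h * g ^ i] (mod m) \<and> w = \<xi> h * z ^ i)" for x
  have eq: "\<xi>' x = \<xi> h * z ^ i" if "h \<in> H" "[x = h * g ^ i] (mod m)" for x h i
    unfolding \<xi>'_def
  proof (rule some_equality)
    fix w assume "\<exists>h\<in>H. \<exists>i. [x = h * g ^ i] (mod m) \<and> w = \<xi> h * z ^ i"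
    then obtain h' j where "h' \<in> H" "[x = h' * g ^ j] (mod m)" "w = \<xi> h' * z ^ j" by blast
    then show "w = \<xi> h * z ^ i" using wd[OF that(1), of h' i j] that(2) by (metis cong_sym cong_trans)
  qed (use that in blast)
  show thesis
  proof (rule that)
    show ext: "\<xi>' h = \<xi> h" if "h \<in> H" for h using eq[of h h 0] that by simp
    show "H \<subseteq> H'" unfolding H'_def using cong_refl by (force intro: exI[of _ 0])
    have "[g = 1 * g ^ 1] (mod m)" by simp
    then show "g \<in> H'" "\<xi>' g = z" using eq[OF pcD(1), of g 1] pcD(1,2) unfolding H'_def by (blast, simp)
    show "partial_char m H' \<xi>'"
      unfolding partial_char_def
    proof (intro conjI ballI allI impI)
      show "1 \<in> H'" using \<open>H \<subseteq> H'\<close> pcD(1) by blast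
      show "\<xi>' 1 = 1" using ext pcD(1,2) by simp
    next
      fix a assume "a \<in> H'"
      then obtain h i where "h \<in> H" "[a = h * g ^ i] (mod m)" by (auto simp: H'_def)
      moreover have "coprime (h * g ^ i) m" using pcD(3)[OF \<open>h \<in> H\<close>] g by simp
      ultimately show "coprime a m" by (metis cong_imp_coprime cong_sym)
    next
      fix a b assume "a \<in> H'" "b \<in> H'"
      then obtain h i h' j where h: "h \<in> H" "[a = h * g ^ i] (mod m)" "h' \<in> H" "[b = h' * g ^ j] (mod m)"
        by (auto simp: H'_def)
      have "[a * b = (h * g ^ i) * (h' * g ^ j)] (mod m)" using h by (intro cong_mult)
      then have ab: "[a * b = (h * h') * g ^ (i + j)] (mod m)" by (simp add: power_add mult_ac)
      show "a * b \<in> H'" using ab pcD(4)[OF h(1,3)] unfolding H'_def by blast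
      show "\<xi>' (a * b) = \<xi>' a * \<xi>' b"
        using eq[OF pcD(4)[OF h(1,3)] ab] eq[OF h(1,2)] eq[OF h(3,4)] pcD(5)[OF h(1,3)]
        by (simp add: power_add mult_ac)
    next
      fix a b assume "a \<in> H'" and ab: "[a = b] (mod m)"
      then obtain h i where h: "h \<in> H" "[a = h * g ^ i] (mod m)" by (auto simp: H'_def)
      have b: "[b = h * g ^ i] (mod m)" using h(2) ab by (metis cong_sym cong_trans)
      then show "b \<in> H'" using h(1) unfolding H'_def by blast
      show "\<xi>' b = \<xi>' a" using eq[OF h(1) b] eq[OF h] by simp
    qed
  qed
qed

lemma complex_nth_root_exists:
  assumes "w \<noteq> 0" "n > 0"
  obtains z :: complex where "z ^ n = w"
proof
  show "exp (Ln w / of_nat n) ^ n = w"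
    using assms by (simp add: exp_of_nat_mult[symmetric])
qed

text \<open>Missing residues are adjoined one at a time; the induction runs over the number of
  reduced residues below \<open>m\<close> that lie outside \<open>H\<close>.\<close>

lemma partial_char_extend_full:
  assumes "m > 0" "partial_char m H \<xi>"
  shows "\<exists>\<xi>'. partial_char m {x. coprime x m} \<xi>' \<and> (\<forall>h\<in>H. \<xi>' h = \<xi> h)"
  using assms(2)
proof (induction "card ({x. x < m \<and> coprime x m} - H)" arbitrary: H \<xi> rule: less_induct)
  case less
  note pcD = partial_charD[OF less.prems]
  show ?case
  proof (cases "{x. coprime x m} \<subseteq> H")
    case True
    then have "H = {x. coprime x m}" using pcD(3) by blast
    then show ?thesis using less.prems by blast
  next
    case False
    then obtain g0 where g0: "coprime g0 m" "g0 \<notin> H" by blast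
    \<comment> \<open>Reduction modulo \<open>m\<close> puts the new element into the finite set
      that the induction counts.\<close>
    define g where "g = g0 mod m"
    have gg0: "[g = g0] (mod m)" by (simp add: g_def cong_def)
    have g: "coprime g m" "g \<notin> H" "g < m"
      using g0 gg0 pcD(6) assms(1) by (auto simp: g_def cong_def)
    have "g * g ^ (totient m - 1) = g ^ totient m"
      using assms(1) by (simp flip: power_Suc)
    then have "[1 = g ^ totient m] (mod m)"
      using cong_power_totient_minus_1[OF g(1) assms(1)] by (simp add: cong_sym)
    then have ex: "totient m > 0 \<and> g ^ totient m \<in> H"
      using pcD(6)[OF pcD(1)] assms(1) by simp
    define n where "n = (LEAST n. n > 0 \<and> g ^ n \<in> H)"
    have n: "n > 0 \<and> g ^ n \<in> H" unfolding n_def using ex by (rule LeastI)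
    have nmin: "g ^ d \<notin> H" if "0 < d" "d < n" for d
      using not_less_Least[of d "\<lambda>n. n > 0 \<and> g ^ n \<in> H"] that by (auto simp: n_def)
    obtain c where c: "c \<in> H" "[g ^ n * c = 1] (mod m)"
      using partial_char_inverse[OF less.prems _ assms(1)] n by blast
    have "\<xi> (g ^ n) * \<xi> c = 1"
      using pcD(5)[of "g ^ n" c] pcD(7)[OF pcD(1), of "g ^ n * c"] c n pcD(2) by (simp add: cong_sym)
    then have "\<xi> (g ^ n) \<noteq> 0" by auto
    then obtain z where z: "z ^ n = \<xi> (g ^ n)"
      using complex_nth_root_exists n by blast
    obtain H' \<xi>' where H': "partial_char m H' \<xi>'" "H \<subseteq> H'" "\<And>h. h \<in> H \<Longrightarrow> \<xi>' h = \<xi> h" "g \<in> H'"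
      using partial_char_extend[OF less.prems assms(1) g(1) _ _ nmin z] n by metis
    have "{x. x < m \<and> coprime x m} - H' \<subset> {x. x < m \<and> coprime x m} - H"
      using H'(2,4) g by blast
    then have "card ({x. x < m \<and> coprime x m} - H') < card ({x. x < m \<and> coprime x m} - H)"
      by (intro psubset_card_mono) auto
    then obtain \<xi>'' where "partial_char m {x. coprime x m} \<xi>''" "\<forall>h\<in>H'. \<xi>'' h = \<xi>' h"
      using less.hyps H'(1) by blast
    then show ?thesis using H'(2,3) by (intro exI[of _ \<xi>'']) auto
  qed
qed

text \<open>The trivial character of the trivial subgroup is extended to the group generated by
  \<open>a\<close>. The order \<open>n\<close> of \<open>a\<close> is at least 2, so
  \<open>a\<close> can be sent to the primitive root of unity \<open>cis (2 * pi / n)\<close>, and a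
  further extension reaches all units.\<close>

lemma exists_dchar_neq_1:
  assumes m: "m > 0" and a: "coprime a m" "\<not> [a = 1] (mod m)"
  obtains \<xi> where "\<xi> \<in> dchar m" "\<xi> a \<noteq> 1"
proof -
  define H where "H = {x. [x = 1] (mod m)}"
  have pc: "partial_char m H (\<lambda>_. 1)"
    unfolding partial_char_def H_def using cong_mult[of _ 1 m _ 1]
    by (auto intro: cong_sym cong_trans dest: cong_imp_coprime[OF cong_sym])
  define n where "n = (LEAST n. n > 0 \<and> a ^ n \<in> H)"
  have "totient m > 0 \<and> a ^ totient m \<in> H"
    using euler_theorem[OF a(1)] m by (simp add: H_def)
  then have n: "n > 0 \<and> a ^ n \<in> H" unfolding n_def by (rule LeastI)
  have nmin: "a ^ d \<notin> H" if "0 < d" "d < n" for d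
    using not_less_Least[of d "\<lambda>n. n > 0 \<and> a ^ n \<in> H"] that by (auto simp: n_def)
  have "n \<noteq> 1" using n a(2) by (auto simp: H_def)
  with n have n2: "n \<ge> 2" by linarith
  define z where "z = cis (2 * pi / real n)"
  have zn: "z ^ n = 1" using n by (simp add: z_def Complex.DeMoivre)
  have "z \<noteq> 1"
  proof
    assume "z = 1"
    then have "cos (2 * pi / real n) = 1" by (metis z_def cis.simps(1) one_complex.simps(1))
    then obtain k :: int where k: "2 * pi / real n = of_int k * 2 * pi"
      using cos_one_2pi_int[of "2 * pi / real n"] by auto
    then have "1 = real_of_int (k * int n)" using n by (simp add: field_simps)
    then have "k * int n = 1" by linarith
    then have "int n dvd 1" by (metis dvd_triv_right)
    then show False using n2 by simp
  qed
  obtain H' \<xi>' where H': "partial_char m H' \<xi>'" "a \<in> H'" "\<xi>' a = z"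
    using partial_char_extend[OF pc m a(1) _ _ nmin, where z = z] n zn by metis
  obtain \<xi> where \<xi>: "partial_char m {x. coprime x m} \<xi>" "\<xi> a = z"
    using partial_char_extend_full[OF m H'(1)] H'(2,3) by blast
  note pcD = partial_charD[OF \<xi>(1)]
  define \<psi> where "\<psi> x = (if coprime x m then \<xi> x else 0)" for x
  have nz: "\<xi> x \<noteq> 0" if cx: "coprime x m" for x
  proof -
    obtain c where c: "coprime c m" "[x * c = 1] (mod m)"
      by (rule partial_char_inverse[OF \<xi>(1) _ m, of x]) (use cx in auto)
    then have "\<xi> x * \<xi> c = 1"
      using pcD(5)[of x c] pcD(7)[of 1 "x * c"] pcD(2) that by (simp add: cong_sym)
    then show ?thesis by auto
  qed
  have "\<psi> \<in> dchar m"
    unfolding dchar_def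
  proof (intro CollectI conjI allI impI)
    show "\<psi> 1 = 1" using pcD(2) by (simp add: \<psi>_def)
    show "\<psi> (a * b) = \<psi> a * \<psi> b" for a b
      using pcD(5)[of a b] by (auto simp: \<psi>_def)
    show "\<psi> a = \<psi> b" if "[a = b] (mod m)" for a b
      using pcD(7)[of a b] that cong_imp_coprime[OF that] cong_imp_coprime[OF cong_sym[OF that]]
      by (auto simp: \<psi>_def)
    show "\<psi> a = 0 \<longleftrightarrow> \<not> coprime a m" for a using nz[of a] by (auto simp: \<psi>_def)
  qed
  moreover have "\<psi> a \<noteq> 1" using a(1) \<xi>(2) \<open>z \<noteq> 1\<close> by (simp add: \<psi>_def)
  ultimately show thesis using that by blast
qed

section \<open>Finiteness and orthogonality of the Dirichlet characters\<close>

lemma chi0_in_dchar: "m > 0 \<Longrightarrow> chi0 m \<in> dchar m"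
  unfolding dchar_def chi0_def
  by (auto dest: cong_imp_coprime cong_imp_coprime[OF cong_sym])

lemma dchar_mod: "\<xi> \<in> dchar m \<Longrightarrow> \<xi> (a mod m) = \<xi> a"
  by (rule dcharD(3)[of _ m]) (simp_all add: cong_def)

lemma dchar_power_totient:
  assumes "\<xi> \<in> dchar m" "coprime a m"
  shows "\<xi> a ^ totient m = 1"
  using dcharD(3)[OF assms(1) euler_theorem[OF assms(2)]] dcharD(1)[OF assms(1)] dchar_power[OF assms(1)]
  by simp

lemma norm_dchar:
  assumes "\<xi> \<in> dchar m" "m > 0"
  shows "norm (\<xi> a) = (if coprime a m then 1 else 0)"
proof (cases "coprime a m")
  case True
  have "norm (\<xi> a) ^ totient m = 1"
    using dchar_power_totient[OF assms(1) True] by (metis norm_one norm_power)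
  then have "norm (\<xi> a) = 1"
    using power_eq_imp_eq_base[of "norm (\<xi> a)" "totient m" 1] assms(2) by simp
  then show ?thesis using True by simp
qed (use dcharD(4)[OF assms(1)] in auto)

lemma norm_dchar_le: "\<xi> \<in> dchar m \<Longrightarrow> m > 0 \<Longrightarrow> norm (\<xi> a) \<le> 1"
  by (simp add: norm_dchar)

text \<open>Periodicity leaves \<open>m\<close> arguments, and each value is 0 or one of finitely
  many roots of unity.\<close>

lemma finite_dchar:
  assumes m: "m > 0"
  shows "finite (dchar m)"
proof (rule inj_on_finite)
  let ?V = "insert 0 {z::complex. z ^ totient m = 1}"
  show "inj_on (\<lambda>\<xi>. restrict \<xi> {..<m}) (dchar m)"
  proof (rule inj_onI, rule ext)
    fix \<xi> \<psi> x assume "\<xi> \<in> dchar m" "\<psi> \<in> dchar m" and eq: "restrict \<xi> {..<m} = restrict \<psi> {..<m}"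
    have "\<xi> (x mod m) = restrict \<xi> {..<m} (x mod m)" using m by simp
    also have "\<dots> = \<psi> (x mod m)" unfolding eq using m by simp
    finally show "\<xi> x = \<psi> x" using dchar_mod[OF \<open>\<xi> \<in> _\<close>, of x] dchar_mod[OF \<open>\<psi> \<in> _\<close>, of x] by simp
  qed
  show "(\<lambda>\<xi>. restrict \<xi> {..<m}) ` dchar m \<subseteq> {..<m} \<rightarrow>\<^sub>E ?V"
    using dchar_power_totient dcharD(4) by (intro image_subsetI, subst restrict_PiE_iff) auto
  show "finite ({..<m} \<rightarrow>\<^sub>E ?V)"
    using m by (intro finite_PiE finite.insertI finite_roots_unity) (auto simp: Suc_le_eq)
qed

lemma dchar_mult:
  assumes "\<xi> \<in> dchar m" "\<psi> \<in> dchar m"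
  shows "(\<lambda>a. \<xi> a * \<psi> a) \<in> dchar m"
  using assms unfolding dchar_def by auto

lemma dchar_neq_chi0:
  assumes "\<xi> \<in> dchar m" "\<xi> \<noteq> chi0 m"
  obtains c where "coprime c m" "\<xi> c \<noteq> 1"
  using assms dcharD(4)[OF assms(1)] unfolding chi0_def fun_eq_iff by metis

text \<open>Multiplication by a unit \<open>c\<close> with \<open>\<xi> c \<noteq> 1\<close>
  permutes the residues, so the sum equals \<open>\<xi> c\<close> times itself.\<close>

lemma sum_dchar_eq_0:
  assumes "\<xi> \<in> dchar m" "\<xi> \<noteq> chi0 m" "m > 0"
  shows "(\<Sum>a<m. \<xi> a) = 0"
proof -
  obtain c where c: "coprime c m" "\<xi> c \<noteq> 1" using dchar_neq_chi0[OF assms(1,2)] .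
  have inj: "inj_on (\<lambda>a. (c * a) mod m) {..<m}"
  proof (rule inj_onI)
    fix x y assume "x \<in> {..<m}" "y \<in> {..<m}" "c * x mod m = c * y mod m"
    then have "[c * x = c * y] (mod m)" by (simp add: cong_def)
    then have "[x = y] (mod m)" using c(1) by (simp add: cong_mult_lcancel_nat)
    then show "x = y" using \<open>x \<in> _\<close> \<open>y \<in> _\<close> by (simp add: cong_def)
  qed
  have "(\<lambda>a. (c * a) mod m) ` {..<m} = {..<m}"
    using inj assms(3) by (intro endo_inj_surj) auto
  then have "(\<Sum>a<m. \<xi> a) = (\<Sum>a<m. \<xi> ((c * a) mod m))"
    using inj by (intro sum.reindex_bij_betw[symmetric]) (simp add: bij_betw_def)
  also have "\<dots> = \<xi> c * (\<Sum>a<m. \<xi> a)"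
    by (simp add: dchar_mod[OF assms(1)] dcharD(2)[OF assms(1)] sum_distrib_left)
  finally show ?thesis using c(2) by simp
qed

lemma sum_chi0: "m > 1 \<Longrightarrow> (\<Sum>a<m. chi0 m a) = of_nat (totient m)"
proof -
  assume m: "m > 1"
  have "(\<Sum>a<m. chi0 m a) = (\<Sum>a\<in>totatives m. 1)"
    unfolding chi0_def
  proof (rule sum.mono_neutral_cong_right)
    show "totatives m \<subseteq> {..<m}" using m totatives_less by auto
    show "\<forall>i\<in>{..<m} - totatives m. (if coprime i m then 1 else (0::complex)) = 0"
      using m by (auto simp: totatives_def intro!: Nat.gr0I)
  qed (auto simp: totatives_def)
  then show ?thesis by (simp add: totient_def)
qed

text \<open>The dual argument: multiplication by a character \<open>\<psi>\<close> with
  \<open>\<psi> a \<noteq> 1\<close> permutes \<open>dchar m\<close>. The existence of such a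
  \<open>\<psi>\<close> is what the extension lemmas were for.\<close>

lemma sum_over_dchar:
  assumes m: "m > 0" and a: "coprime a m"
  shows "(\<Sum>\<xi>\<in>dchar m. \<xi> a) = (if [a = 1] (mod m) then of_nat (card (dchar m)) else 0)"
proof (cases "[a = 1] (mod m)")
  case True
  then have "\<xi> a = 1" if "\<xi> \<in> dchar m" for \<xi>
    using dcharD(3)[OF that True] dcharD(1)[OF that] by simp
  then have "(\<Sum>\<xi>\<in>dchar m. \<xi> a) = (\<Sum>\<xi>\<in>dchar m. 1)" by (rule sum.cong[OF refl])
  then show ?thesis using True by simp
next
  case False
  obtain \<psi> where \<psi>: "\<psi> \<in> dchar m" "\<psi> a \<noteq> 1" using exists_dchar_neq_1[OF m a False] .
  let ?f = "\<lambda>\<xi> x. \<psi> x * \<xi> x"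
  have inj: "inj_on ?f (dchar m)"
  proof (rule inj_onI, rule ext)
    fix \<xi> \<xi>' x assume *: "\<xi> \<in> dchar m" "\<xi>' \<in> dchar m" "?f \<xi> = ?f \<xi>'"
    have "\<psi> x * \<xi> x = \<psi> x * \<xi>' x" using fun_cong[OF *(3), of x] .
    then show "\<xi> x = \<xi>' x"
      using dcharD(4)[OF \<psi>(1), of x] dcharD(4)[OF *(1), of x] dcharD(4)[OF *(2), of x] by auto
  qed
  have "?f ` dchar m = dchar m"
    using inj finite_dchar[OF m] dchar_mult[OF \<psi>(1)] by (intro endo_inj_surj) auto
  then have "(\<Sum>\<xi>\<in>dchar m. \<xi> a) = (\<Sum>\<xi>\<in>dchar m. ?f \<xi> a)"
    using inj by (intro sum.reindex_bij_betw[symmetric, of ?f _ _ "\<lambda>\<xi>. \<xi> a"]) (simp add: bij_betw_def)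
  also have "\<dots> = \<psi> a * (\<Sum>\<xi>\<in>dchar m. \<xi> a)" by (simp add: sum_distrib_left)
  finally show ?thesis using \<psi>(2) False by simp
qed

text \<open>The double sum of \<open>\<xi> a\<close> over all residues and all characters is
  evaluated in both orders, once by each orthogonality relation.\<close>

lemma card_dchar:
  assumes m: "m > 1"
  shows "card (dchar m) = totient m"
proof -
  have "(\<Sum>a<m. \<Sum>\<xi>\<in>dchar m. \<xi> a) = (\<Sum>a<m. if a = 1 then of_nat (card (dchar m)) else 0)"
  proof (rule sum.cong)
    fix a assume a: "a \<in> {..<m}"
    show "(\<Sum>\<xi>\<in>dchar m. \<xi> a) = (if a = 1 then of_nat (card (dchar m)) else 0)"
    proof (cases "coprime a m")
      case True
      have "[a = 1] (mod m) \<longleftrightarrow> a = 1" using a m by (simp add: cong_def)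
      then show ?thesis using sum_over_dchar[of m a] True m by simp
    next
      case False
      then have "(\<Sum>\<xi>\<in>dchar m. \<xi> a) = 0" using dcharD(4) by (intro sum.neutral) blast
      moreover have "a \<noteq> 1" using False by auto
      ultimately show ?thesis by simp
    qed
  qed simp
  also have "\<dots> = of_nat (card (dchar m))" using m by (simp add: sum.delta')
  also have "(\<Sum>a<m. \<Sum>\<xi>\<in>dchar m. \<xi> a) = (\<Sum>\<xi>\<in>dchar m. \<Sum>a<m. \<xi> a)" by (rule sum.swap)
  also have "\<dots> = (\<Sum>\<xi>\<in>dchar m. if \<xi> = chi0 m then of_nat (totient m) else 0)"
    using sum_dchar_eq_0[of _ m] sum_chi0[of m] m by (intro sum.cong) auto
  also have "\<dots> = of_nat (totient m)"
    using chi0_in_dchar[of m] finite_dchar[of m] m by (simp add: sum.delta')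
  finally show ?thesis by (simp only: of_nat_eq_iff)
qed

text \<open>Complete periods sum to zero, so every partial sum equals one of length at most
  \<open>m\<close>.\<close>

lemma periodic_partial_sums_bounded:
  fixes f :: "nat \<Rightarrow> complex"
  assumes per: "\<And>a. f (m + a) = f a" and sum0: "(\<Sum>a<m. f a) = 0" and m: "m > 0"
  shows "norm (\<Sum>a<n. f a) \<le> (\<Sum>a<m. norm (f a))"
proof (induction n rule: less_induct)
  case (less n)
  show ?case
  proof (cases "n \<le> m")
    case True
    have "norm (\<Sum>a<n. f a) \<le> (\<Sum>a<n. norm (f a))" by (rule norm_sum)
    also have "\<dots> \<le> (\<Sum>a<m. norm (f a))" using True by (intro sum_mono2) auto
    finally show ?thesis .
  next
    case False
    have "(\<Sum>a<m + k. f a) = (\<Sum>a<m. f a) + (\<Sum>a<k. f a)" for k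
      by (induction k) (simp_all add: per)
    from this[of "n - m"] have "(\<Sum>a<n. f a) = (\<Sum>a<n - m. f a)" using False sum0 by simp
    then show ?thesis using less.IH[of "n - m"] False m by simp
  qed
qed

section \<open>Newman's Tauberian theorem\<close>

text \<open>Comparison with the integral of \<open>t powr (-1 - x)\<close>, done by telescoping with
  the mean value theorem. It bounds the tail of the Dirichlet series in the right
  half-plane.\<close>

lemma sum_Suc_powr_neg_le:
  fixes x :: real
  assumes "x > 0" "N > 0"
  shows "(\<Sum>n\<in>{N<..M}. real n powr (-1 - x)) \<le> real N powr (-x) / x"
proof -
  have powr_step: "real (Suc n) powr (-1 - x) \<le> (real n powr (-x) - real (Suc n) powr (-x)) / x" if "n > 0" for n
  proof -
    have "\<exists>z>real n. z < real (Suc n) \<and>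
        (real (Suc n) powr (-x) - real n powr (-x)) = (real (Suc n) - real n) * (-x * z powr (-x - 1))"
      using that by (intro MVT2) (auto intro!: derivative_eq_intros)
    then obtain z where z: "z > real n" "z < real (Suc n)"
      and eq: "real (Suc n) powr (-x) - real n powr (-x) = -x * z powr (-x - 1)" by auto
    have "real (Suc n) powr (-1 - x) \<le> z powr (-1 - x)"
      using z assms that by (intro powr_mono2') auto
    then have "x * real (Suc n) powr (-1 - x) \<le> x * z powr (-1 - x)"
      using assms by (intro mult_left_mono) auto
    moreover have "-x - 1 = -1 - x" by simp
    ultimately have "x * real (Suc n) powr (-1 - x) \<le> real n powr (-x) - real (Suc n) powr (-x)"
      using eq by (simp only:)
    then show ?thesis using assms by (simp add: field_simps del: of_nat_Suc)
  qed
  show ?thesis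
  proof (cases "N \<le> M")
    case True
    then have "(\<Sum>n\<in>{N<..M}. real n powr (-1 - x)) \<le> (real N powr (-x) - real M powr (-x)) / x"
    proof (induction M rule: dec_induct)
      case (step n)
      have "{N<..Suc n} = insert (Suc n) {N<..n}" using step by auto
      then have "(\<Sum>n\<in>{N<..Suc n}. real n powr (-1 - x)) = real (Suc n) powr (-1 - x) + (\<Sum>n\<in>{N<..n}. real n powr (-1 - x))"
        by simp
      also have "\<dots> \<le> (real n powr (-x) - real (Suc n) powr (-x)) / x + (real N powr (-x) - real n powr (-x)) / x"
        using step.hyps step.IH \<open>N > 0\<close> by (intro add_mono powr_step) auto
      also have "\<dots> = (real N powr (-x) - real (Suc n) powr (-x)) / x" by (simp add: diff_divide_distrib)
      finally show ?case .
    qed simp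
    also have "\<dots> \<le> real N powr (-x) / x" using assms by (simp add: divide_right_mono)
    finally show ?thesis .
  qed (use assms in auto)
qed

text \<open>The counterpart for partial sums in the left half-plane. The summand decreases for
  \<open>u \<le> 1\<close> and increases for \<open>u > 1\<close>; the extra
  \<open>real N powr (u - 1)\<close> pays for the last term in the increasing case.\<close>

lemma sum_powr_le:
  fixes u :: real
  assumes "u > 0" "N > 0"
  shows "(\<Sum>n\<in>{0<..N}. real n powr (u - 1)) \<le> real N powr u / u + real N powr (u - 1)"
proof -
  have mvt: "\<exists>z. z > real n \<and> z < real (Suc n) \<and> z powr (u - 1) = (real (Suc n) powr u - real n powr u) / u" for n
  proof -
    have "\<exists>z>real n. z < real (Suc n) \<and>
        (real (Suc n) powr u - real n powr u) = (real (Suc n) - real n) * (u * z powr (u - 1))"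
    proof (cases "n = 0")
      case False
      then show ?thesis
        by (intro MVT2) (auto intro!: derivative_eq_intros)
    next
      \<comment> \<open>At 0 the power function need not be differentiable, so this interval uses
        the form of the mean value theorem that asks only for continuity at the endpoints.\<close>
      case True
      have "\<exists>z. 0 < z \<and> z < 1 \<and> (1::real) powr u - 0 powr u = (1 - 0) * (u * z powr (u - 1))"
      proof -
        have "\<exists>l z. 0 < z \<and> z < 1 \<and> ((\<lambda>x. x powr u) has_real_derivative l) (at z) \<and>
            (1::real) powr u - 0 powr u = (1 - 0) * l"
        proof (rule MVT)
          show "continuous_on {0..1} (\<lambda>x::real. x powr u)"
            using assms by (intro continuous_on_powr') (auto intro!: continuous_intros)
          show "(\<lambda>x. x powr u) differentiable (at x)" if "0 < x" "x < 1" for x :: real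
            using that by (auto intro!: derivative_eq_intros simp: real_differentiable_def)
        qed auto
        then obtain l z where z: "0 < z" "z < 1" "((\<lambda>x. x powr u) has_real_derivative l) (at z)"
          "(1::real) powr u - 0 powr u = (1 - 0) * l" by blast
        have "((\<lambda>x. x powr u) has_real_derivative (u * z powr (u - 1))) (at z)"
          using z by (auto intro!: derivative_eq_intros)
        with z(3) have "l = u * z powr (u - 1)" by (rule DERIV_unique)
        with z show ?thesis by auto
      qed
      with True show ?thesis by simp
    qed
    then show ?thesis using assms by (auto simp: field_simps)
  qed
  show ?thesis
  proof (cases "u \<le> 1")
    case True
    have "(\<Sum>n\<in>{0<..N}. real n powr (u - 1)) \<le> real N powr u / u"
    proof (induction N)
      case (Suc n)
      obtain z where z: "z > real n" "z < real (Suc n)" "z powr (u - 1) = (real (Suc n) powr u - real n powr u) / u"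
        using mvt by blast
      have "real (Suc n) powr (u - 1) \<le> z powr (u - 1)"
        using z True by (intro powr_mono2') auto
      moreover have "{0<..Suc n} = insert (Suc n) {0<..n}" by auto
      ultimately show ?case using Suc z(3) by (simp add: diff_divide_distrib)
    qed simp
    then show ?thesis by (smt (verit) powr_ge_zero)
  next
    case False
    have "(\<Sum>n\<in>{0<..<N}. real n powr (u - 1)) \<le> real N powr u / u"
    proof (induction N)
      case (Suc n)
      obtain z where z: "z > real n" "z < real (Suc n)" "z powr (u - 1) = (real (Suc n) powr u - real n powr u) / u"
        using mvt by blast
      have "real n powr (u - 1) \<le> z powr (u - 1)"
        using z False by (intro powr_mono2) auto
      moreover have "{0<..<Suc n} = (if n = 0 then {} else insert n {0<..<n})" by auto
      ultimately show ?case using Suc z(3) by (auto simp add: diff_divide_distrib)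
    qed simp
    moreover have "{0<..N} = insert N {0<..<N}" using assms by auto
    ultimately show ?thesis by simp
  qed
qed

text \<open>Cauchy's formula on a rectangle, regrouped at the imaginary axis because the two halves
  are estimated by different means. The width \<open>d\<close> to the left is free: small for a
  function that extends only slightly across the axis, equal to \<open>R\<close> for the entire
  partial sums.\<close>

lemma contour_box_split:
  fixes f :: "complex \<Rightarrow> complex" and R d :: real
  assumes "R > 0" "d > 0" "f holomorphic_on U" "open U" "cbox (Complex (-d) (-R)) (Complex R R) \<subseteq> U"
  shows "contour_integral (linepath (Complex 0 (-R)) (Complex R (-R))) (\<lambda>z. f z / z) +
    contour_integral (linepath (Complex R (-R)) (Complex R R)) (\<lambda>z. f z / z) +
    contour_integral (linepath (Complex R R) (Complex 0 R)) (\<lambda>z. f z / z) +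
    (contour_integral (linepath (Complex 0 R) (Complex (-d) R)) (\<lambda>z. f z / z) +
    contour_integral (linepath (Complex (-d) R) (Complex (-d) (-R))) (\<lambda>z. f z / z) +
    contour_integral (linepath (Complex (-d) (-R)) (Complex 0 (-R))) (\<lambda>z. f z / z)) = 2 * pi * \<i> * f 0"
proof -
  let ?a = "Complex (-d) (-R)" and ?c = "Complex R R" and ?b = "Complex R (-R)" and ?d = "Complex (-d) R"
  let ?f = "\<lambda>z. f z / z"
  have holf: "f holomorphic_on cbox ?a ?c"
    using assms holomorphic_on_subset by blast
  have box: "0 \<in> box ?a ?c" using assms by (auto simp: in_box_complex_iff)
  have img: "path_image (rectpath ?a ?c) = cbox ?a ?c - box ?a ?c"
    using assms by (intro path_image_rectpath_cbox_minus_box) auto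
  have "((\<lambda>w. f w / (w - 0)) has_contour_integral (2 * pi * \<i> * winding_number (rectpath ?a ?c) 0 * f 0)) (rectpath ?a ?c)"
  proof (rule Cauchy_integral_formula_convex_simple)
    show "0 \<in> interior (cbox ?a ?c)" using box by (simp add: interior_cbox)
    show "path_image (rectpath ?a ?c) \<subseteq> cbox ?a ?c - {0}" using img box by auto
  qed (use holf in auto)
  then have "contour_integral (rectpath ?a ?c) ?f = 2 * pi * \<i> * f 0"
    using box by (auto dest!: contour_integral_unique simp: winding_number_rectpath)
  moreover have cont: "continuous_on S ?f" if "S \<subseteq> path_image (rectpath ?a ?c)" for S
  proof -
    have "0 \<notin> S" "S \<subseteq> cbox ?a ?c" using that img box by auto
    then show ?thesis using holomorphic_on_imp_continuous_on[OF holf]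
      by (auto intro!: continuous_intros elim: continuous_on_subset)
  qed
  have segs: "path_image (rectpath ?a ?c) = closed_segment ?a ?b \<union> closed_segment ?b ?c \<union> closed_segment ?c ?d \<union> closed_segment ?d ?a"
    by (simp add: rectpath_def Let_def path_image_join Un_assoc)
  have int: "?f contour_integrable_on (linepath x y)" if "closed_segment x y \<subseteq> path_image (rectpath ?a ?c)" for x y
    using that cont by (intro contour_integrable_continuous_linepath)
  have "contour_integral (rectpath ?a ?c) ?f = contour_integral (linepath ?a ?b) ?f +
      (contour_integral (linepath ?b ?c) ?f + (contour_integral (linepath ?c ?d) ?f + contour_integral (linepath ?d ?a) ?f))"
  proof -
    have "?f contour_integrable_on linepath ?a ?b" "?f contour_integrable_on linepath ?b ?c"
      "?f contour_integrable_on linepath ?c ?d" "?f contour_integrable_on linepath ?d ?a"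
      by (intro int; auto simp: segs)+
    then show ?thesis
      unfolding rectpath_def Let_def by (simp add: contour_integrable_joinI)
  qed
  moreover have "contour_integral (linepath ?a ?b) ?f =
      contour_integral (linepath ?a (Complex 0 (-R))) ?f + contour_integral (linepath (Complex 0 (-R)) ?b) ?f"
    using assms
    by (intro contour_integral_split_linepath cont) (auto simp: segs closed_segment_same_Im closed_segment_eq_real_ivl)
  moreover have "contour_integral (linepath ?c ?d) ?f =
      contour_integral (linepath ?c (Complex 0 R)) ?f + contour_integral (linepath (Complex 0 R) ?d) ?f"
    using assms
    by (intro contour_integral_split_linepath cont) (auto simp: segs closed_segment_same_Im closed_segment_eq_real_ivl)
  ultimately show ?thesis by (simp add: add_ac)
qed

lemma norm_contour_three_linepaths_le:
  fixes f :: "complex \<Rightarrow> complex"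
  assumes "f contour_integrable_on linepath p q" "f contour_integrable_on linepath q r"
    "f contour_integrable_on linepath r s"
  assumes "\<And>z. z \<in> closed_segment p q \<union> closed_segment r s \<Longrightarrow> norm (f z) \<le> A"
  assumes "\<And>z. z \<in> closed_segment q r \<Longrightarrow> norm (f z) \<le> B"
  shows "norm (contour_integral (linepath p q) f + contour_integral (linepath q r) f + contour_integral (linepath r s) f)
    \<le> A * (dist p q + dist r s) + B * dist q r"
proof -
  have "A \<ge> 0" "B \<ge> 0"
    using order.trans[OF norm_ge_zero assms(4)[of p]] order.trans[OF norm_ge_zero assms(5)[of q]] by auto
  then have "norm (contour_integral (linepath p q) f) \<le> A * norm (q - p)"
    "norm (contour_integral (linepath q r) f) \<le> B * norm (r - q)"
    "norm (contour_integral (linepath r s) f) \<le> A * norm (s - r)"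
    using assms by (auto intro!: contour_integral_bound_linepath)
  then show ?thesis
    by (intro norm_triangle_le) (use norm_triangle_ineq[of "contour_integral (linepath p q) f" "contour_integral (linepath q r) f"]
      in \<open>simp add: dist_norm norm_minus_commute distrib_left\<close>)
qed

lemma dist_Complex_same:
  "dist (Complex a b) (Complex a c) = \<bar>b - c\<bar>" "dist (Complex b a) (Complex c a) = \<bar>b - c\<bar>"
  by (simp_all add: dist_norm cmod_def)

text \<open>Newman's choice of kernel: the factor \<open>1 + z\<^sup>2 / R\<^sup>2\<close> vanishes at \<open>\<plusminus>\<i>R\<close> and thereby absorbs the
  factors \<open>1 / \<bar>Re z\<bar>\<close> of the tail estimates on the horizontal edges.\<close>
definition newman_kernel :: "nat \<Rightarrow> real \<Rightarrow> complex \<Rightarrow> complex" where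
  "newman_kernel N R z = of_nat N powr z * (1 + z\<^sup>2 / of_real (R\<^sup>2))"

lemma newman_kernel_0 [simp]: "N > 0 \<Longrightarrow> newman_kernel N R 0 = 1"
  by (simp add: newman_kernel_def)

lemma holomorphic_newman_kernel [holomorphic_intros]: "N > 0 \<Longrightarrow> newman_kernel N R holomorphic_on A"
  unfolding newman_kernel_def by (cases "R = 0") (auto intro!: holomorphic_intros)

lemma norm_of_nat_powr: "N > 0 \<Longrightarrow> norm (of_nat N powr z) = real N powr Re z"
  using norm_powr_real_powr[of "of_nat N" z] by simp

text \<open>With \<open>z = x + \<i> * y\<close> and \<open>\<bar>y\<bar> = R\<close>, the numerator
  of \<open>1 + z\<^sup>2 / R\<^sup>2\<close> factors as \<open>x * (x + 2 * \<i> * y)\<close>, and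
  the second factor has modulus at most \<open>3 * R\<close>.\<close>

lemma norm_newman_kernel_horizontal:
  assumes "N > 0" "R > 0" "\<bar>Re z\<bar> \<le> R" "\<bar>Im z\<bar> = R"
  shows "norm (newman_kernel N R z / z) \<le> real N powr Re z * (3 * \<bar>Re z\<bar> / R\<^sup>2)"
proof -
  have "(Im z)\<^sup>2 = R\<^sup>2" using assms(4) by (metis power2_abs)
  then have "1 + z\<^sup>2 / of_real (R\<^sup>2) = of_real (Re z) * (of_real (Re z) + 2 * \<i> * of_real (Im z)) / of_real (R\<^sup>2)"
    using assms by (auto simp: complex_eq_iff field_simps power2_eq_square)
  also have "norm \<dots> = \<bar>Re z\<bar> * norm (of_real (Re z) + 2 * \<i> * of_real (Im z)) / R\<^sup>2"
    by (simp add: norm_mult norm_divide norm_power)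
  also have "\<dots> \<le> \<bar>Re z\<bar> * (3 * R) / R\<^sup>2"
    using assms by (intro divide_right_mono mult_left_mono order.trans[OF norm_triangle_ineq]) (auto simp: norm_mult)
  finally have "norm (1 + z\<^sup>2 / of_real (R\<^sup>2)) \<le> 3 * \<bar>Re z\<bar> / R"
    using assms by (simp add: power2_eq_square mult.commute)
  moreover have "norm z \<ge> R" using abs_Im_le_cmod[of z] assms by simp
  ultimately have "norm (1 + z\<^sup>2 / of_real (R\<^sup>2)) / norm z \<le> (3 * \<bar>Re z\<bar> / R) / R"
    using assms by (intro frac_le) auto
  then have "norm (1 + z\<^sup>2 / of_real (R\<^sup>2)) / norm z \<le> 3 * \<bar>Re z\<bar> / R\<^sup>2"
    by (simp add: power2_eq_square)
  then have "real N powr Re z * (norm (1 + z\<^sup>2 / of_real (R\<^sup>2)) / norm z) \<le> real N powr Re z * (3 * \<bar>Re z\<bar> / R\<^sup>2)"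
    by (rule mult_left_mono) auto
  then show ?thesis
    using assms by (simp add: newman_kernel_def norm_mult norm_divide norm_of_nat_powr)
qed

text \<open>Points of the box satisfy \<open>(norm z)\<^sup>2 \<le> 2 * R\<^sup>2\<close>, so the
  polynomial factor of the kernel is at most 3, while \<open>norm z \<ge> d\<close>.\<close>

lemma norm_newman_kernel_vertical:
  assumes "N > 0" "R > 0" "0 < d" "d \<le> R" "\<bar>Re z\<bar> = d" "\<bar>Im z\<bar> \<le> R"
  shows "norm (newman_kernel N R z / z) \<le> real N powr Re z * (3 / d)"
proof -
  have "norm z \<le> sqrt 2 * R"
  proof -
    have "(norm z)\<^sup>2 = \<bar>Re z\<bar>\<^sup>2 + \<bar>Im z\<bar>\<^sup>2" by (simp add: cmod_power2)
    also have "\<dots> \<le> R\<^sup>2 + R\<^sup>2" using assms by (intro add_mono power_mono) auto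
    also have "\<dots> = (sqrt 2 * R)\<^sup>2" by (simp add: power_mult_distrib)
    finally show ?thesis using assms by (auto intro: power2_le_imp_le)
  qed
  then have "(norm z)\<^sup>2 \<le> 2 * R\<^sup>2"
    using power_mono[of "norm z" "sqrt 2 * R" 2] by (simp add: power_mult_distrib)
  then have "norm (z\<^sup>2 / of_real (R\<^sup>2)) \<le> 2"
    using assms by (simp add: norm_divide norm_power field_simps)
  then have "norm (1 + z\<^sup>2 / of_real (R\<^sup>2)) \<le> 3"
    by (intro order.trans[OF norm_triangle_ineq]) auto
  moreover have "norm z \<ge> d" using abs_Re_le_cmod[of z] assms by simp
  ultimately have "norm (1 + z\<^sup>2 / of_real (R\<^sup>2)) / norm z \<le> 3 / d"
    using assms by (intro frac_le) auto
  then have "real N powr Re z * (norm (1 + z\<^sup>2 / of_real (R\<^sup>2)) / norm z) \<le> real N powr Re z * (3 / d)"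
    by (rule mult_left_mono) auto
  then show ?thesis
    using assms by (simp add: newman_kernel_def norm_mult norm_divide norm_of_nat_powr)
qed

text \<open>Compactness of the segment between the points \<open>-\<i> R\<close> and
  \<open>\<i> R\<close> yields a uniform margin to the left of the axis.\<close>

lemma strip_neighbourhood:
  fixes U :: "complex set" and R :: real
  assumes "open U" "{z. Re z \<ge> 0} \<subseteq> U" "R > 0"
  obtains d where "d > 0" "cbox (Complex (-d) (-R)) (Complex R R) \<subseteq> U"
proof -
  let ?K = "(\<lambda>y. Complex 0 y) ` {-R..R}"
  have "compact ?K" by (intro compact_continuous_image continuous_intros compact_Icc)
  moreover have "?K \<subseteq> U" using assms(2) by auto
  moreover have "?K \<noteq> {}" using assms by auto
  ultimately obtain e where e: "e > 0" "{x. infdist x ?K \<le> e} \<subseteq> U"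
    using assms(1) by (metis (no_types) compact_in_open_separated)
  show thesis
  proof (rule that[of e])
    show "cbox (Complex (-e) (-R)) (Complex R R) \<subseteq> U"
    proof
      fix z assume z: "z \<in> cbox (Complex (-e) (-R)) (Complex R R)"
      then have z': "-e \<le> Re z" "-R \<le> Im z" "Im z \<le> R" by (auto simp: in_cbox_complex_iff)
      show "z \<in> U"
      proof (cases "Re z \<ge> 0")
        case False
        have "infdist z ?K \<le> dist z (Complex 0 (Im z))" using z' by (intro infdist_le) auto
        also have "dist z (Complex 0 (Im z)) = \<bar>Re z\<bar>" by (simp add: dist_norm cmod_def)
        also have "\<dots> \<le> e" using False z' by auto
        finally show ?thesis using e by auto
      qed (use assms in auto)
    qed
  qed fact
qed


text \<open>Cauchy's formula is applied to \<open>G\<close> and to the partial sum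
  \<open>S N\<close>, each times a kernel with value 1 at 0. On the right the tail bound
  \<open>B * N powr (-x) / x\<close> of \<open>G - S N\<close>, where \<open>x = Re z\<close>, is
  compensated by the growth \<open>N powr x\<close> of the kernel. On the left the two functions are
  separated: the bound for \<open>S N\<close> is compensated in the same way, whereas
  \<open>G\<close> is merely bounded on a fixed box and its integral vanishes with the decay of
  \<open>N powr x\<close>. What remains is of order \<open>B / R\<close>, with \<open>R\<close>
  arbitrary.\<close>

theorem newman_series:
  fixes b :: "nat \<Rightarrow> complex" and G :: "complex \<Rightarrow> complex"
  assumes bound: "\<And>n. norm (b n) \<le> B"
    and U: "open U" "{z. Re z \<ge> 0} \<subseteq> U" and holG: "G holomorphic_on U"
    and G: "\<And>z. Re z > 0 \<Longrightarrow> (\<lambda>n. b n * of_nat n powr (-1 - z)) sums G z"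
  shows "(\<lambda>N. \<Sum>n\<in>{0<..N}. b n / of_nat n) \<longlonglongrightarrow> G 0"
proof -
  define S where "S N z = (\<Sum>n\<in>{0<..N}. b n * of_nat n powr (-1 - z))" for N z
  have B: "B \<ge> 0" using bound[of 0] norm_ge_zero by (rule order.trans[rotated])
  have holS: "S N holomorphic_on A" for N A
    unfolding S_def by (intro holomorphic_intros) auto
  have S0: "S N 0 = (\<Sum>n\<in>{0<..N}. b n / of_nat n)" for N
    unfolding S_def by (intro sum.cong refl) (simp add: powr_minus divide_inverse)
  have norm_term: "norm (b n * of_nat n powr (-1 - z)) \<le> B * real n powr (-1 - Re z)" for n z
    using bound[of n] by (cases "n = 0") (auto simp: norm_mult norm_of_nat_powr intro!: mult_right_mono)
  have right: "norm (G z - S N z) \<le> B * (real N powr (- Re z) / Re z)" if "Re z > 0" "N > 0" for z N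
  proof (rule LIMSEQ_le_const2)
    have "(\<lambda>M. \<Sum>n<Suc M. b n * of_nat n powr (-1 - z)) \<longlonglongrightarrow> G z"
      using G[OF that(1)] unfolding sums_def by (rule LIMSEQ_Suc)
    also have "(\<lambda>M. \<Sum>n<Suc M. b n * of_nat n powr (-1 - z)) = (\<lambda>M. S M z)"
    proof
      fix M
      have "(\<Sum>n<Suc M. b n * of_nat n powr (-1 - z)) = (\<Sum>n\<in>{0<..M}. b n * of_nat n powr (-1 - z))"
        by (rule sum.mono_neutral_right) auto
      then show "(\<Sum>n<Suc M. b n * of_nat n powr (-1 - z)) = S M z" by (simp add: S_def)
    qed
    finally show "(\<lambda>M. norm (S M z - S N z)) \<longlonglongrightarrow> norm (G z - S N z)"
      by (intro tendsto_intros)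
    show "\<exists>M0. \<forall>M\<ge>M0. norm (S M z - S N z) \<le> B * (real N powr (- Re z) / Re z)"
    proof (intro exI allI impI)
      fix M assume "N \<le> M"
      then have "{0<..M} = {0<..N} \<union> {N<..M}" by auto
      then have "S M z - S N z = (\<Sum>n\<in>{N<..M}. b n * of_nat n powr (-1 - z))"
        unfolding S_def by (simp add: sum.union_disjoint)
      also have "norm \<dots> \<le> (\<Sum>n\<in>{N<..M}. B * real n powr (-1 - Re z))"
        by (rule sum_norm_le) (rule norm_term)
      also have "\<dots> \<le> B * (real N powr (- Re z) / Re z)"
        unfolding sum_distrib_left[symmetric] using sum_Suc_powr_neg_le[of "Re z" N M] that B
        by (intro mult_left_mono) auto
      finally show "norm (S M z - S N z) \<le> B * (real N powr (- Re z) / Re z)" .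
    qed
  qed
  have left: "norm (S N z) \<le> B * (real N powr (- Re z) * (1 / (- Re z) + 1 / real N))" if "Re z < 0" "N > 0" for z N
  proof -
    have "norm (S N z) \<le> (\<Sum>n\<in>{0<..N}. B * real n powr (-1 - Re z))"
      unfolding S_def by (rule sum_norm_le) (rule norm_term)
    also have "\<dots> \<le> B * (real N powr (- Re z) / (- Re z) + real N powr (- Re z - 1))"
    proof -
      have "- Re z - 1 = - 1 - Re z" by simp
      then show ?thesis
        unfolding sum_distrib_left[symmetric] using sum_powr_le[of "- Re z" N] that B
        by (intro mult_left_mono) (simp only:, auto)
    qed
    also have "real N powr (- Re z - 1) = real N powr (- Re z) / real N"
      using that by (simp add: powr_diff)
    finally show ?thesis by (simp add: algebra_simps)
  qed
  have key: "\<forall>\<^sub>F N in sequentially. dist (S N 0) (G 0) < e" if "e > 0" for e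
  proof -
    \<comment> \<open>Two half-contours contribute \<open>12 * B / R\<close> each, so any factor of
      at least 24 works; the \<open>+ 1\<close> keeps \<open>R\<close> positive when
      \<open>B = 0\<close>.\<close>
    define R where "R = 40 * B / e + 1"
    have R: "R > 0" using B that by (simp add: R_def add_nonneg_pos)
    obtain d0 where d0: "d0 > 0" "cbox (Complex (-d0) (-R)) (Complex R R) \<subseteq> U"
      using strip_neighbourhood[OF U R] by blast
    \<comment> \<open>The kernel estimates on the left box ask for \<open>d \<le> R\<close>.\<close>
    define d where "d = min d0 R"
    have d: "d > 0" "d \<le> R" using d0 R by (auto simp: d_def)
    let ?Q = "cbox (Complex (-d) (-R)) (Complex R R)"
    have Q: "?Q \<subseteq> U"
      using d0 by (auto simp: d_def in_cbox_complex_iff subset_iff)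
    have "compact (G ` ?Q)"
      using holG Q by (intro compact_continuous_image holomorphic_on_imp_continuous_on) (auto intro: holomorphic_on_subset)
    then obtain M where M: "M > 0" "\<And>z. z \<in> ?Q \<Longrightarrow> norm (G z) \<le> M"
      by (auto dest!: compact_imp_bounded simp: bounded_pos)
    define E where "E N = (12 * B / R + 12 * B / R * (1 + R / real N) + (6 * M * d / R\<^sup>2 * (1 / ln (real N))
        + 6 * R * M / d * real N powr (-d))) / (2 * pi)" for N
    have est: "dist (S N 0) (G 0) \<le> E N" if N: "N \<ge> 3" for N
    proof -
      let ?K = "newman_kernel N R"
      let ?f = "\<lambda>z. (G z - S N z) * ?K z / z" and ?g = "\<lambda>z. G z * ?K z / z" and ?h = "\<lambda>z. S N z * ?K z / z"
      define I where "I f p q r s = contour_integral (linepath p q) f + contour_integral (linepath q r) f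
          + contour_integral (linepath r s) f" for f p q r s
      let ?a = "Complex 0 (-R)" and ?a' = "Complex 0 R" and ?b = "Complex R (-R)" and ?b' = "Complex R R"
      let ?c = "Complex (-d) (-R)" and ?c' = "Complex (-d) R" and ?e = "Complex (-R) (-R)" and ?e' = "Complex (-R) R"
      have hol: "(\<lambda>z. G z * ?K z) holomorphic_on U" "(\<lambda>z. S N z * ?K z) holomorphic_on UNIV"
        using N by (auto intro!: holomorphic_intros holS holG)
      have i1: "I ?g ?a ?b ?b' ?a' + I ?g ?a' ?c' ?c ?a = 2 * pi * \<i> * (G 0 * ?K 0)"
        unfolding I_def using contour_box_split[OF R d(1) hol(1) U(1) Q] by simp
      \<comment> \<open>\<open>S N\<close> is entire, so its left half-contour may be moved out to
        \<open>Re z = -R\<close>, where its estimate is as good as the one on the right.\<close>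
      have i2: "I ?h ?a ?b ?b' ?a' + I ?h ?a' ?e' ?e ?a = 2 * pi * \<i> * (S N 0 * ?K 0)"
        unfolding I_def using contour_box_split[OF R R hol(2) open_UNIV] by simp
      have intg: "?g contour_integrable_on linepath p q" if "closed_segment p q \<subseteq> ?Q - {0}" for p q
        using that Q holG N
        by (intro contour_integrable_continuous_linepath holomorphic_on_imp_continuous_on holomorphic_intros)
          (auto intro: holomorphic_on_subset)
      have inth: "?h contour_integrable_on linepath p q" if "0 \<notin> closed_segment p q" for p q
        using that N
        by (intro contour_integrable_continuous_linepath holomorphic_on_imp_continuous_on holomorphic_intros holS) auto
      have segs: "z \<in> closed_segment ?a ?b \<union> closed_segment ?b' ?a' \<Longrightarrow> \<bar>Im z\<bar> = R \<and> 0 \<le> Re z \<and> Re z \<le> R"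
        "z \<in> closed_segment ?b ?b' \<Longrightarrow> Re z = R \<and> \<bar>Im z\<bar> \<le> R"
        "0 \<le> t \<Longrightarrow> z \<in> closed_segment ?a' (Complex (-t) R) \<union> closed_segment (Complex (-t) (-R)) ?a \<Longrightarrow> \<bar>Im z\<bar> = R \<and> -t \<le> Re z
            \<and> Re z \<le> 0"
        "0 \<le> t \<Longrightarrow> z \<in> closed_segment (Complex (-t) R) (Complex (-t) (-R)) \<Longrightarrow> Re z = -t \<and> \<bar>Im z\<bar> \<le> R" for z t
        using R by (auto simp: closed_segment_same_Im closed_segment_same_Re closed_segment_eq_real_ivl split: if_splits)
      have inQ: "z \<in> ?Q - {0}" if "-d \<le> Re z" "Re z \<le> R" "\<bar>Im z\<bar> \<le> R" "\<bar>Im z\<bar> = R \<or> Re z \<noteq> 0" for z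
        using that R by (auto simp: in_cbox_complex_iff)
      have sub: "closed_segment ?a ?b \<subseteq> ?Q - {0}" "closed_segment ?b ?b' \<subseteq> ?Q - {0}" "closed_segment ?b' ?a' \<subseteq> ?Q - {0}"
        "closed_segment ?a' ?c' \<subseteq> ?Q - {0}" "closed_segment ?c' ?c \<subseteq> ?Q - {0}" "closed_segment ?c ?a \<subseteq> ?Q - {0}"
      proof -
        note segs' = segs(1,2) segs(3,4)[of d]
        show "closed_segment ?a ?b \<subseteq> ?Q - {0}" "closed_segment ?b' ?a' \<subseteq> ?Q - {0}"
          by (rule subsetI, rule inQ; use segs'(1) R d in fastforce)+
        show "closed_segment ?b ?b' \<subseteq> ?Q - {0}"
          by (rule subsetI, rule inQ; use segs'(2) R d in fastforce)
        show "closed_segment ?a' ?c' \<subseteq> ?Q - {0}" "closed_segment ?c ?a \<subseteq> ?Q - {0}"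
          by (rule subsetI, rule inQ; use segs'(3) R d in fastforce)+
        show "closed_segment ?c' ?c \<subseteq> ?Q - {0}"
          by (rule subsetI, rule inQ; use segs'(4) R d in fastforce)
      qed
      have sub': "0 \<notin> closed_segment ?a' ?e'" "0 \<notin> closed_segment ?e' ?e" "0 \<notin> closed_segment ?e ?a"
        using segs(3,4)[of R 0] R by auto
      have i3: "I ?f ?a ?b ?b' ?a' = I ?g ?a ?b ?b' ?a' - I ?h ?a ?b ?b' ?a'"
      proof -
        have "contour_integral (linepath p q) ?f = contour_integral (linepath p q) ?g - contour_integral (linepath p q) ?h"
          if "closed_segment p q \<subseteq> ?Q - {0}" for p q
          using contour_integral_diff[OF intg[OF that] inth[of p q]] that
              by (auto simp: left_diff_distrib diff_divide_distrib)
        then show ?thesis unfolding I_def using sub by simp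
      qed
      then have "2 * pi * \<i> * (G 0 - S N 0) = I ?f ?a ?b ?b' ?a' + I ?g ?a' ?c' ?c ?a - I ?h ?a' ?e' ?e ?a"
      proof -
        have "u - t = f + y - w" if "x + y = u" "v + w = t" "f = x - v" for u t f x y v w :: complex
          using that by (auto simp: algebra_simps)
        from this[OF i1 i2 i3] show ?thesis using N by (simp add: right_diff_distrib)
      qed
      then have "norm (2 * pi * \<i> * (G 0 - S N 0)) \<le> norm (I ?f ?a ?b ?b' ?a') + norm (I ?g ?a' ?c' ?c ?a)
          + norm (I ?h ?a' ?e' ?e ?a)"
        by (simp only:) (intro order.trans[OF norm_triangle_ineq4] add_right_mono norm_triangle_ineq)
      moreover have "norm (I ?f ?a ?b ?b' ?a') \<le> 12 * B / R"
      proof -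
        have "norm (I ?f ?a ?b ?b' ?a') \<le> (3 * B / R\<^sup>2) * (dist ?a ?b + dist ?b' ?a') + (3 * B / R\<^sup>2) * dist ?b ?b'"
          unfolding I_def
        proof (rule norm_contour_three_linepaths_le)
          fix z assume "z \<in> closed_segment ?a ?b \<union> closed_segment ?b' ?a'"
          then have z: "\<bar>Im z\<bar> = R" "0 \<le> Re z" "Re z \<le> R" using segs by auto
          have K: "norm (?K z / z) \<le> real N powr Re z * (3 * \<bar>Re z\<bar> / R\<^sup>2)"
            using z N R by (intro norm_newman_kernel_horizontal) auto
          show "norm (?f z) \<le> 3 * B / R\<^sup>2"
          proof (cases "Re z = 0")
            case False
            have "norm (?f z) = norm (G z - S N z) * norm (?K z / z)" by (simp add: norm_mult norm_divide)
            also have "\<dots> \<le> (B * (real N powr (- Re z) / Re z)) * (real N powr Re z * (3 * \<bar>Re z\<bar> / R\<^sup>2))"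
              using False z N B by (intro mult_mono right K) auto
            also have "\<dots> = 3 * B / R\<^sup>2" using False z N by (simp add: powr_minus field_simps)
            finally show ?thesis .
          qed (use K B in auto)
        next
          fix z assume "z \<in> closed_segment ?b ?b'"
          then have z: "Re z = R" "\<bar>Im z\<bar> \<le> R" using segs by auto
          have "norm (?f z) = norm (G z - S N z) * norm (?K z / z)" by (simp add: norm_mult norm_divide)
          also have "\<dots> \<le> (B * (real N powr (- Re z) / Re z)) * (real N powr Re z * (3 / R))"
            using z N B R by (intro mult_mono right norm_newman_kernel_vertical) auto
          also have "\<dots> = 3 * B / R\<^sup>2" using z N R by (simp add: powr_minus field_simps power2_eq_square)
          finally show "norm (?f z) \<le> 3 * B / R\<^sup>2" .
        qed (use sub in \<open>auto intro!: contour_integrable_diff intg inth simp: left_diff_distrib diff_divide_distrib\<close>)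
        also have "\<dots> = 12 * B / R"
          using R by (simp add: dist_Complex_same power2_eq_square field_simps)
        finally show ?thesis .
      qed
      moreover have "norm (I ?h ?a' ?e' ?e ?a) \<le> 12 * B / R * (1 + R / real N)"
      proof -
        have "norm (I ?h ?a' ?e' ?e ?a) \<le> (3 * B / R\<^sup>2 * (1 + R / real N)) * (dist ?a' ?e' + dist ?e ?a) + (3 * B / R\<^sup>2 * (1
            + R / real N)) * dist ?e' ?e"
          unfolding I_def
        proof (rule norm_contour_three_linepaths_le)
          fix z assume "z \<in> closed_segment ?a' ?e' \<union> closed_segment ?e ?a"
          then have z: "\<bar>Im z\<bar> = R" "-R \<le> Re z" "Re z \<le> 0" using segs(3)[of R z] R by auto
          have K: "norm (?K z / z) \<le> real N powr Re z * (3 * \<bar>Re z\<bar> / R\<^sup>2)"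
            using z N R by (intro norm_newman_kernel_horizontal) auto
          show "norm (?h z) \<le> 3 * B / R\<^sup>2 * (1 + R / real N)"
          proof (cases "Re z = 0")
            case False
            then have "1 / (- Re z) + 1 / real N \<ge> 0" using z by (intro add_nonneg_nonneg) auto
            have "norm (?h z) = norm (S N z) * norm (?K z / z)" by (simp add: norm_mult norm_divide)
            also have "\<dots> \<le> (B * (real N powr (- Re z) * (1 / (- Re z)
                + 1 / real N))) * (real N powr Re z * (3 * \<bar>Re z\<bar> / R\<^sup>2))"
              using False z N B \<open>1 / (- Re z) + 1 / real N \<ge> 0\<close> by (intro mult_mono left K mult_nonneg_nonneg) auto
            also have "\<dots> = 3 * B / R\<^sup>2 * (1 + (- Re z) / real N)" using False z N R by (simp add: powr_minus field_simps)
            also have "\<dots> \<le> 3 * B / R\<^sup>2 * (1 + R / real N)"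
              using z B by (intro mult_left_mono add_left_mono divide_right_mono) auto
            finally show ?thesis .
          qed (use K B R in auto)
        next
          fix z assume "z \<in> closed_segment ?e' ?e"
          then have z: "Re z = -R" "\<bar>Im z\<bar> \<le> R" using segs(4)[of R z] R by auto
          have "norm (?h z) = norm (S N z) * norm (?K z / z)" by (simp add: norm_mult norm_divide)
          also have "\<dots> \<le> (B * (real N powr (- Re z) * (1 / (- Re z) + 1 / real N))) * (real N powr Re z * (3 / R))"
            using z N B R by (intro mult_mono left norm_newman_kernel_vertical) auto
          also have "\<dots> = 3 * B / R\<^sup>2 * (1 + R / real N)" using z N R by (simp add: powr_minus field_simps power2_eq_square)
          finally show "norm (?h z) \<le> 3 * B / R\<^sup>2 * (1 + R / real N)" .
        qed (use sub' in \<open>auto intro!: inth\<close>)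
        also have "\<dots> = 12 * B / R * (1 + R / real N)"
          using R by (simp add: dist_Complex_same power2_eq_square field_simps)
        finally show ?thesis .
      qed
      moreover have "norm (I ?g ?a' ?c' ?c ?a) \<le> 6 * M * d / R\<^sup>2 * (1 / ln (real N)) + 6 * R * M / d * real N powr (-d)"
      proof -
        have "norm (I ?g ?a' ?c' ?c ?a) \<le> (3 * M / R\<^sup>2 * (1 / ln (real N))) * (dist ?a' ?c' + dist ?c ?a)
            + (3 * M / d * real N powr (-d)) * dist ?c' ?c"
          unfolding I_def
        proof (rule norm_contour_three_linepaths_le)
          fix z assume zc: "z \<in> closed_segment ?a' ?c' \<union> closed_segment ?c ?a"
          then have z: "\<bar>Im z\<bar> = R" "-d \<le> Re z" "Re z \<le> 0" using segs(3)[of d z] d by auto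
          have K: "norm (?K z / z) \<le> real N powr Re z * (3 * \<bar>Re z\<bar> / R\<^sup>2)"
            using z N R d by (intro norm_newman_kernel_horizontal) auto
          have "ln (real N) > 0" using N by simp
          have "real N powr Re z * \<bar>Re z\<bar> \<le> 1 / ln (real N)"
          proof -
            \<comment> \<open>The inequality \<open>t \<le> exp t\<close> at
              \<open>t = ln N * \<bar>Re z\<bar>\<close> shows that the factor
              \<open>\<bar>Re z\<bar>\<close> of the kernel buys decay in \<open>N\<close>,
              uniformly up to the imaginary axis.\<close>
            have "ln (real N) * \<bar>Re z\<bar> \<le> exp (ln (real N) * \<bar>Re z\<bar>)"
              using exp_ge_add_one_self[of "ln (real N) * \<bar>Re z\<bar>"] by linarith
            then have "ln (real N) * \<bar>Re z\<bar> \<le> real N powr (- Re z)"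
              using N z by (simp add: powr_def mult.commute)
            then show ?thesis using \<open>ln (real N) > 0\<close> N by (simp add: powr_minus field_simps)
          qed
          then have "real N powr Re z * (3 * \<bar>Re z\<bar> / R\<^sup>2) \<le> 3 / R\<^sup>2 * (1 / ln (real N))"
            using R by (simp add: field_simps)
          with K have K': "norm (?K z / z) \<le> 3 / R\<^sup>2 * (1 / ln (real N))" by (rule order.trans)
          have "norm (?g z) = norm (G z) * norm (?K z / z)" by (simp add: norm_mult norm_divide)
          also have "\<dots> \<le> M * (3 / R\<^sup>2 * (1 / ln (real N)))"
            using M(1) K' sub zc by (intro mult_mono M) auto
          finally show "norm (?g z) \<le> 3 * M / R\<^sup>2 * (1 / ln (real N))" by (simp add: mult_ac)
        next
          fix z assume zc: "z \<in> closed_segment ?c' ?c"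
          then have z: "Re z = -d" "\<bar>Im z\<bar> \<le> R" using segs(4)[of d z] d by auto
          have "norm (?g z) = norm (G z) * norm (?K z / z)" by (simp add: norm_mult norm_divide)
          also have "\<dots> \<le> M * (real N powr Re z * (3 / d))"
            using M(1) z d R N sub zc by (intro mult_mono M norm_newman_kernel_vertical) auto
          finally show "norm (?g z) \<le> 3 * M / d * real N powr (-d)" using z by (simp add: mult_ac)
        qed (use sub in \<open>auto intro!: intg\<close>)
        also have "\<dots> = 6 * M * d / R\<^sup>2 * (1 / ln (real N)) + 6 * R * M / d * real N powr (-d)"
          using R d by (simp add: dist_Complex_same power2_eq_square field_simps)
        finally show ?thesis .
      qed
      ultimately have "norm (2 * pi * \<i> * (G 0 - S N 0)) \<le> 2 * pi * E N"
        by (simp add: E_def)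
      moreover have "norm (2 * pi * \<i> * (G 0 - S N 0)) = 2 * pi * dist (S N 0) (G 0)"
        by (simp add: norm_mult dist_norm norm_minus_commute)
      ultimately show ?thesis by simp
    qed
    have "E \<longlonglongrightarrow> (12 * B / R + 12 * B / R * (1 + 0) + (6 * M * d / R\<^sup>2 * 0 + 6 * R * M / d * 0)) / (2 * pi)"
    proof -
      have "(\<lambda>N. R / real N) \<longlonglongrightarrow> 0" "(\<lambda>N. 1 / ln (real N)) \<longlonglongrightarrow> 0" "(\<lambda>N. real N powr (-d)) \<longlonglongrightarrow> 0"
        using d(1) by real_asymp+
      then show ?thesis unfolding E_def by (intro tendsto_intros) auto
    qed
    moreover have "(12 * B / R + 12 * B / R * (1 + 0) + (6 * M * d / R\<^sup>2 * 0 + 6 * R * M / d * 0)) / (2 * pi) < e"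
    proof -
      have "24 * B / R < e"
      proof -
        have "e * R = 40 * B + e" using that by (simp add: R_def field_simps)
        then have "24 * B < e * R" using B that by linarith
        then show ?thesis using R by (simp add: field_simps)
      qed
      moreover have "24 * B / R / (2 * pi) \<le> 24 * B / R / 1"
        using B R pi_gt3 by (intro divide_left_mono) auto
      ultimately show ?thesis by simp
    qed
    ultimately have "\<forall>\<^sub>F N in sequentially. E N < e" by (rule order_tendstoD)
    then show ?thesis using eventually_ge_at_top[of 3]
      by eventually_elim (use est in \<open>auto intro: le_less_trans\<close>)
  qed
  show ?thesis unfolding S0[symmetric] tendsto_iff using key by blast
qed

section \<open>Dirichlet series\<close>

lemma norm_of_real_powr_diff_le:
  fixes x y :: real and s :: complex
  assumes "0 < x" "x \<le> y" "Re s \<ge> -1"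
  shows "norm (of_real y powr (-s) - of_real x powr (-s)) \<le> norm s * x powr (-Re s - 1) * (y - x)"
proof -
  let ?S = "closed_segment (complex_of_real x) (complex_of_real y)"
  have S: "\<exists>t. z = of_real t \<and> x \<le> t \<and> t \<le> y" if "z \<in> ?S" for z
    using that assms by (auto simp: closed_segment_of_real closed_segment_eq_real_ivl)
  have "norm (of_real y powr (-s) - of_real x powr (-s))
      \<le> (norm s * x powr (-Re s - 1)) * norm (complex_of_real y - of_real x)"
  proof (rule field_differentiable_bound[of ?S])
    fix z assume "z \<in> ?S"
    then obtain t where t: "z = of_real t" "x \<le> t" "t \<le> y" using S by blast
    then have "z \<notin> \<real>\<^sub>\<le>\<^sub>0" using assms by auto
    then show "((\<lambda>z. z powr (-s)) has_field_derivative (-s * z powr (-s - 1))) (at z within ?S)"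
      by (auto intro!: derivative_eq_intros DERIV_subset[OF has_field_derivative_powr])
    have "norm (-s * z powr (-s - 1)) = norm s * t powr (-Re s - 1)"
      using t assms by (simp add: norm_mult norm_powr_real_powr)
    also have "\<dots> \<le> norm s * x powr (-Re s - 1)"
      using t assms by (intro mult_left_mono powr_mono2') auto
    finally show "norm (-s * z powr (-s - 1)) \<le> norm s * x powr (-Re s - 1)" .
  qed auto
  also have "norm (complex_of_real y - of_real x) = y - x"
    using assms by (metis abs_of_nonneg diff_ge_0_iff_ge norm_of_real of_real_diff)
  finally show ?thesis .
qed

lemma norm_powr_diff_Suc_le:
  assumes "n > 0" "Re s \<ge> -1"
  shows "norm (of_nat n powr (-s) - of_nat (Suc n) powr (-s)) \<le> norm s * real n powr (-Re s - 1)"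
  using norm_of_real_powr_diff_le[of "real n" "real (Suc n)" s] assms by (simp add: norm_minus_commute)

text \<open>The expression is the error of the tangent at \<open>n\<close> to
  \<open>x powr (-s)\<close>, taken at \<open>n + 1\<close>. Being of second order, it gains one
  power of \<open>n\<close> over \<open>norm_powr_diff_Suc_le\<close>, which moves half-planes of
  convergence by 1 to the left.\<close>

lemma norm_powr_taylor_Suc_le:
  assumes "n > 0" "Re s \<ge> -2"
  shows "norm (s * of_nat n powr (-1 - s) - of_nat n powr (-s) + of_nat (Suc n) powr (-s))
    \<le> norm s * norm (s + 1) * real n powr (-Re s - 2)"
proof -
  let ?x = "complex_of_real (real n)" and ?y = "complex_of_real (real (Suc n))"
  let ?S = "closed_segment ?x ?y"
  \<comment> \<open>Removing the tangent makes the derivative a difference of two values of the same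
    power, to which the first-order estimate applies.\<close>
  let ?f = "\<lambda>z. z powr (-s) + s * ?x powr (-s - 1) * z"
  have S: "\<exists>t. z = of_real t \<and> real n \<le> t \<and> t \<le> real (Suc n)" if "z \<in> ?S" for z
    using that assms by (auto simp: closed_segment_of_real closed_segment_eq_real_ivl simp del: of_nat_Suc of_real_of_nat_eq)
  have "norm (?f ?y - ?f ?x) \<le> (norm s * norm (s + 1) * real n powr (-Re s - 2)) * norm (?y - ?x)"
  proof (rule field_differentiable_bound[of ?S])
    fix z assume "z \<in> ?S"
    then obtain t where t: "z = of_real t" "real n \<le> t" "t \<le> real (Suc n)" using S by blast
    then have "z \<notin> \<real>\<^sub>\<le>\<^sub>0" using assms by auto
    then show "(?f has_field_derivative (-s * (z powr (-(s + 1)) - ?x powr (-(s + 1))))) (at z within ?S)"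
    proof -
      have e: "-(s + 1) = -s - 1" by simp
      show ?thesis unfolding e
        using \<open>z \<notin> \<real>\<^sub>\<le>\<^sub>0\<close>
        by (auto intro!: derivative_eq_intros DERIV_subset[OF has_field_derivative_powr] simp: right_diff_distrib)
    qed
    have "norm (z powr (-(s + 1)) - ?x powr (-(s + 1))) \<le> norm (s + 1) * real n powr (-Re (s + 1) - 1) * (t - real n)"
      unfolding t(1) using t assms by (intro norm_of_real_powr_diff_le) auto
    also have "\<dots> \<le> norm (s + 1) * real n powr (-Re (s + 1) - 1) * 1"
      using t by (intro mult_left_mono) auto
    finally have "norm s * norm (z powr (-(s + 1)) - ?x powr (-(s + 1))) \<le> norm s * (norm (s + 1) * real n powr (-Re (s
        + 1) - 1) * 1)"
      by (rule mult_left_mono) auto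
    moreover have e: "-Re (s + 1) - 1 = -Re s - 2" by simp
    ultimately show "norm (-s * (z powr (-(s + 1)) - ?x powr (-(s + 1)))) \<le> norm s * norm (s + 1) * real n powr (-Re s - 2)"
      unfolding e by (simp only: norm_mult norm_minus_cancel mult.assoc mult_1_right)
  qed auto
  moreover have "?y - ?x = 1" by simp
  moreover have "?f ?y - ?f ?x = s * of_nat n powr (-1 - s) - of_nat n powr (-s) + of_nat (Suc n) powr (-s)"
  proof -
    have "-s - 1 = -1 - s" by simp
    then have "?f ?y - ?f ?x = ?y powr (-s) - ?x powr (-s) + s * ?x powr (-1 - s) * (?y - ?x)"
      by (simp only:) (simp add: algebra_simps)
    then show ?thesis unfolding \<open>?y - ?x = 1\<close> by simp
  qed
  ultimately show ?thesis by (simp only:) simp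
qed

text \<open>Weierstrass' theorem in the form suited to Dirichlet series: the majorants in the
  applications grow with \<open>norm s\<close> and worsen near the boundary, so they are asked for
  only on bounded parts of smaller half-planes. The termwise derivative is needed for logarithmic
  derivatives.\<close>

lemma halfplane_series:
  fixes f :: "nat \<Rightarrow> complex \<Rightarrow> complex"
  assumes hol: "\<And>n. f n holomorphic_on {s. Re s > a}"
    and dom: "\<And>r R. r > a \<Longrightarrow> \<exists>M. summable M \<and> (\<forall>n s. Re s \<ge> r \<and> norm s \<le> R \<longrightarrow> norm (f n s) \<le> M n)"
  shows "\<And>s. Re s > a \<Longrightarrow> (\<lambda>n. f n s) sums (\<Sum>n. f n s)"
    and "(\<lambda>s. \<Sum>n. f n s) holomorphic_on {s. Re s > a}"
    and "\<And>s. Re s > a \<Longrightarrow> (\<lambda>n. deriv (f n) s) sums deriv (\<lambda>s. \<Sum>n. f n s) s"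
proof -
  let ?S = "{s::complex. Re s > a}"
  have op: "open ?S" by (simp add: open_halfspace_Re_gt)
  have "\<exists>g g'. \<forall>x \<in> ?S. ((\<lambda>n. f n x) sums g x) \<and> ((\<lambda>n. deriv (f n) x) sums g' x) \<and> (g has_field_derivative g' x) (at x)"
  proof (rule series_and_derivative_comparison_complex[OF op])
    show "(f n has_field_derivative deriv (f n) x) (at x)" if "x \<in> ?S" for n x
      using hol op that by (rule holomorphic_derivI)
    fix x assume x: "x \<in> ?S"
    define d where "d = (Re x - a) / 2"
    have d: "d > 0" "Re x - d > a" using x by (auto simp: d_def field_simps)
    obtain M where M: "summable M" "\<And>n s. Re s \<ge> Re x - d \<Longrightarrow> norm s \<le> norm x + d \<Longrightarrow> norm (f n s) \<le> M n"
      using dom[OF d(2), of "norm x + d"] by blast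
    have Mx: "M n \<ge> 0" for n using M(2)[of x n] d by (auto intro: order.trans[OF norm_ge_zero])
    show "\<exists>d (h :: nat \<Rightarrow> complex). 0 < d \<and> summable h \<and> range h \<subseteq> \<real>\<^sub>\<ge>\<^sub>0
        \<and> (\<forall>\<^sub>F n in sequentially. \<forall>y\<in>ball x d \<inter> ?S. norm (f n y) \<le> norm (h n))"
    proof (intro exI conjI)
      show "summable (\<lambda>n. complex_of_real (M n))" using M(1) by (rule summable_of_real)
      show "range (\<lambda>n. complex_of_real (M n)) \<subseteq> \<real>\<^sub>\<ge>\<^sub>0" using Mx by auto
      show "\<forall>\<^sub>F n in sequentially. \<forall>y\<in>ball x d \<inter> ?S. norm (f n y) \<le> norm (complex_of_real (M n))"
      proof (intro always_eventually allI ballI)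
        fix n y assume "y \<in> ball x d \<inter> ?S"
        then have y: "norm (y - x) < d" by (auto simp: dist_norm norm_minus_commute)
        have "\<bar>Re (y - x)\<bar> \<le> norm (y - x)" by (rule abs_Re_le_cmod)
        then have "Re y \<ge> Re x - d" using y by auto
        moreover have "norm y \<le> norm x + d" using y norm_triangle_sub[of y x] by linarith
        ultimately have "norm (f n y) \<le> M n" by (rule M(2))
        then show "norm (f n y) \<le> norm (complex_of_real (M n))" using Mx[of n] by simp
      qed
    qed (fact d)
  qed
  then obtain g g' where g: "\<And>x. x \<in> ?S \<Longrightarrow> (\<lambda>n. f n x) sums g x"
    "\<And>x. x \<in> ?S \<Longrightarrow> (\<lambda>n. deriv (f n) x) sums g' x"
    "\<And>x. x \<in> ?S \<Longrightarrow> (g has_field_derivative g' x) (at x)" by blast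
  have eq: "(\<Sum>n. f n x) = g x" if "x \<in> ?S" for x using g(1)[OF that] by (rule sums_unique[symmetric])
  have der: "((\<lambda>s. \<Sum>n. f n s) has_field_derivative g' x) (at x)" if "x \<in> ?S" for x
    using g(3)[OF that] op that
  proof (rule has_field_derivative_transform_within_open)
  qed (use eq in auto)
  show "(\<lambda>n. f n s) sums (\<Sum>n. f n s)" if "Re s > a" for s
    using g(1)[of s] eq[of s] that by simp
  show "(\<lambda>s. \<Sum>n. f n s) holomorphic_on ?S"
    using der op by (auto simp: holomorphic_on_open)
  show "(\<lambda>n. deriv (f n) s) sums deriv (\<lambda>s. \<Sum>n. f n s) s" if "Re s > a" for s
    using g(2)[of s] DERIV_imp_deriv[OF der[of s]] that by simp
qed

lemma sum_by_parts:
  fixes f u :: "nat \<Rightarrow> 'a :: comm_ring_1"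
  shows "(\<Sum>n\<in>{0<..N}. f n * u n) = (\<Sum>n\<in>{0<..N}. (\<Sum>k\<in>{0<..n}. f k) * (u n - u (Suc n))) + (\<Sum>k\<in>{0<..N}. f k) * u (Suc N)"
proof (induction N)
  case (Suc N)
  have "{0<..Suc N} = insert (Suc N) {0<..N}" by auto
  then show ?case using Suc by (simp add: algebra_simps)
qed simp

lemma sum_lessThan_Suc_eq:
  fixes f :: "nat \<Rightarrow> 'a :: comm_monoid_add"
  assumes "f 0 = 0"
  shows "sum f {..<Suc N} = sum f {0<..N}"
  by (rule sum.mono_neutral_right) (use assms in auto)

text \<open>Abel summation: the differences of \<open>n powr (-s)\<close> gain one power of
  \<open>n\<close>, which makes the summed series absolutely convergent for \<open>Re s > a\<close>.
  Its terms are handed out as a third conclusion because the Tauberian argument works with them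
  directly.\<close>

lemma dirichlet_series_by_parts:
  fixes f :: "nat \<Rightarrow> complex"
  assumes a: "a \<ge> 0" and bound: "\<And>n. norm (\<Sum>k\<in>{0<..n}. f k) \<le> C * real n powr a"
  obtains H where "H holomorphic_on {s. Re s > a}" "\<And>s. Re s > a \<Longrightarrow> (\<lambda>n. f n * of_nat n powr (-s)) sums H s"
    "\<And>s. Re s > a \<Longrightarrow> (\<lambda>n. (\<Sum>k\<in>{0<..n}. f k) * (of_nat n powr (-s) - of_nat (Suc n) powr (-s))) sums H s"
proof -
  define A where "A n = (\<Sum>k\<in>{0<..n}. f k)" for n
  define h where "h n s = A n * (of_nat n powr (-s) - of_nat (Suc n) powr (-s))" for n s
  have C: "C \<ge> 0" using bound[of 1] by (auto intro: order.trans[OF norm_ge_zero])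
  have hb: "norm (h n s) \<le> C * norm s * real n powr (a - Re s - 1)" if "Re s > a" for n s
  proof (cases "n = 0")
    case False
    have "norm (h n s) \<le> (C * real n powr a) * (norm s * real n powr (-Re s - 1))"
      unfolding h_def norm_mult A_def using False that a C
      by (intro mult_mono bound norm_powr_diff_Suc_le) auto
    also have "\<dots> = C * norm s * (real n powr a * real n powr (-Re s - 1))" by simp
    also have "real n powr a * real n powr (-Re s - 1) = real n powr (a - Re s - 1)"
      by (simp add: algebra_simps flip: powr_add)
    finally show ?thesis .
  qed (simp add: h_def A_def)
  have *: "\<exists>M. summable M \<and> (\<forall>n s. Re s \<ge> r \<and> norm s \<le> R \<longrightarrow> norm (h n s) \<le> M n)" if "r > a" for r R
  proof (intro exI conjI allI impI)
    show "summable (\<lambda>n. C * R * real n powr (a - r - 1))"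
      using that by (intro summable_mult) (simp add: summable_real_powr_iff)
    fix n s assume s: "r \<le> Re s \<and> norm s \<le> R"
    have "norm (h n s) \<le> C * norm s * real n powr (a - Re s - 1)" using s that by (intro hb) auto
    also have "\<dots> \<le> C * R * real n powr (a - r - 1)"
    proof (cases "n = 0")
      case False
      then show ?thesis using s C by (intro mult_mono powr_mono mult_nonneg_nonneg) (auto intro: order.trans[OF norm_ge_zero])
    qed simp
    finally show "norm (h n s) \<le> C * R * real n powr (a - r - 1)" .
  qed
  have hol: "h n holomorphic_on S" for n S
    unfolding h_def by (cases "n = 0") (auto intro!: holomorphic_intros simp: A_def simp del: of_nat_Suc)
  have H1: "\<And>s. Re s > a \<Longrightarrow> (\<lambda>n. h n s) sums (\<Sum>n. h n s)"
    and H2: "(\<lambda>s. \<Sum>n. h n s) holomorphic_on {s. Re s > a}"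
    by (rule halfplane_series[of h a, OF hol *]; assumption)+
  show thesis
  proof (rule that[of "\<lambda>s. \<Sum>n. h n s"])
    show "(\<lambda>s. \<Sum>n. h n s) holomorphic_on {s. Re s > a}" by (rule H2)
    fix s :: complex assume s: "Re s > a"
    show "(\<lambda>n. (\<Sum>k\<in>{0<..n}. f k) * (of_nat n powr (-s) - of_nat (Suc n) powr (-s))) sums (\<Sum>n. h n s)"
      using H1[OF s] by (simp add: h_def A_def)
    have "(\<lambda>N. sum (\<lambda>n. h n s) {..<Suc N} + A N * of_nat (Suc N) powr (-s)) \<longlonglongrightarrow> (\<Sum>n. h n s) + 0"
    proof (intro tendsto_add LIMSEQ_Suc)
      show "(\<lambda>N. sum (\<lambda>n. h n s) {..<N}) \<longlonglongrightarrow> (\<Sum>n. h n s)" using H1[OF s] by (simp add: sums_def)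
      show "(\<lambda>N. A N * of_nat (Suc N) powr (-s)) \<longlonglongrightarrow> 0"
      proof (rule Lim_null_comparison)
        have "norm (A N * of_nat (Suc N) powr (-s)) \<le> C * real (Suc N) powr (a - Re s)" for N
        proof -
          have "norm (A N * of_nat (Suc N) powr (-s)) \<le> (C * real (Suc N) powr a) * real (Suc N) powr (-Re s)"
            unfolding norm_mult A_def using a C
            by (intro mult_mono order.trans[OF bound] mult_left_mono powr_mono2) (auto simp: norm_of_nat_powr simp del: of_nat_Suc)
          also have "\<dots> = C * real (Suc N) powr (a - Re s)" by (simp add: powr_diff powr_minus field_simps)
          finally show ?thesis .
        qed
        then show "\<forall>\<^sub>F N in sequentially. norm (A N * of_nat (Suc N) powr (-s)) \<le> C * real (Suc N) powr (a - Re s)" by simp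
        show "(\<lambda>N. C * real (Suc N) powr (a - Re s)) \<longlonglongrightarrow> 0" using s by real_asymp
      qed
    qed
    moreover have "sum (\<lambda>n. h n s) {..<Suc N} + A N * of_nat (Suc N) powr (-s) = (\<Sum>n<Suc N. f n * of_nat n powr (-s))" for N
    proof -
      have "sum (\<lambda>n. h n s) {..<Suc N} = (\<Sum>n\<in>{0<..N}. h n s)" by (rule sum_lessThan_Suc_eq) (simp add: h_def A_def)
      moreover have "(\<Sum>n<Suc N. f n * of_nat n powr (-s)) = (\<Sum>n\<in>{0<..N}. f n * of_nat n powr (-s))"
        by (rule sum_lessThan_Suc_eq) simp
      ultimately show ?thesis
        using sum_by_parts[of f "\<lambda>n. of_nat n powr (-s)" N] by (simp add: h_def A_def)
    qed
    ultimately have "(\<lambda>N. \<Sum>n<Suc N. f n * of_nat n powr (-s)) \<longlonglongrightarrow> (\<Sum>n. h n s)" by simp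
    then show "(\<lambda>n. f n * of_nat n powr (-s)) sums (\<Sum>n. h n s)"
      unfolding sums_def by (rule LIMSEQ_imp_Suc)
  qed
qed

text \<open>The second-order estimate leaves terms of size \<open>n powr (c - Re s - 2)\<close>. It
  is used with \<open>c = 0\<close> to continue zeta and with \<open>c = 1\<close> to correct Abel
  summation in the Tauberian argument.\<close>

lemma taylor_series_holomorphic:
  fixes A :: "nat \<Rightarrow> complex"
  assumes bound: "\<And>n. norm (A n) \<le> C * real n powr c" "c \<ge> 0"
  defines "h \<equiv> \<lambda>n s. A n * (s * of_nat n powr (-1 - s) - of_nat n powr (-s) + of_nat (Suc n) powr (-s))"
  shows "\<And>s. Re s > c - 1 \<Longrightarrow> (\<lambda>n. h n s) sums (\<Sum>n. h n s)"
    and "(\<lambda>s. \<Sum>n. h n s) holomorphic_on {s. Re s > c - 1}"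
proof -
  have C: "C \<ge> 0" using bound(1)[of 1] by (auto intro: order.trans[OF norm_ge_zero])
  have hb: "norm (h n s) \<le> C * (norm s * norm (s + 1)) * real n powr (c - Re s - 2)" if "Re s > c - 1" for n s
  proof (cases "n = 0")
    case False
    have "norm (h n s) \<le> (C * real n powr c) * (norm s * norm (s + 1) * real n powr (-Re s - 2))"
      unfolding h_def norm_mult using False that bound(2) C
      by (intro mult_mono bound norm_powr_taylor_Suc_le) auto
    also have "\<dots> = C * (norm s * norm (s + 1)) * (real n powr c * real n powr (-Re s - 2))" by simp
    also have "real n powr c * real n powr (-Re s - 2) = real n powr (c - Re s - 2)"
      by (simp add: algebra_simps flip: powr_add)
    finally show ?thesis .
  qed (use bound(1)[of 0] in \<open>simp add: h_def\<close>)
  have *: "\<exists>M. summable M \<and> (\<forall>n s. Re s \<ge> r \<and> norm s \<le> R \<longrightarrow> norm (h n s) \<le> M n)" if "r > c - 1" for r R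
  proof (intro exI conjI allI impI)
    show "summable (\<lambda>n. C * (R * (R + 1)) * real n powr (c - r - 2))"
      using that by (intro summable_mult) (simp add: summable_real_powr_iff)
    fix n s assume s: "r \<le> Re s \<and> norm s \<le> R"
    have R: "R \<ge> 0" using s norm_ge_zero[of s] by linarith
    have "norm (s + 1) \<le> R + 1" using s norm_triangle_ineq[of s 1] by simp
    have "norm (h n s) \<le> C * (norm s * norm (s + 1)) * real n powr (c - Re s - 2)" using s that by (intro hb) auto
    also have "\<dots> \<le> C * (R * (R + 1)) * real n powr (c - r - 2)"
    proof (cases "n = 0")
      case False
      then show ?thesis using s C R \<open>norm (s + 1) \<le> R + 1\<close>
        by (intro mult_mono powr_mono mult_nonneg_nonneg mult_left_mono) auto
    qed simp
    finally show "norm (h n s) \<le> C * (R * (R + 1)) * real n powr (c - r - 2)" .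
  qed
  have hol: "h n holomorphic_on S" for n S
    unfolding h_def using bound(1)[of 0] by (cases "n = 0") (auto intro!: holomorphic_intros simp del: of_nat_Suc)
  show "\<And>s. Re s > c - 1 \<Longrightarrow> (\<lambda>n. h n s) sums (\<Sum>n. h n s)"
    and "(\<lambda>s. \<Sum>n. h n s) holomorphic_on {s. Re s > c - 1}"
    by (rule halfplane_series[of h "c - 1", OF hol *]; assumption)+
qed

section \<open>Dirichlet L-functions\<close>

text \<open>\<open>Z s\<close> is \<open>(s - 1)\<close> times zeta. With \<open>w = s - 1\<close>
  the Taylor errors of \<open>n powr (-w)\<close> telescope to \<open>w\<close> times the partial
  sum of zeta, plus \<open>(N + 1) powr (-w) - 1\<close>, and their series converges for
  \<open>Re w > -1\<close>.\<close>

lemma zeta_continuation: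
  obtains Z where "Z holomorphic_on {s. Re s > 0}" "Z 1 = 1"
    "\<And>s. Re s > 1 \<Longrightarrow> (\<lambda>n. of_nat n powr (-s)) sums (Z s / (s - 1))"
proof -
  \<comment> \<open>The bound \<open>norm (A n) \<le> real n powr 0\<close> forces
    \<open>A 0 = 0\<close>, because \<open>0 powr 0 = 0\<close>.\<close>
  define A :: "nat \<Rightarrow> complex" where "A n = (if n = 0 then 0 else 1)" for n
  define h where "h n s = A n * (s * of_nat n powr (-1 - s) - of_nat n powr (-s) + of_nat (Suc n) powr (-s))" for n s
  have A: "norm (A n) \<le> 1 * real n powr 0" for n by (simp add: A_def)
  have H1: "\<And>s. Re s > -1 \<Longrightarrow> (\<lambda>n. h n s) sums (\<Sum>n. h n s)"
    and H2: "(\<lambda>s. \<Sum>n. h n s) holomorphic_on {s. Re s > -1}"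
    unfolding h_def using taylor_series_holomorphic[of A 1 0, OF A] by simp_all
  define Z where "Z s = 1 + (\<Sum>n. h n (s - 1))" for s
  have "Z holomorphic_on {s. Re s > 0}"
    unfolding Z_def
    by (intro holomorphic_intros holomorphic_on_compose_gen[OF _ H2, unfolded o_def, of "\<lambda>s. s - 1"]) auto
  moreover have "Z 1 = 1"
  proof -
    have "h n 0 = 0" for n by (simp add: h_def A_def del: of_nat_Suc)
    then show ?thesis by (simp add: Z_def)
  qed
  moreover have "(\<lambda>n. of_nat n powr (-s)) sums (Z s / (s - 1))" if s: "Re s > 1" for s
  proof -
    define w where "w = s - 1"
    have w: "Re w > 0" "w \<noteq> 0" using s by (auto simp: w_def)
    have "sum (\<lambda>n. h n w) {..<Suc N} = w * (\<Sum>n<Suc N. of_nat n powr (-s)) + (of_nat (Suc N) powr (-w) - 1)" for N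
    proof (induction N)
      case 0
      then show ?case by (simp add: h_def A_def)
    next
      case (Suc N)
      have "h (Suc N) w = w * of_nat (Suc N) powr (-s) - of_nat (Suc N) powr (-w) + of_nat (Suc (Suc N)) powr (-w)"
        by (simp add: h_def A_def w_def)
      then show ?case unfolding sum.lessThan_Suc[of _ "Suc N"] Suc.IH
        by (simp add: algebra_simps del: of_nat_Suc)
    qed
    then have eq: "(\<Sum>n<Suc N. of_nat n powr (-s)) = (1 + sum (\<lambda>n. h n w) {..<Suc N} - of_nat (Suc N) powr (-w)) / w" for N
      using w by (simp add: field_simps del: of_nat_Suc)
    have "(\<lambda>N. sum (\<lambda>n. h n w) {..<Suc N}) \<longlonglongrightarrow> (\<Sum>n. h n w)"
      using H1[of w] w by (intro LIMSEQ_Suc) (simp add: sums_def)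
    moreover have "(\<lambda>N. of_nat (Suc N) powr (-w)) \<longlonglongrightarrow> 0"
    proof (rule tendsto_norm_zero_cancel)
      have "(\<lambda>N. real (Suc N) powr (- Re w)) \<longlonglongrightarrow> 0" using w by real_asymp
      then show "(\<lambda>N. norm (of_nat (Suc N) powr (-w))) \<longlonglongrightarrow> 0"
        by (simp add: norm_of_nat_powr del: of_nat_Suc)
    qed
    ultimately have "(\<lambda>N. (1 + sum (\<lambda>n. h n w) {..<Suc N} - of_nat (Suc N) powr (-w)) / w) \<longlonglongrightarrow> (1 + (\<Sum>n. h n w) - 0) / w"
      using w by (intro tendsto_intros) auto
    then have "(\<lambda>N. \<Sum>n<Suc N. of_nat n powr (-s)) \<longlonglongrightarrow> Z s / (s - 1)"
      unfolding eq by (simp add: Z_def w_def)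
    then show ?thesis unfolding sums_def by (rule LIMSEQ_imp_Suc)
  qed
  ultimately show thesis using that by blast
qed

lemma periodic_series_continuation:
  fixes f :: "nat \<Rightarrow> complex"
  assumes per: "\<And>a. f (m + a) = f a" and sum0: "(\<Sum>a<m. f a) = 0" and m: "m > 0"
  obtains H where "H holomorphic_on {s. Re s > 0}" "\<And>s. Re s > 0 \<Longrightarrow> (\<lambda>n. f n * of_nat n powr (-s)) sums H s"
proof -
  define C where "C = (\<Sum>a<m. norm (f a)) + norm (f 0)"
  have "norm (\<Sum>k\<in>{0<..n}. f k) \<le> C * real n powr 0" for n
  proof (cases "n = 0")
    case False
    have "{..<Suc n} = insert 0 {0<..n}" by auto
    then have "(\<Sum>k<Suc n. f k) = f 0 + (\<Sum>k\<in>{0<..n}. f k)" by simp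
    then have "(\<Sum>k\<in>{0<..n}. f k) = (\<Sum>k<Suc n. f k) - f 0" by (simp del: sum.lessThan_Suc)
    also have "norm \<dots> \<le> C"
      unfolding C_def using periodic_partial_sums_bounded[OF per sum0 m, of "Suc n"]
      by (intro order.trans[OF norm_triangle_ineq4] add_mono) (auto simp del: sum.lessThan_Suc)
    finally show ?thesis using False by simp
  qed simp
  from dirichlet_series_by_parts[OF order.refl this] that show thesis by metis
qed

text \<open>For the principal character the mean value \<open>c = \<phi>(m) / m\<close> is split
  off: what is left is periodic with zero sum, and \<open>c\<close> times zeta carries the pole.
  There \<open>L\<close> includes the factor \<open>s - 1\<close>, so that it is holomorphic in
  every case.\<close>

lemma dchar_series_continuation:
  assumes m: "m > 1" and \<xi>: "\<xi> \<in> dchar m"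
  obtains L where "L holomorphic_on {s. Re s > 0}" "\<xi> = chi0 m \<Longrightarrow> L 1 \<noteq> 0"
    "\<And>s. Re s > 1 \<Longrightarrow> (\<lambda>n. \<xi> n * of_nat n powr (-s)) sums (if \<xi> = chi0 m then L s / (s - 1) else L s)"
    "\<And>s. \<xi> \<noteq> chi0 m \<Longrightarrow> Re s > 0 \<Longrightarrow> (\<lambda>n. \<xi> n * of_nat n powr (-s)) sums L s"
proof (cases "\<xi> = chi0 m")
  case False
  have "\<xi> (m + a) = \<xi> a" for a by (rule dcharD(3)[OF \<xi>]) (simp add: cong_def)
  from periodic_series_continuation[OF this sum_dchar_eq_0[OF \<xi> False]] obtain H
    where H: "H holomorphic_on {s. Re s > 0}" "\<And>s. Re s > 0 \<Longrightarrow> (\<lambda>n. \<xi> n * of_nat n powr (-s)) sums H s"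
    using m by auto
  show thesis by (rule that[of H]) (use H False in auto)
next
  case True
  define c :: complex where "c = of_nat (totient m) / of_nat m"
  have c: "c \<noteq> 0" using m by (simp add: c_def)
  define f where "f a = chi0 m a - c" for a
  have "f (m + a) = f a" for a
    using dcharD(3)[OF chi0_in_dchar[of m], of "m + a" a] m by (simp add: f_def cong_def)
  moreover have "(\<Sum>a<m. f a) = 0" using sum_chi0[OF m] m by (simp add: f_def sum_subtractf c_def)
  ultimately obtain H where H: "H holomorphic_on {s. Re s > 0}" "\<And>s. Re s > 0 \<Longrightarrow> (\<lambda>n. f n * of_nat n powr (-s)) sums H s"
    using periodic_series_continuation[of f m] m by auto
  obtain Z where Z: "Z holomorphic_on {s. Re s > 0}" "Z 1 = 1"
    "\<And>s. Re s > 1 \<Longrightarrow> (\<lambda>n. of_nat n powr (-s)) sums (Z s / (s - 1))"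
    using zeta_continuation by blast
  show thesis
  proof (rule that[of "\<lambda>s. (s - 1) * H s + c * Z s"])
    show "(\<lambda>s. (s - 1) * H s + c * Z s) holomorphic_on {s. Re s > 0}"
      by (intro holomorphic_intros H Z)
    show "(1 - 1) * H 1 + c * Z 1 \<noteq> 0" using Z c by simp
    fix s :: complex assume s: "Re s > 1"
    have "(\<lambda>n. f n * of_nat n powr (-s) + c * of_nat n powr (-s)) sums (H s + c * (Z s / (s - 1)))"
      using s by (intro sums_add sums_mult H Z) auto
    moreover have "H s + c * (Z s / (s - 1)) = ((s - 1) * H s + c * Z s) / (s - 1)"
    proof -
      have "s - 1 \<noteq> 0" using s by auto
      then show ?thesis by (simp add: add_divide_distrib)
    qed
    ultimately show "(\<lambda>n. \<xi> n * of_nat n powr (-s)) sums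
        (if \<xi> = chi0 m then ((s - 1) * H s + c * Z s) / (s - 1) else (s - 1) * H s + c * Z s)"
      using True by (simp add: f_def algebra_simps)
  qed (use True in auto)
qed

section \<open>Euler product and logarithmic derivative\<close>

lemma sieve_sums:
  fixes f :: "nat \<Rightarrow> complex"
  assumes f: "f 0 = 0" "\<And>a b. f (a * b) = f a * f b" and sf: "summable (\<lambda>n. norm (f n))"
    and P: "finite P" "\<And>p. p \<in> P \<Longrightarrow> prime p"
  shows "(\<lambda>n. if \<exists>p\<in>P. p dvd n then 0 else f n) sums ((\<Prod>p\<in>P. 1 - f p) * (\<Sum>n. f n))"
  using P
proof (induction P rule: finite_induct)
  case empty
  then show ?case using summable_norm_cancel[OF sf] by (simp add: summable_sums)
next
  case (insert q P)
  define g where "g n = (if \<exists>p\<in>P. p dvd n then 0 else f n)" for n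
  define S where "S = (\<Prod>p\<in>P. 1 - f p) * (\<Sum>n. f n)"
  have q: "prime q" using insert.prems by simp
  have g: "g sums S" using insert unfolding g_def S_def by auto
  \<comment> \<open>A further prime \<open>q\<close> does not affect divisibility by the primes of
    \<open>P\<close>, so the multiples of \<open>q\<close> in the sieved series contribute
    \<open>f q\<close> times that series.\<close>
  have gq: "g (q * n) = f q * g n" for n
  proof -
    have "(\<exists>p\<in>P. p dvd q * n) \<longleftrightarrow> (\<exists>p\<in>P. p dvd n)"
      using insert.hyps insert.prems q by (metis insertCI prime_dvd_mult_iff primes_dvd_imp_eq)
    then show ?thesis by (simp add: g_def f)
  qed
  have "(\<lambda>n. f q * g n) sums (f q * S)" using g by (rule sums_mult)
  then have "(\<lambda>n. if q dvd n then g n else 0) sums (f q * S)"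
  proof (subst sums_mono_reindex[symmetric, of "\<lambda>n. q * n"])
    show "strict_mono (\<lambda>n. q * n)" using prime_gt_0_nat[OF q] by (simp add: strict_mono_def)
  qed (auto simp: gq elim!: dvdE)
  with g have "(\<lambda>n. g n - (if q dvd n then g n else 0)) sums (S - f q * S)" by (rule sums_diff)
  moreover have "g n - (if q dvd n then g n else 0) = (if \<exists>p\<in>insert q P. p dvd n then 0 else f n)" for n
    by (auto simp: g_def)
  moreover have "S - f q * S = (\<Prod>p\<in>insert q P. 1 - f p) * (\<Sum>n. f n)"
    using insert by (simp add: S_def algebra_simps)
  ultimately show ?case by simp
qed

text \<open>Once the primes up to \<open>N\<close> are sieved out, only \<open>n = 1\<close> and
  terms beyond \<open>N\<close> survive, and the latter are bounded by a tail of the absolutely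
  convergent series. Stating the limit of a product with the series, rather than of the reciprocal
  product, avoids any division and yields non-vanishing.\<close>

lemma euler_product:
  fixes f :: "nat \<Rightarrow> complex"
  assumes f: "f 0 = 0" "f 1 = 1" "\<And>a b. f (a * b) = f a * f b" and sf: "summable (\<lambda>n. norm (f n))"
  shows "(\<lambda>N. (\<Prod>p | prime p \<and> p \<le> N. 1 - f p) * (\<Sum>n. f n)) \<longlonglongrightarrow> 1"
proof (rule LIMSEQ_I)
  fix e :: real assume "e > 0"
  then obtain N0 where N0: "\<And>n. n \<ge> N0 \<Longrightarrow> norm (\<Sum>i. norm (f (i + n))) < e"
    using suminf_exist_split[OF _ sf] by blast
  show "\<exists>N0. \<forall>N\<ge>N0. norm ((\<Prod>p | prime p \<and> p \<le> N. 1 - f p) * (\<Sum>n. f n) - 1) < e"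
  proof (intro exI allI impI)
    fix N assume N: "N \<ge> N0 + 1"
    let ?P = "{p. prime p \<and> p \<le> N}"
    define g where "g n = (if \<exists>p\<in>?P. p dvd n then 0 else f n)" for n
    have gs: "g sums ((\<Prod>p\<in>?P. 1 - f p) * (\<Sum>n. f n))"
      unfolding g_def by (rule sieve_sums) (use f sf in auto)
    have small: "g n = 0" if n: "n \<le> N" "n \<noteq> 1" for n
    proof (cases "n = 0")
      case False
      then obtain p where "prime p" "p dvd n" using prime_factor_nat[OF n(2)] by blast
      moreover have "p \<le> N" using dvd_imp_le[OF \<open>p dvd n\<close>] False n by simp
      ultimately show ?thesis by (auto simp: g_def)
    qed (simp add: g_def f)
    have g1: "g 1 = 1" unfolding g_def using f(2) by (auto dest: prime_ge_2_nat)
    have "(\<Sum>n<Suc N. g n) = (\<Sum>n<Suc N. if n = 1 then 1 else 0)"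
      using small g1 by (intro sum.cong) auto
    also have "\<dots> = 1" using N by (simp add: sum.delta')
    finally have "(\<lambda>n. g (n + Suc N)) sums ((\<Prod>p\<in>?P. 1 - f p) * (\<Sum>n. f n) - 1)"
      using gs by (subst sums_iff_shift) simp
    then have "(\<Prod>p\<in>?P. 1 - f p) * (\<Sum>n. f n) - 1 = (\<Sum>n. g (n + Suc N))" by (rule sums_unique)
    also have "norm \<dots> \<le> (\<Sum>n. norm (f (n + Suc N)))"
    proof (rule norm_suminf_le)
      show "norm (g (n + Suc N)) \<le> norm (f (n + Suc N))" for n by (simp add: g_def)
      show "summable (\<lambda>n. norm (f (n + Suc N)))" using sf by (subst summable_iff_shift)
    qed
    also have "\<dots> < e" using N0[of "Suc N"] N by (simp only: real_norm_def) linarith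
    finally show "norm ((\<Prod>p\<in>?P. 1 - f p) * (\<Sum>n. f n) - 1) < e" .
  qed
qed


text \<open>Only primes carry weight, not their powers, so that the coefficients match Chebyshev's
  \<theta> rather than \<psi>.\<close>

definition prime_term :: "(nat \<Rightarrow> complex) \<Rightarrow> nat \<Rightarrow> complex \<Rightarrow> complex" where
  "prime_term \<xi> n s = (if prime n then \<xi> n * ln (real n) * of_nat n powr (-s) else 0)"

text \<open>The function \<open>E\<close> collects the contribution of the higher prime powers to the logarithmic derivative.\<close>
lemma dchar_log_derivative:
  assumes m: "m > 1" and \<xi>: "\<xi> \<in> dchar m"
    and L: "\<And>s. Re s > 1 \<Longrightarrow> (\<lambda>n. \<xi> n * of_nat n powr (-s)) sums L s"
  obtains E where "E holomorphic_on {s. Re s > 1/2}"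
    "\<And>s. Re s > 1 \<Longrightarrow> L s \<noteq> 0"
    "L holomorphic_on {s. Re s > 1}"
    "\<And>s. Re s > 1 \<Longrightarrow> (\<lambda>n. prime_term \<xi> n s) sums (- deriv L s / L s - E s)"
proof -
  define w where "w n s = \<xi> n * of_nat n powr (-s)" for n s
  have w_norm: "norm (w n s) \<le> real n powr (- Re s)" for n s
  proof (cases "n = 0")
    case False
    then show ?thesis using norm_dchar_le[OF \<xi>, of n] m
      by (simp add: w_def norm_mult norm_of_nat_powr mult_left_le_one_le)
  qed (simp add: w_def)
  have w_le: "norm (w n s) \<le> real n powr (- r)" if "Re s \<ge> r" "n > 0" for n s r
    using w_norm[of n s] powr_mono[of "- Re s" "- r" "real n"] that by simp
  have w_le2: "norm (w n s) \<le> 2 powr (- r)" if "Re s \<ge> r" "r > 0" "prime n" for n s r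
  proof -
    have "norm (w n s) \<le> real n powr (- r)" using w_le[OF that(1)] prime_gt_0_nat[OF that(3)] by blast
    also have "\<dots> \<le> 2 powr (- r)"
      using prime_ge_2_nat[OF that(3)] that(2) by (intro powr_mono2') auto
    finally show ?thesis .
  qed
  have w_hol: "(\<lambda>s. w n s) holomorphic_on S" for n S
    unfolding w_def by (cases "n = 0") (auto intro!: holomorphic_intros)
  have w_der: "((\<lambda>s. w n s) has_field_derivative (- ln (real n) * w n s)) (at s)" if "n > 0" for n s
  proof -
    have "((\<lambda>s. \<xi> n * exp (- s * Ln (of_nat n))) has_field_derivative
        (- Ln (of_nat n) * (\<xi> n * exp (- s * Ln (of_nat n))))) (at s)"
      by (auto intro!: derivative_eq_intros)
    then show ?thesis using that by (simp add: w_def powr_def Ln_of_nat)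
  qed
  \<comment> \<open>\<open>q\<close> is the logarithm of an Euler factor. In its derivative
    \<open>w / (1 - w) = w + w\<^sup>2 / (1 - w)\<close>: the first summand gives
    \<open>prime_term\<close>, and the second gives \<open>e\<close>, which is small enough to
    converge for \<open>Re s > 1/2\<close>.\<close>
  define q where "q n s = (if prime n then - Ln (1 - w n s) else 0)" for n s
  define e where "e n s = (if prime n then ln (real n) * ((w n s)\<^sup>2 / (1 - w n s)) else 0)" for n s
  have half: "norm (w n s) < 1/2" if "Re s > 1" "prime n" for n s
  proof -
    have "norm (w n s) \<le> 2 powr (- Re s)" using that by (intro w_le2) auto
    also have "\<dots> < 2 powr (-1)" using that by (intro powr_less_mono) auto
    finally show ?thesis by (simp add: powr_minus)
  qed
  have notR: "1 - w n s \<notin> \<real>\<^sub>\<le>\<^sub>0" if "Re s > 1" "prime n" for n s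
  proof -
    have "Re (w n s) < 1" using half[OF that] complex_Re_le_cmod[of "w n s"] by linarith
    then show ?thesis by (auto simp: complex_nonpos_Reals_iff)
  qed
  have q_der: "(q n has_field_derivative - (prime_term \<xi> n s + e n s)) (at s)" if "Re s > 1" for n s
  proof (cases "prime n")
    case True
    have ne: "1 - w n s \<noteq> 0" using notR[OF that True] by auto
    have "((\<lambda>s. - Ln (1 - w n s)) has_field_derivative - (inverse (1 - w n s) * (0 - (- ln (real n) * w n s)))) (at s)"
      using notR[OF that True] prime_gt_0_nat[OF True]
      by (intro derivative_intros DERIV_chain2[OF has_field_derivative_Ln] w_der) auto
    moreover have "inverse (1 - w n s) * (0 - (- ln (real n) * w n s)) = prime_term \<xi> n s + e n s"
    proof -
      have "w n s / (1 - w n s) = w n s + (w n s)\<^sup>2 / (1 - w n s)"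
        using ne by (simp add: field_simps power2_eq_square)
      then have "ln (real n) * (w n s / (1 - w n s)) = ln (real n) * w n s + ln (real n) * ((w n s)\<^sup>2 / (1 - w n s))"
        by (simp add: distrib_left)
      then show ?thesis using True by (simp add: prime_term_def e_def w_def field_simps)
    qed
    moreover have "q n = (\<lambda>s. - Ln (1 - w n s))" using True by (auto simp: q_def)
    ultimately show ?thesis by (simp only:)
  next
    case False
    then have "q n = (\<lambda>s. 0)" by (auto simp: q_def)
    then show ?thesis using False by (simp add: prime_term_def e_def)
  qed
  have opH: "open {s::complex. Re s > a}" for a by (rule open_halfspace_Re_gt)
  have q_hol: "q n holomorphic_on {s. Re s > 1}" for n
    using q_der by (subst holomorphic_on_open[OF opH]) blast
  have q_dom: "\<exists>M. summable M \<and> (\<forall>n s. Re s \<ge> r \<and> norm s \<le> R \<longrightarrow> norm (q n s) \<le> M n)" if "r > 1" for r R :: real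
  proof (intro exI conjI allI impI)
    show "summable (\<lambda>n. 2 * real n powr (- r))"
      using that by (intro summable_mult) (simp add: summable_real_powr_iff)
    fix n s assume s: "r \<le> Re s \<and> norm s \<le> R"
    show "norm (q n s) \<le> 2 * real n powr (- r)"
    proof (cases "prime n")
      case True
      have "norm (q n s) \<le> 2 * norm (w n s)"
        using norm_Ln_le[of "- w n s"] half[of s n] True s that by (simp add: q_def)
      also have "\<dots> \<le> 2 * real n powr (- r)" using w_le[of r s n] s prime_gt_0_nat[OF True] by simp
      finally show ?thesis .
    qed (simp add: q_def)
  qed
  define Q where "Q s = (\<Sum>n. q n s)" for s
  have Q1: "(\<lambda>n. q n s) sums Q s" if "Re s > 1" for s
    unfolding Q_def by (rule halfplane_series(1)[where f = q and a = 1, OF q_hol q_dom that])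
  have Q2: "Q holomorphic_on {s. Re s > 1}"
    unfolding Q_def by (rule halfplane_series(2)[where f = q and a = 1, OF q_hol q_dom])
  have Q3: "(\<lambda>n. deriv (q n) s) sums deriv Q s" if "Re s > 1" for s
    unfolding Q_def by (rule halfplane_series(3)[where f = q and a = 1, OF q_hol q_dom that])
  have e_hol: "e n holomorphic_on {s. Re s > 1/2}" for n
  proof (cases "prime n")
    case True
    have "1 - w n s \<noteq> 0" if "Re s > 1/2" for s
    proof -
      have "norm (w n s) \<le> 2 powr (-(1/2))" using that True by (intro w_le2) auto
      also have "\<dots> < 2 powr 0" by (rule powr_less_mono) auto
      finally show ?thesis by auto
    qed
    then show ?thesis unfolding e_def using True by (auto intro!: holomorphic_intros w_hol)
  next
    case False
    then have "e n = (\<lambda>s. 0)" by (auto simp: e_def)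
    then show ?thesis by simp
  qed
  have e_dom: "\<exists>M. summable M \<and> (\<forall>n s. Re s \<ge> r \<and> norm s \<le> R \<longrightarrow> norm (e n s) \<le> M n)" if r: "r > 1/2" for r R :: real
  proof -
    define c where "c = 1 / (1 - 2 powr (- r))"
    have c: "2 powr (- r) < (1::real)" using powr_less_mono[of "-r" 0 2] r by simp
    show ?thesis
    proof (intro exI conjI allI impI)
      show "summable (\<lambda>n. c * (ln (real n) * real n powr (- 2 * r)))"
      proof (rule summable_mult, rule summable_comparison_test_bigo)
        \<comment> \<open>From \<open>r > 1/2\<close> follows \<open>2 * r > r + 1/2 > 1\<close>;
          the gap absorbs the logarithm.\<close>
        show "summable (\<lambda>n. norm (real n powr (- (r + 1/2))))" using r by (simp add: summable_real_powr_iff)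
        show "(\<lambda>n. ln (real n) * real n powr (- 2 * r)) \<in> O(\<lambda>n. real n powr (- (r + 1/2)))"
          using r by real_asymp
      qed
      fix n s assume s: "r \<le> Re s \<and> norm s \<le> R"
      show "norm (e n s) \<le> c * (ln (real n) * real n powr (- 2 * r))"
      proof (cases "prime n")
        case True
        have w1: "norm (w n s) \<le> 2 powr (- r)" using s r True by (intro w_le2) auto
        have "norm (1 - w n s) \<ge> 1 - 2 powr (- r)" using norm_triangle_ineq2[of 1 "w n s"] w1 by simp
        then have "1 / norm (1 - w n s) \<le> c" unfolding c_def using c by (intro divide_left_mono mult_pos_pos) auto
        moreover have "(norm (w n s))\<^sup>2 \<le> real n powr (- 2 * r)"
        proof -
          have "(norm (w n s))\<^sup>2 \<le> (real n powr (- r))\<^sup>2"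
            using s prime_gt_0_nat[OF True] by (intro power_mono w_le) auto
          also have "\<dots> = real n powr (- 2 * r)" by (simp add: power2_eq_square flip: powr_add)
          finally show ?thesis .
        qed
        moreover have "ln (real n) \<ge> 0" using prime_gt_0_nat[OF True] by simp
        ultimately have "ln (real n) * ((norm (w n s))\<^sup>2 * (1 / norm (1 - w n s)))
            \<le> ln (real n) * (real n powr (- 2 * r) * c)"
          using c by (intro mult_left_mono mult_mono) auto
        then show ?thesis using True \<open>ln (real n) \<ge> 0\<close> by (simp add: e_def norm_mult norm_divide norm_power mult_ac)
      next
        case False
        then show ?thesis using c by (cases "n = 0") (auto simp: e_def c_def)
      qed
    qed
  qed
  define E where "E s = (\<Sum>n. e n s)" for s
  have E1: "(\<lambda>n. e n s) sums E s" if "Re s > 1/2" for s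
    unfolding E_def by (rule halfplane_series(1)[where f = e and a = "1/2", OF e_hol e_dom that])
  have E2: "E holomorphic_on {s. Re s > 1/2}"
    unfolding E_def by (rule halfplane_series(2)[where f = e and a = "1/2", OF e_hol e_dom])
  \<comment> \<open>Exponentiating needs no branch of the logarithm of \<open>L\<close>, and it
    shows at once that \<open>L s \<noteq> 0\<close>.\<close>
  have exp_Q: "exp (Q s) = L s" if s: "Re s > 1" for s
  proof -
    let ?f = "\<lambda>n. w n s"
    have L': "(\<Sum>n. ?f n) = L s" using L[OF s] by (simp add: w_def sums_iff)
    have mult: "?f (a * b) = ?f a * ?f b" for a b
      unfolding w_def using dcharD(2)[OF \<xi>, of a b] powr_times_real[of "of_nat a" "of_nat b" "-s"]
      by (simp add: mult_ac)
    have "(\<lambda>N. (\<Prod>p | prime p \<and> p \<le> N. 1 - ?f p) * (\<Sum>n. ?f n)) \<longlonglongrightarrow> 1"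
    proof (rule euler_product)
      show "summable (\<lambda>n. norm (?f n))"
      proof (rule summable_comparison_test')
        show "summable (\<lambda>n. real n powr (- Re s))" using s by (simp add: summable_real_powr_iff)
        show "norm (norm (?f n)) \<le> real n powr (- Re s)" if "n \<ge> 0" for n using w_norm[of n s] by simp
      qed
      show "?f 1 = 1" using dcharD(1)[OF \<xi>] by (simp add: w_def)
      show "?f 0 = 0" by (simp add: w_def)
    qed (rule mult)
    then have "(\<lambda>N. (\<Prod>p | prime p \<and> p \<le> N. 1 - ?f p) * L s) \<longlonglongrightarrow> 1" unfolding L' .
    moreover have "(\<lambda>N. exp (- (\<Sum>n<Suc N. q n s)) * L s) \<longlonglongrightarrow> exp (- Q s) * L s"
      using Q1[OF s] by (intro tendsto_intros LIMSEQ_Suc) (simp add: sums_def)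
    moreover have "exp (- (\<Sum>n<Suc N. q n s)) = (\<Prod>p | prime p \<and> p \<le> N. 1 - ?f p)" for N
    proof -
      have "(\<Sum>n<Suc N. q n s) = (\<Sum>p | prime p \<and> p \<le> N. - Ln (1 - ?f p))"
        unfolding q_def by (subst sum.inter_filter[symmetric]) (auto intro!: sum.cong)
      then have "exp (- (\<Sum>n<Suc N. q n s)) = (\<Prod>p | prime p \<and> p \<le> N. exp (Ln (1 - ?f p)))"
        by (simp add: sum_negf exp_sum)
      also have "\<dots> = (\<Prod>p | prime p \<and> p \<le> N. 1 - ?f p)"
      proof (intro prod.cong refl exp_Ln)
        fix p assume "p \<in> {p. prime p \<and> p \<le> N}"
        then show "1 - w p s \<noteq> 0" using notR[OF s, of p] by auto
      qed
      finally show ?thesis .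
    qed
    ultimately have "exp (- Q s) * L s = 1" by (auto intro: LIMSEQ_unique)
    then show ?thesis by (simp add: exp_minus field_simps)
  qed
  have L_der: "(L has_field_derivative (exp (Q s) * deriv Q s)) (at s)" if "Re s > 1" for s
  proof (rule has_field_derivative_transform_within_open)
    show "((\<lambda>s. exp (Q s)) has_field_derivative (exp (Q s) * deriv Q s)) (at s)"
      using holomorphic_derivI[OF Q2 opH, of s] that by (auto intro!: derivative_eq_intros)
  qed (use opH[of 1] that exp_Q in auto)
  show thesis
  proof (rule that[OF E2])
    show "L s \<noteq> 0" if "Re s > 1" for s using exp_Q[OF that] by auto
    show "L holomorphic_on {s. Re s > 1}" using L_der by (subst holomorphic_on_open[OF opH]) blast
    fix s :: complex assume s: "Re s > 1"
    have "deriv L s = exp (Q s) * deriv Q s" using L_der[OF s] by (rule DERIV_imp_deriv)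
    then have LL: "deriv L s / L s = deriv Q s" using exp_Q[OF s] by (metis exp_not_eq_zero nonzero_mult_div_cancel_left)
    have "deriv (q n) s = - (prime_term \<xi> n s + e n s)" for n using q_der[OF s] by (rule DERIV_imp_deriv)
    then have "(\<lambda>n. - (prime_term \<xi> n s + e n s)) sums deriv Q s" using Q3[OF s] by simp
    from sums_diff[OF sums_minus[OF this] E1[of s]] s
    have "(\<lambda>n. prime_term \<xi> n s) sums (- deriv Q s - E s)" by simp
    then show "(\<lambda>n. prime_term \<xi> n s) sums (- deriv L s / L s - E s)" using LL by (simp add: minus_divide_left)
  qed
qed

section \<open>Real characters\<close>

text \<open>The terms \<open>t ^ i\<close> and \<open>t ^ (n - i)\<close> have geometric mean
  \<open>sqrt (t ^ n)\<close>, so pairing them and applying the arithmetic-geometric inequality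
  bounds the geometric sum.\<close>

lemma geometric_sum_ge:
  fixes t :: real
  assumes "0 < t" "t < 1"
  shows "(1 - t ^ Suc n) / (1 - t) \<ge> real (Suc n) * sqrt (t ^ n)"
proof -
  have sum: "(1 - t ^ Suc n) / (1 - t) = (\<Sum>i<Suc n. t ^ i)"
    using assms by (simp add: sum_gp_strict del: sum.lessThan_Suc power_Suc)
  have "(\<Sum>i<Suc n. 2 * sqrt (t ^ n)) \<le> (\<Sum>i<Suc n. t ^ i + t ^ (Suc n - Suc i))"
  proof (rule sum_mono)
    fix i assume i: "i \<in> {..<Suc n}"
    then have "t ^ n = t ^ i * t ^ (Suc n - Suc i)" by (simp flip: power_add)
    then have "sqrt (t ^ n) = sqrt (t ^ i * t ^ (Suc n - Suc i))" by simp
    also have "\<dots> \<le> (t ^ i + t ^ (Suc n - Suc i)) / 2"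
      using assms by (intro arith_geo_mean_sqrt) auto
    finally show "2 * sqrt (t ^ n) \<le> t ^ i + t ^ (Suc n - Suc i)" by simp
  qed
  also have "\<dots> = (\<Sum>i<Suc n. t ^ i) + (\<Sum>i<Suc n. t ^ (Suc n - Suc i))" by (rule sum.distrib)
  also have "(\<Sum>i<Suc n. t ^ (Suc n - Suc i)) = (\<Sum>i<Suc n. t ^ i)" by (rule sum.nat_diff_reindex)
  finally show ?thesis unfolding sum by (simp del: sum.lessThan_Suc)
qed

text \<open>This monotonicity is the heart of Monsky's proof that \<open>L(1, \<xi>) \<noteq> 0\<close> for real characters.\<close>
lemma lambert_difference_antimono:
  fixes t :: real
  assumes t: "0 < t" "t < 1" and n: "n > 0"
  defines "b \<equiv> \<lambda>n. 1 / (real n * (1 - t)) - t ^ n / (1 - t ^ n)"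
  shows "b (Suc n) \<le> b n"
proof -
  let ?A = "(1 - t ^ n) / (1 - t)" and ?B = "(1 - t ^ Suc n) / (1 - t)"
  have lt: "t ^ n < 1" "t ^ Suc n < 1" using t n by (simp_all add: power_less_one_iff del: power_Suc)
  have pos: "?A > 0" "?B > 0" using lt t by (simp_all del: power_Suc)
  obtain k where k: "n = Suc k" using n by (cases n) auto
  \<comment> \<open>\<open>?A\<close> has only \<open>n\<close> terms, for which the lemma gives the
    larger root \<open>sqrt (t ^ (n - 1))\<close>. It is weakened to \<open>sqrt (t ^ n)\<close> so
    that the product with the bound for \<open>?B\<close> contains exactly
    \<open>t ^ n\<close>.\<close>
  have "sqrt (t ^ n) \<le> sqrt (t ^ k)" using t k by (intro real_sqrt_le_mono power_decreasing) auto
  then have "real n * sqrt (t ^ n) \<le> real n * sqrt (t ^ k)" by (intro mult_left_mono) auto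
  also have "\<dots> \<le> ?A" unfolding k by (rule geometric_sum_ge[OF t])
  finally have AB1: "real n * sqrt (t ^ n) * (real (Suc n) * sqrt (t ^ n)) \<le> ?A * ?B"
    using geometric_sum_ge[OF t, of n] pos t by (intro mult_mono) auto
  have AB2: "real n * sqrt (t ^ n) * (real (Suc n) * sqrt (t ^ n)) = real n * real (Suc n) * t ^ n"
  proof -
    have "sqrt (t ^ n) * sqrt (t ^ n) = t ^ n" using t by simp
    then show ?thesis by (metis mult.assoc mult.left_commute)
  qed
  have AB: "real n * real (Suc n) * t ^ n \<le> ?A * ?B" using AB1 unfolding AB2 .
  have "t ^ n * (1 - t) / ((1 - t ^ n) * (1 - t ^ Suc n)) = t ^ n / (?A * ?B) / (1 - t)"
  proof -
    have "u * (1 - t) / ((1 - u) * (1 - v)) = u / (((1 - u) / (1 - t)) * ((1 - v) / (1 - t))) / (1 - t)" for u v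
      using t by (simp add: divide_simps)
    then show ?thesis .
  qed
  also have "\<dots> \<le> 1 / (real n * real (Suc n)) / (1 - t)"
  proof (rule divide_right_mono)
    show "t ^ n / (?A * ?B) \<le> 1 / (real n * real (Suc n))"
    proof -
      have "u / y \<le> 1 / x" if "x * u \<le> y" "x > 0" "y > 0" for u x y :: real
        using that by (simp add: divide_simps mult.commute)
      from this[OF AB _ mult_pos_pos[OF pos]] show ?thesis using n by simp
    qed
  qed (use t in simp)
  also have "\<dots> = 1 / (real n * (1 - t)) - 1 / (real (Suc n) * (1 - t))"
  proof -
    have "1 / (x * (1 + x)) / y = 1 / (x * y) - 1 / ((1 + x) * y)" if "x > 0" "y > 0" for x y :: real
      using that by (simp add: divide_simps)
    from this[of "real n" "1 - t"] show ?thesis using n t by simp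
  qed
  finally have "t ^ n * (1 - t) / ((1 - t ^ n) * (1 - t ^ Suc n)) \<le> 1 / (real n * (1 - t)) - 1 / (real (Suc n) * (1 - t))" .
  moreover have "t ^ n * (1 - t) / ((1 - t ^ n) * (1 - t ^ Suc n)) = t ^ n / (1 - t ^ n) - t ^ Suc n / (1 - t ^ Suc n)"
    using lt by (simp add: divide_simps) (simp add: algebra_simps)
  ultimately show ?thesis unfolding b_def by linarith
qed

lemma divisor_sum_coprime_mult:
  fixes c :: "nat \<Rightarrow> real"
  assumes c: "\<And>a b. c (a * b) = c a * c b" and ab: "coprime a b" "a > 0" "b > 0"
  shows "(\<Sum>d | d dvd a * b. c d) = (\<Sum>d | d dvd a. c d) * (\<Sum>d | d dvd b. c d)"
proof -
  have g: "gcd (x * y) a = x" "gcd (x * y) b = y" if xy: "x dvd a" "y dvd b" for x y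
  proof -
    have "coprime b x" "coprime a y"
      using coprime_divisors[OF xy(1) dvd_refl ab(1)] coprime_divisors[OF dvd_refl xy(2) ab(1)]
      by (simp_all add: coprime_commute)
    from gcd_mult_left_left_cancel[OF this(1), of y] gcd_mult_left_right_cancel[OF this(2), of x] xy show "gcd (x * y) a = x" "gcd (x * y) b = y" by (simp_all add: gcd_nat.absorb1)
  qed
  have "(\<Sum>d | d dvd a * b. c d) = (\<Sum>(x, y)\<in>{d. d dvd a} \<times> {d. d dvd b}. c (x * y))"
  proof (rule sum.reindex_bij_witness[of _ "\<lambda>(x, y). x * y" "\<lambda>d. (gcd d a, gcd d b)"])
    fix d assume "d \<in> {d. d dvd a * b}"
    then obtain x y where "d = x * y" "x dvd a" "y dvd b" using division_decomp by blast
    then have *: "gcd d a * gcd d b = d" using g by simp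
    show "(case (gcd d a, gcd d b) of (x, y) \<Rightarrow> x * y) = d" using * by simp
    show "(gcd d a, gcd d b) \<in> {d. d dvd a} \<times> {d. d dvd b}" by simp
    show "(case (gcd d a, gcd d b) of (x, y) \<Rightarrow> c (x * y)) = c d" using * by simp
  next
    fix z assume "z \<in> {d. d dvd a} \<times> {d. d dvd b}"
    then obtain x y where z: "z = (x, y)" "x dvd a" "y dvd b" by auto
    then show "(gcd (case z of (x, y) \<Rightarrow> x * y) a, gcd (case z of (x, y) \<Rightarrow> x * y) b) = z" using g by simp
    show "(case z of (x, y) \<Rightarrow> x * y) \<in> {d. d dvd a * b}" using z by (simp add: mult_dvd_mono)
  qed
  also have "\<dots> = (\<Sum>d | d dvd a. c d) * (\<Sum>d | d dvd b. c d)"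
    by (simp add: c sum_product sum.cartesian_product)
  finally show ?thesis .
qed

lemma divisor_sum_prime_power:
  fixes c :: "nat \<Rightarrow> real"
  assumes c: "c 1 = 1" "\<And>a b. c (a * b) = c a * c b" and p: "prime p"
  shows "(\<Sum>d | d dvd p ^ k. c d) = (\<Sum>i\<le>k. c p ^ i)"
proof -
  have pow: "c (p ^ i) = c p ^ i" for i by (induction i) (simp_all add: c c(1)[simplified])
  have "{d. d dvd p ^ k} = (\<lambda>i. p ^ i) ` {..k}" using divides_primepow_nat[OF p] by auto
  moreover have "inj_on (\<lambda>i. p ^ i) {..k}"
    using prime_gt_1_nat[OF p] by (auto intro!: inj_onI)
  ultimately show ?thesis by (simp add: sum.reindex pow)
qed

lemma sum_powers_sign:
  fixes x :: real
  assumes "x \<in> {-1, 0, 1}"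
  shows "(\<Sum>i\<le>k. x ^ i) \<ge> 0" "even k \<Longrightarrow> (\<Sum>i\<le>k. x ^ i) \<ge> 1"
proof -
  have "(\<Sum>i\<le>k. (-1::real) ^ i) = (if even k then 1 else 0)" by (induction k) auto
  moreover have "(\<Sum>i\<le>k. (0::real) ^ i) = 1" by (induction k) auto
  ultimately show "(\<Sum>i\<le>k. x ^ i) \<ge> 0" "even k \<Longrightarrow> (\<Sum>i\<le>k. x ^ i) \<ge> 1"
    using assms by auto
qed

text \<open>Multiplicativity reduces the claim to prime powers, where the sum is a geometric sum
  with ratio in \<open>{-1, 0, 1}\<close>.\<close>

lemma divisor_sum_nonneg:
  fixes c :: "nat \<Rightarrow> real"
  assumes c: "c 1 = 1" "\<And>a b. c (a * b) = c a * c b" "\<And>a. c a \<in> {-1, 0, 1}" and n: "n > 0"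
  shows "(\<Sum>d | d dvd n. c d) \<ge> 0"
  using n
proof (induction n rule: less_induct)
  case (less n)
  show ?case
  proof (cases "n = 1")
    case True
    then show ?thesis using c(1) by simp
  next
    case False
    then obtain p where p: "prime p" "p dvd n" using prime_factor_nat by blast
    define k where "k = multiplicity p n"
    obtain q where q: "n = p ^ k * q" "\<not> p dvd q"
      unfolding k_def by (rule multiplicity_decompose'[of n p]) (use p less.prems in auto)
    have "k > 0" unfolding k_def using p less.prems by (simp add: prime_multiplicity_gt_zero_iff)
    then have "p ^ k > 1" using prime_gt_1_nat[OF p(1)] by (metis one_less_power)
    have q0: "q > 0" using q less.prems by (cases q) auto
    then have "q < n" using q(1) \<open>p ^ k > 1\<close> by simp
    then have "(\<Sum>d | d dvd q. c d) \<ge> 0" using less.IH q0 by blast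
    moreover have "(\<Sum>d | d dvd n. c d) = (\<Sum>d | d dvd p ^ k. c d) * (\<Sum>d | d dvd q. c d)"
      unfolding q(1) using prime_imp_coprime[OF p(1) q(2)] q0 prime_gt_0_nat[OF p(1)]
      by (intro divisor_sum_coprime_mult c) auto
    moreover have "(\<Sum>d | d dvd p ^ k. c d) \<ge> 0"
      using divisor_sum_prime_power[OF c(1,2) p(1)] sum_powers_sign(1)[OF c(3)] by simp
    ultimately show ?thesis by simp
  qed
qed

text \<open>A Lambert term is a geometric series over the multiples of \<open>n\<close>. Writing it
  as a series over all \<open>l\<close> prepares the rearrangement by powers of \<open>t\<close>,
  whose coefficients are divisor sums.\<close>

lemma lambert_term_sums:
  fixes t :: real
  assumes "0 < t" "t < 1" "n > 0"
  shows "(\<lambda>l. if n dvd l \<and> l > 0 then t ^ l else 0) sums (t ^ n / (1 - t ^ n))"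
proof -
  have "t ^ n < 1" using assms by (simp add: power_less_one_iff)
  then have "(\<lambda>j. t ^ n * (t ^ n) ^ j) sums (t ^ n * (1 / (1 - t ^ n)))"
    using assms by (intro sums_mult geometric_sums) auto
  then have "(\<lambda>j. (\<lambda>l. if n dvd l \<and> l > 0 then t ^ l else 0) (n * Suc j)) sums (t ^ n / (1 - t ^ n))"
    using assms(3) by (simp add: power_mult power_add)
  then show ?thesis
  proof (subst (asm) sums_mono_reindex)
    show "strict_mono (\<lambda>j. n * Suc j)" using assms(3) by (auto simp: strict_mono_def)
    show "(if n dvd l \<and> l > 0 then t ^ l else 0) = 0" if "l \<notin> range (\<lambda>j. n * Suc j)" for l
    proof -
      have False if "n dvd l" "l > 0"
      proof -
        from that obtain k where k: "l = n * k" "k > 0" by (auto elim!: dvdE)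
        then have "l = n * Suc (k - 1)" by simp
        then show False using \<open>l \<notin> _\<close> by blast
      qed
      then show ?thesis by auto
    qed
  qed
qed

text \<open>If the series vanished, subtracting \<open>1 / (1 - t)\<close> times it would turn the
  Lambert series into minus the sum of \<open>c n * b n\<close>. Abel summation bounds this by
  \<open>M\<close>, since \<open>b\<close> falls from 1 to 0. But the Lambert series is also the sum
  of \<open>r l * t ^ l\<close> with \<open>r l \<ge> 0\<close>, and letting \<open>t\<close> tend
  to 1 bounds all partial sums of \<open>r\<close>, although \<open>r\<close> is at least 1 at every
  even power of 2.\<close>

theorem real_character_sum_nonzero:
  fixes c :: "nat \<Rightarrow> real"
  assumes c: "c 1 = 1" "\<And>a b. c (a * b) = c a * c b" "\<And>a. c a \<in> {-1, 0, 1}"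
    and bound: "\<And>n. \<bar>\<Sum>k\<in>{0<..n}. c k\<bar> \<le> M"
  shows "\<not> (\<lambda>N. \<Sum>n\<in>{0<..N}. c n / real n) \<longlonglongrightarrow> 0"
proof
  assume lim0: "(\<lambda>N. \<Sum>n\<in>{0<..N}. c n / real n) \<longlonglongrightarrow> 0"
  define r where "r l = (\<Sum>d | d dvd l. c d)" for l
  have r_nonneg: "r l \<ge> 0" if "l > 0" for l unfolding r_def using divisor_sum_nonneg[OF c that] .
  have main: "(\<Sum>l\<in>{0<..L}. r l * t ^ l) \<le> M" if t: "0 < t" "t < 1" for t L
  proof -
    define b where "b n = 1 / (real n * (1 - t)) - t ^ n / (1 - t ^ n)" for n
    define D where "D N = (\<Sum>n\<in>{0<..N}. c n * (t ^ n / (1 - t ^ n)))" for N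
    have b_mono: "b (Suc n) \<le> b n" if "n > 0" for n
      unfolding b_def using lambert_difference_antimono[OF t that] .
    have b_lim: "b \<longlonglongrightarrow> 0" unfolding b_def using t by real_asymp
    have b1: "b 1 = 1" using t by (simp add: b_def field_simps)
    have bN: "b (Suc N) \<ge> 0" for N
    proof -
      have "decseq (\<lambda>n. b (Suc n))" using b_mono by (intro decseq_SucI) simp
      then show ?thesis using LIMSEQ_Suc[OF b_lim] by (rule decseq_ge)
    qed
    have abel: "\<bar>\<Sum>n\<in>{0<..N}. c n * b n\<bar> \<le> M" for N
    proof -
      have M: "M \<ge> 0" using bound[of 0] by simp
      have "\<bar>\<Sum>n\<in>{0<..N}. c n * b n\<bar> \<le> \<bar>\<Sum>n\<in>{0<..N}. (\<Sum>k\<in>{0<..n}. c k) * (b n - b (Suc n))\<bar> + \<bar>(\<Sum>k\<in>{0<..N}. c k) * b (Suc N)\<bar>"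
        unfolding sum_by_parts[of c b N] by (rule abs_triangle_ineq)
      also have "\<dots> \<le> (\<Sum>n\<in>{0<..N}. M * (b n - b (Suc n))) + M * b (Suc N)"
      proof (intro add_mono order.trans[OF sum_abs] sum_mono)
        show "\<bar>(\<Sum>k\<in>{0<..n}. c k) * (b n - b (Suc n))\<bar> \<le> M * (b n - b (Suc n))" if "n \<in> {0<..N}" for n
          unfolding abs_mult using bound[of n] b_mono[of n] that M by (intro mult_mono) auto
        show "\<bar>(\<Sum>k\<in>{0<..N}. c k) * b (Suc N)\<bar> \<le> M * b (Suc N)"
          unfolding abs_mult using bound[of N] bN M by (intro mult_mono) auto
      qed
      also have "(\<Sum>n\<in>{0<..N}. M * (b n - b (Suc n))) = M * (b 1 - b (Suc N))"
      proof (induction N)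
        case (Suc N)
        have "{0<..Suc N} = insert (Suc N) {0<..N}" by auto
        then show ?case using Suc by (simp add: algebra_simps)
      qed simp
      finally show ?thesis using b1 by (simp add: algebra_simps)
    qed
    \<comment> \<open>Only the Lambert terms up to \<open>N\<close> are rearranged, so that no
      double series arises. Beyond \<open>N\<close> the truncated divisor sum at \<open>l\<close> is
      at most \<open>l\<close> in absolute value, and \<open>T N\<close> bounds the resulting
      error.\<close>
    define T where "T N = (\<Sum>l. real (l + Suc N) * t ^ (l + Suc N))" for N
    have lsum: "summable (\<lambda>l. real l * t ^ l)"
    proof -
      have "summable (\<lambda>l. real (Suc l) * t ^ l - t ^ l)"
        using t geometric_deriv_sums[of t] by (intro summable_diff summable_geometric) (auto simp: sums_iff)
      then show ?thesis by (simp add: algebra_simps)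
    qed
    have T_lim: "T \<longlonglongrightarrow> 0"
    proof (rule LIMSEQ_I)
      fix e :: real assume "e > 0"
      then obtain N0 where "\<And>n. n \<ge> N0 \<Longrightarrow> norm (\<Sum>i. real (i + n) * t ^ (i + n)) < e"
        using suminf_exist_split[OF _ lsum] by blast
      then have "norm (T N - 0) < e" if "N \<ge> N0" for N
        using that unfolding T_def diff_zero by (meson le_SucI)
      then show "\<exists>N0. \<forall>N\<ge>N0. norm (T N - 0) < e" by blast
    qed
    have ineq: "(\<Sum>l\<in>{0<..L}. r l * t ^ l) \<le> D N + T N" if N: "N \<ge> L" for N
    proof -
      define rN where "rN l = (\<Sum>n\<in>{0<..N}. if n dvd l \<and> l > 0 then c n else 0)" for l
      have "(\<lambda>l. \<Sum>n\<in>{0<..N}. c n * (if n dvd l \<and> l > 0 then t ^ l else 0)) sums D N"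
        unfolding D_def using t by (intro sums_sum sums_mult lambert_term_sums) auto
      also have "(\<lambda>l. \<Sum>n\<in>{0<..N}. c n * (if n dvd l \<and> l > 0 then t ^ l else 0)) = (\<lambda>l. rN l * t ^ l)"
        unfolding rN_def sum_distrib_right by (intro ext sum.cong) auto
      finally have sN: "(\<lambda>l. rN l * t ^ l) sums D N" .
      then have tail: "(\<lambda>l. rN (l + Suc N) * t ^ (l + Suc N)) sums (D N - (\<Sum>l<Suc N. rN l * t ^ l))"
        by (subst sums_iff_shift) (simp del: sum.lessThan_Suc)
      have rN_le: "\<bar>rN l\<bar> \<le> real l" for l
      proof (cases "l = 0")
        case False
        have "\<bar>rN l\<bar> \<le> (\<Sum>n\<in>{0<..N}. if n dvd l \<and> l > 0 then 1 else 0)"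
          unfolding rN_def
        proof (intro order.trans[OF sum_abs] sum_mono)
          show "\<bar>if n dvd l \<and> l > 0 then c n else 0\<bar> \<le> (if n dvd l \<and> l > 0 then 1 else 0)" for n
            using c(3)[of n] by auto
        qed
        also have "\<dots> = real (card {n\<in>{0<..N}. n dvd l \<and> l > 0})"
          by (simp add: sum.If_cases Int_def)
        also have "\<dots> \<le> real (card {0<..l})"
          using False by (intro of_nat_mono card_mono) (auto dest: dvd_imp_le)
        finally show ?thesis by simp
      qed (simp add: rN_def)
      have "norm (D N - (\<Sum>l<Suc N. rN l * t ^ l)) \<le> T N"
        unfolding sums_unique[OF tail] T_def
      proof (rule norm_suminf_le)
        show "norm (rN (l + Suc N) * t ^ (l + Suc N)) \<le> real (l + Suc N) * t ^ (l + Suc N)" for l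
          unfolding norm_mult using rN_le[of "l + Suc N"] t
          by (intro mult_mono) (auto simp del: of_nat_Suc power_Suc of_nat_add)
        show "summable (\<lambda>l. real (l + Suc N) * t ^ (l + Suc N))" using lsum by (subst summable_iff_shift)
      qed
      then have "(\<Sum>l<Suc N. rN l * t ^ l) \<le> D N + T N" by (simp only: real_norm_def abs_le_iff) linarith
      moreover have "(\<Sum>l<Suc N. rN l * t ^ l) = (\<Sum>l\<in>{0<..N}. r l * t ^ l)"
      proof -
        have "(\<Sum>l<Suc N. rN l * t ^ l) = (\<Sum>l\<in>{0<..N}. rN l * t ^ l)"
          by (rule sum_lessThan_Suc_eq) (simp add: rN_def)
        also have "\<dots> = (\<Sum>l\<in>{0<..N}. r l * t ^ l)"
        proof (intro sum.cong refl arg_cong2[where f = "(*)"])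
          fix l assume l: "l \<in> {0<..N}"
          have "rN l = (\<Sum>n\<in>{n\<in>{0<..N}. n dvd l}. c n)"
            unfolding rN_def using l by (subst sum.inter_filter) auto
          also have "{n\<in>{0<..N}. n dvd l} = {n. n dvd l}"
            using l by (auto dest: dvd_imp_le dvd_pos_nat)
          finally show "rN l = r l" by (simp add: r_def)
        qed
        finally show ?thesis .
      qed
      moreover have "(\<Sum>l\<in>{0<..L}. r l * t ^ l) \<le> (\<Sum>l\<in>{0<..N}. r l * t ^ l)"
        using N t r_nonneg by (intro sum_mono2) auto
      ultimately show ?thesis by linarith
    qed
    have D_le: "D N \<le> \<bar>\<Sum>n\<in>{0<..N}. c n / real n\<bar> / (1 - t) + M" for N
    proof -
      have "D N = (\<Sum>n\<in>{0<..N}. c n / real n) / (1 - t) - (\<Sum>n\<in>{0<..N}. c n * b n)"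
        unfolding D_def b_def sum_divide_distrib sum_subtractf[symmetric]
        by (intro sum.cong refl) (simp add: algebra_simps)
      also have "\<dots> \<le> \<bar>\<Sum>n\<in>{0<..N}. c n / real n\<bar> / (1 - t) + M"
      proof -
        have "x / (1 - t) \<le> \<bar>x\<bar> / (1 - t)" for x using t by (intro divide_right_mono) auto
        then show ?thesis using abel[of N] by (smt (verit))
      qed
      finally show ?thesis .
    qed
    have lim: "(\<lambda>N. \<bar>\<Sum>n\<in>{0<..N}. c n / real n\<bar> / (1 - t) + M + T N) \<longlonglongrightarrow> \<bar>0\<bar> / (1 - t) + M + 0"
      using t by (intro tendsto_intros lim0 T_lim) auto
    have ev: "\<forall>\<^sub>F N in sequentially. (\<Sum>l\<in>{0<..L}. r l * t ^ l) \<le> \<bar>\<Sum>n\<in>{0<..N}. c n / real n\<bar> / (1 - t) + M + T N"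
      using eventually_ge_at_top[of L] by eventually_elim (use ineq D_le in \<open>fastforce intro: order.trans\<close>)
    have "(\<Sum>l\<in>{0<..L}. r l * t ^ l) \<le> \<bar>0\<bar> / (1 - t) + M + 0"
      using tendsto_lowerbound[OF lim ev] by simp
    then show ?thesis by simp
  qed
  have r_sum: "(\<Sum>l\<in>{0<..L}. r l) \<le> M" for L
  proof -
    have "((\<lambda>t. \<Sum>l\<in>{0<..L}. r l * t ^ l) \<longlongrightarrow> (\<Sum>l\<in>{0<..L}. r l * 1 ^ l)) (at_left 1)"
      by (intro tendsto_intros)
    moreover have "\<forall>\<^sub>F t in at_left (1::real). (\<Sum>l\<in>{0<..L}. r l * t ^ l) \<le> M"
      using eventually_at_left_real[OF zero_less_one] by eventually_elim (use main in auto)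
    ultimately have "(\<Sum>l\<in>{0<..L}. r l * 1 ^ l) \<le> M"
      by (intro tendsto_upperbound) auto
    then show ?thesis by simp
  qed
  \<comment> \<open>\<open>K\<close> exceeds \<open>M\<close>, and \<open>K\<close> even powers of 2
    contribute at least 1 each, whichever of -1, 0, 1 is the value \<open>c 2\<close>.\<close>
  define K where "K = nat \<lceil>M\<rceil> + 1"
  let ?J = "(\<lambda>j. (2::nat) ^ (2 * j)) ` {..<K}"
  have "real K = (\<Sum>l\<in>?J. 1)"
    by (simp add: card_image inj_on_def)
  also have "\<dots> \<le> (\<Sum>l\<in>?J. r l)"
    using divisor_sum_prime_power[OF c(1,2) two_is_prime_nat] sum_powers_sign(2)[OF c(3)[of 2]]
    by (intro sum_mono) (auto simp: r_def)
  also have "\<dots> \<le> (\<Sum>l\<in>{0<..2 ^ (2 * K)}. r l)"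
    using r_nonneg by (intro sum_mono2) (auto intro!: power_increasing)
  also have "\<dots> \<le> M" by (rule r_sum)
  finally show False unfolding K_def by linarith
qed

section \<open>The prime number theorem in arithmetic progressions\<close>

lemma log_derivative_residue:
  assumes hol: "L holomorphic_on {s. Re s > 0}" and nz: "\<And>s. Re s > 1 \<Longrightarrow> L s \<noteq> 0" and s0: "Re s0 = 1"
  obtains k :: nat where "k = 0 \<longleftrightarrow> L s0 \<noteq> 0"
    "((\<lambda>x. of_real x * (deriv L (s0 + of_real x) / L (s0 + of_real x))) \<longlongrightarrow> of_nat k) (at_right 0)"
proof (cases "L s0 = 0")
  case False
  have op: "open {s::complex. Re s > 0}" by (rule open_halfspace_Re_gt)
  have c: "isCont L s0" "isCont (deriv L) s0"
    using holomorphic_on_imp_continuous_on[OF hol] holomorphic_on_imp_continuous_on[OF holomorphic_deriv[OF hol op]] op s0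
    by (simp_all add: continuous_on_eq_continuous_at)
  have sh: "((\<lambda>x. s0 + of_real x) \<longlongrightarrow> s0) (at_right 0)"
    by (auto intro!: tendsto_eq_intros)
  have "((\<lambda>x. of_real x * (deriv L (s0 + of_real x) / L (s0 + of_real x))) \<longlongrightarrow> of_real 0 * (deriv L s0 / L s0)) (at_right 0)"
    using False by (intro tendsto_intros isCont_tendsto_compose[OF c(1) sh] isCont_tendsto_compose[OF c(2) sh])
  then show thesis using that[of 0] False by simp
next
  case True
  \<comment> \<open>Since \<open>L\<close> is not identically zero, its zero at \<open>s0\<close>
    has a finite order \<open>k\<close>, which becomes the residue of the logarithmic
    derivative.\<close>
  have "\<not> L constant_on {s. Re s > 0}"
  proof
    assume "L constant_on {s. Re s > 0}"
    then have "L 2 = L s0" unfolding constant_on_def using s0 by auto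
    then show False using nz[of 2] True by simp
  qed
  moreover have "connected {s::complex. Re s > 0}" by (intro convex_connected convex_halfspace_Re_gt)
  ultimately obtain g r k where k: "0 < k" "0 < r" "ball s0 r \<subseteq> {s. Re s > 0}" "g holomorphic_on ball s0 r"
    "\<And>w. w \<in> ball s0 r \<Longrightarrow> L w = (w - s0) ^ k * g w" "\<And>w. w \<in> ball s0 r \<Longrightarrow> g w \<noteq> 0"
    using holomorphic_factor_zero_nonconstant[OF hol open_halfspace_Re_gt _ _ True] s0
    by (metis (no_types, lifting) mem_Collect_eq zero_less_one)
  have c: "isCont g s0" "isCont (deriv g) s0"
    using holomorphic_on_imp_continuous_on[OF k(4)] holomorphic_on_imp_continuous_on[OF holomorphic_deriv[OF k(4) open_ball]] k(2)
    by (simp_all add: continuous_on_eq_continuous_at)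
  have sh: "((\<lambda>x. s0 + of_real x) \<longlongrightarrow> s0) (at_right 0)"
    by (auto intro!: tendsto_eq_intros)
  have "((\<lambda>x. of_nat k + of_real x * (deriv g (s0 + of_real x) / g (s0 + of_real x))) \<longlongrightarrow> of_nat k
      + of_real 0 * (deriv g s0 / g s0)) (at_right 0)"
    using k(2,6) by (intro tendsto_intros isCont_tendsto_compose[OF c(1) sh] isCont_tendsto_compose[OF c(2) sh]) auto
  moreover have "\<forall>\<^sub>F x in at_right 0. of_nat k + of_real x * (deriv g (s0 + of_real x) / g (s0 + of_real x)) =
      of_real x * (deriv L (s0 + of_real x) / L (s0 + of_real x))"
    using eventually_at_right_less[of 0] eventually_at_right_real[OF k(2)]
  proof eventually_elim
    case (elim x)
    define w where "w = s0 + of_real x"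
    have w: "w \<in> ball s0 r" "w - s0 \<noteq> 0" "w - s0 = of_real x" using elim by (auto simp: w_def dist_norm)
    have "((\<lambda>w. (w - s0) ^ k * g w) has_field_derivative
        (of_nat k * (w - s0) ^ (k - 1) * g w + (w - s0) ^ k * deriv g w)) (at w)"
      using holomorphic_derivI[OF k(4) open_ball w(1)] by (auto intro!: derivative_eq_intros)
    then have "(L has_field_derivative (of_nat k * (w - s0) ^ (k - 1) * g w + (w - s0) ^ k * deriv g w)) (at w)"
      by (rule has_field_derivative_transform_within_open[OF _ open_ball w(1)]) (simp add: k(5))
    then have "deriv L w = of_nat k * (w - s0) ^ (k - 1) * g w + (w - s0) ^ k * deriv g w" by (rule DERIV_imp_deriv)
    moreover have "(w - s0) ^ k = (w - s0) * (w - s0) ^ (k - 1)" using k(1) by (metis power_minus_mult mult.commute)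
    ultimately have "(w - s0) * (deriv L w / L w) = of_nat k + (w - s0) * (deriv g w / g w)"
    proof -
      have "u * ((c * P * G + (u * P) * D) / ((u * P) * G)) = c + u * (D / G)"
        if "u \<noteq> 0" "P \<noteq> 0" "G \<noteq> 0" for u P G D c :: complex
        using that by (simp add: field_simps)
      from this[OF w(2) _ k(6)[OF w(1)]] show ?thesis using w(2) \<open>deriv L w = _\<close> \<open>(w - s0) ^ k = _\<close> k(5)[OF w(1)] by simp
    qed
    then show ?case using w(3) by (simp add: w_def)
  qed
  ultimately have "((\<lambda>x. of_real x * (deriv L (s0 + of_real x) / L (s0 + of_real x))) \<longlongrightarrow> of_nat k
      + of_real 0 * (deriv g s0 / g s0)) (at_right 0)"
    by (rule Lim_transform_eventually)
  then show thesis using that[of k] True k(1) by simp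
qed

text \<open>For the principal character \<open>L\<close> stands for \<open>(s - 1)\<close> times the
  L-function: it is holomorphic and nonzero at 1, and the pole survives only as the summand
  \<open>1 / (s - 1)\<close>. The bundle lets one argument run for a character, its square and the
  principal character at once.\<close>

definition dchar_data :: "nat \<Rightarrow> (nat \<Rightarrow> complex) \<Rightarrow> (complex \<Rightarrow> complex) \<Rightarrow> (complex \<Rightarrow> complex) \<Rightarrow> bool" where
  "dchar_data m \<xi> L E \<longleftrightarrow> L holomorphic_on {s. Re s > 0} \<and> E holomorphic_on {s. Re s > 1/2} \<and>
    (\<forall>s. Re s > 1 \<longrightarrow> L s \<noteq> 0) \<and> (\<xi> = chi0 m \<longrightarrow> L 1 \<noteq> 0) \<and>
    (\<forall>s. Re s > 1 \<longrightarrow> (\<lambda>n. prime_term \<xi> n s) sums ((if \<xi> = chi0 m then 1 / (s - 1) else 0) - deriv L s / L s - E s)) \<and>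
    (\<xi> \<noteq> chi0 m \<longrightarrow> (\<forall>s. Re s > 0 \<longrightarrow> (\<lambda>n. \<xi> n * of_nat n powr (-s)) sums L s))"

lemma dchar_dataD:
  assumes "dchar_data m \<xi> L E"
  shows "L holomorphic_on {s. Re s > 0}" "E holomorphic_on {s. Re s > 1/2}" "Re s > 1 \<Longrightarrow> L s \<noteq> 0" "\<xi> = chi0 m \<Longrightarrow> L 1 \<noteq> 0"
    "Re s > 1 \<Longrightarrow> (\<lambda>n. prime_term \<xi> n s) sums ((if \<xi> = chi0 m then 1 / (s - 1) else 0) - deriv L s / L s - E s)"
    "\<xi> \<noteq> chi0 m \<Longrightarrow> Re s > 0 \<Longrightarrow> (\<lambda>n. \<xi> n * of_nat n powr (-s)) sums L s"
  using assms unfolding dchar_data_def by blast+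

lemma dchar_data_exists:
  assumes m: "m > 1" and \<xi>: "\<xi> \<in> dchar m"
  shows "\<exists>L E. dchar_data m \<xi> L E"
proof -
  obtain L where L: "L holomorphic_on {s. Re s > 0}" "\<xi> = chi0 m \<Longrightarrow> L 1 \<noteq> 0"
    "\<And>s. Re s > 1 \<Longrightarrow> (\<lambda>n. \<xi> n * of_nat n powr (-s)) sums (if \<xi> = chi0 m then L s / (s - 1) else L s)"
    "\<And>s. \<xi> \<noteq> chi0 m \<Longrightarrow> Re s > 0 \<Longrightarrow> (\<lambda>n. \<xi> n * of_nat n powr (-s)) sums L s"
    using dchar_series_continuation[OF m \<xi>] by blast
  define L' where "L' s = (if \<xi> = chi0 m then L s / (s - 1) else L s)" for s
  have L': "(\<lambda>n. \<xi> n * of_nat n powr (-s)) sums L' s" if "Re s > 1" for s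
    unfolding L'_def using L(3)[OF that] .
  have "\<exists>E. E holomorphic_on {s. Re s > 1/2} \<and> (\<forall>s. Re s > 1 \<longrightarrow> L' s \<noteq> 0) \<and>
      (\<forall>s. Re s > 1 \<longrightarrow> (\<lambda>n. prime_term \<xi> n s) sums (- deriv L' s / L' s - E s))"
    by (rule dchar_log_derivative[OF m \<xi> L'], assumption, intro exI conjI allI impI) simp_all
  then obtain E where E: "E holomorphic_on {s. Re s > 1/2}" "\<And>s. Re s > 1 \<Longrightarrow> L' s \<noteq> 0"
    "\<And>s. Re s > 1 \<Longrightarrow> (\<lambda>n. prime_term \<xi> n s) sums (- deriv L' s / L' s - E s)"
    by blast
  have nz: "L s \<noteq> 0" if "Re s > 1" for s using E(2)[OF that] by (auto simp: L'_def split: if_splits)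
  have "- deriv L' s / L' s = (if \<xi> = chi0 m then 1 / (s - 1) else 0) - deriv L s / L s" if s: "Re s > 1" for s
  proof (cases "\<xi> = chi0 m")
    case True
    have s1: "s - 1 \<noteq> 0" using s by auto
    have "(L has_field_derivative deriv L s) (at s)"
      using s by (intro holomorphic_derivI[OF L(1) open_halfspace_Re_gt]) auto
    then have "((\<lambda>s. L s / (s - 1)) has_field_derivative (deriv L s * (s - 1) - L s) / ((s - 1) * (s - 1))) (at s)"
      using s1 by (auto intro!: derivative_eq_intros)
    then have "deriv (\<lambda>s. L s / (s - 1)) s = (deriv L s * (s - 1) - L s) / ((s - 1) * (s - 1))"
      by (rule DERIV_imp_deriv)
    moreover have "- ((D * y - X) / (y * y)) / (X / y) = 1 / y - D / X" if "X \<noteq> 0" "y \<noteq> 0" for D X y :: complex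
      using that by (simp add: field_simps)
    moreover have "L' = (\<lambda>s. L s / (s - 1))" using True by (auto simp: L'_def)
    ultimately show ?thesis using True s1 nz[OF s] by simp
  next
    case False
    then have "L' = L" by (auto simp: L'_def)
    then show ?thesis using False by simp
  qed
  then have "dchar_data m \<xi> L E"
    unfolding dchar_data_def using L(1,2,4) E nz by simp
  then show ?thesis by blast
qed

text \<open>The limit is the residue of the prime series at \<open>s0\<close>: 1 from a pole, minus
  the order \<open>k\<close> of a zero of \<open>L\<close>. The contribution \<open>E\<close> of the
  prime powers is regular on the line and drops out.\<close>

lemma prime_term_limit:
  assumes d: "dchar_data m \<xi> L E" and s0: "Re s0 = 1"
  obtains k :: nat where "k = 0 \<longleftrightarrow> L s0 \<noteq> 0"
    "((\<lambda>x. of_real x * (\<Sum>n. prime_term \<xi> n (s0 + of_real x))) \<longlongrightarrow> (if \<xi> = chi0 m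
        \<and> s0 = 1 then 1 else 0) - of_nat k) (at_right 0)"
proof -
  note d' = dchar_dataD[OF d]
  obtain k where k: "k = 0 \<longleftrightarrow> L s0 \<noteq> 0"
    "((\<lambda>x. of_real x * (deriv L (s0 + of_real x) / L (s0 + of_real x))) \<longlongrightarrow> of_nat k) (at_right 0)"
    using log_derivative_residue[OF d'(1,3) s0] by blast
  have sh: "((\<lambda>x. s0 + of_real x) \<longlongrightarrow> s0) (at_right 0)"
    by (auto intro!: tendsto_eq_intros)
  have "isCont E s0"
    using holomorphic_on_imp_continuous_on[OF d'(2)] open_halfspace_Re_gt[of "1/2"] s0
    by (simp add: continuous_on_eq_continuous_at)
  then have E: "((\<lambda>x. of_real x * E (s0 + of_real x)) \<longlongrightarrow> of_real 0 * E s0) (at_right 0)"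
    by (intro tendsto_intros isCont_tendsto_compose[OF _ sh])
  let ?e = "\<lambda>s. if \<xi> = chi0 m then 1 / (s - 1) else 0 :: complex"
  have e: "((\<lambda>x. of_real x * ?e (s0 + of_real x)) \<longlongrightarrow> (if \<xi> = chi0 m \<and> s0 = 1 then 1 else 0)) (at_right 0)"
  proof (cases "\<xi> = chi0 m \<and> s0 = 1")
    case True
    have "\<forall>\<^sub>F x in at_right 0. (1::complex) = of_real x * ?e (s0 + of_real x)"
      using eventually_at_right_less[of 0] by eventually_elim (use True in simp)
    from Lim_transform_eventually[OF tendsto_const this] show ?thesis using True by simp
  next
    case False
    show ?thesis
    proof (cases "\<xi> = chi0 m")
      case True
      then have "s0 - 1 \<noteq> 0" using False by auto
      then have "((\<lambda>x. of_real x * (1 / (s0 + of_real x - 1))) \<longlongrightarrow> of_real 0 * (1 / (s0 - 1))) (at_right 0)"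
        by (intro tendsto_intros sh)
      then show ?thesis using True False by simp
    qed simp
  qed
  have "\<forall>\<^sub>F x in at_right 0. of_real x * ?e (s0 + of_real x) - of_real x * (deriv L (s0 + of_real x) / L (s0
      + of_real x)) - of_real x * E (s0 + of_real x) =
      of_real x * (\<Sum>n. prime_term \<xi> n (s0 + of_real x))"
    using eventually_at_right_less[of 0]
  proof eventually_elim
    case (elim x)
    then have "Re (s0 + of_real x) > 1" using s0 by simp
    from sums_unique[OF d'(5)[OF this]] show ?case by (simp add: algebra_simps)
  qed
  from Lim_transform_eventually[OF tendsto_diff[OF tendsto_diff[OF e k(2)] E] this] show thesis
    using that[OF k(1)] by simp
qed

text \<open>Up to a nonnegative factor the three terms combine to \<open>3 + 4 * z + z * z\<close>,
  where \<open>z\<close> is \<open>\<xi> n\<close> times \<open>n powr (-\<i> * t)\<close>. For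
  \<open>norm z = 1\<close> the real part is \<open>2 * (1 + Re z)\<^sup>2\<close>; if
  \<open>n\<close> and \<open>m\<close> share a factor, everything is 0.\<close>

lemma prime_term_341:
  assumes m: "m > 0" and \<xi>: "\<xi> \<in> dchar m"
  shows "Re (3 * prime_term (chi0 m) n (1 + of_real x) + 4 * prime_term \<xi> n (Complex 1 t + of_real x) +
    prime_term (\<lambda>n. \<xi> n * \<xi> n) n (Complex 1 (2 * t) + of_real x)) \<ge> 0"
proof (cases "prime n")
  case True
  then have n: "n > 0" "n \<ge> 1" using prime_gt_0_nat[of n] by auto
  define z where "z = \<xi> n * of_nat n powr (- Complex 0 t)"
  define c where "c = ln (real n) * real n powr (-(1 + x))"
  have c: "c \<ge> 0" using n by (simp add: c_def)
  have base: "of_nat n powr (-(1 + of_real x)) = complex_of_real (real n powr (-(1 + x)))"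
    using powr_of_real[of "real n" "-(1 + x)"] by simp
  have p1: "of_nat n powr (-(Complex 1 t + of_real x)) = of_real (real n powr (-(1 + x))) * of_nat n powr (- Complex 0 t)"
  proof -
    have "-(Complex 1 t + of_real x) = -(1 + of_real x) + (- Complex 0 t)" by (simp add: complex_eq_iff)
    then show ?thesis by (simp only: powr_add base)
  qed
  have p2: "of_nat n powr (-(Complex 1 (2 * t) + of_real x)) =
      of_real (real n powr (-(1 + x))) * (of_nat n powr (- Complex 0 t) * of_nat n powr (- Complex 0 t))"
  proof -
    have "-(Complex 1 (2 * t) + of_real x) = -(1 + of_real x) + (- Complex 0 t + - Complex 0 t)"
        by (simp add: complex_eq_iff)
    then show ?thesis by (simp only: powr_add base)
  qed
  have "3 * prime_term (chi0 m) n (1 + of_real x) + 4 * prime_term \<xi> n (Complex 1 t + of_real x) +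
      prime_term (\<lambda>n. \<xi> n * \<xi> n) n (Complex 1 (2 * t) + of_real x) = of_real c * (3 * chi0 m n + 4 * z + z * z)"
    unfolding prime_term_def p1 p2 base using True by (simp add: c_def z_def algebra_simps)
  also have "Re \<dots> = c * Re (3 * chi0 m n + 4 * z + z * z)" by simp
  also have "Re (3 * chi0 m n + 4 * z + z * z) \<ge> 0"
  proof (cases "coprime n m")
    case True
    have "norm z = 1" using norm_dchar[OF \<xi> m, of n] True n by (simp add: z_def norm_mult norm_of_nat_powr)
    then have "(Re z)\<^sup>2 + (Im z)\<^sup>2 = 1" by (metis cmod_power2 power_one)
    then have "Re (3 * chi0 m n + 4 * z + z * z) = 2 * (1 + Re z)\<^sup>2"
      using True by (simp add: chi0_def power2_eq_square algebra_simps)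
    then show ?thesis by simp
  next
    case False
    then show ?thesis using dcharD(4)[OF \<xi>, of n] by (simp add: chi0_def z_def)
  qed
  then have "c * Re (3 * chi0 m n + 4 * z + z * z) \<ge> 0" using c by (rule mult_nonneg_nonneg[rotated])
  finally show ?thesis .
qed (simp add: prime_term_def)

text \<open>Let \<open>L\<close> vanish to order \<open>k1 \<ge> 1\<close> at
  \<open>1 + \<i> * t\<close>. Multiplying the nonnegative combination of prime series by
  \<open>x\<close> and letting \<open>x\<close> tend to 0 from the right compares residues:
  \<open>3 - 4 * k1 + d - k2 \<ge> 0\<close>, where \<open>d = 1\<close> if the square of
  \<open>\<xi>\<close> is principal and \<open>t = 0\<close>, and \<open>d = 0\<close>
  otherwise.\<close>

lemma dchar_nonzero_on_line:
  assumes m: "m > 1" and \<xi>: "\<xi> \<in> dchar m" and d: "dchar_data m \<xi> L E" and s0: "Re s0 = 1"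
  shows "L s0 \<noteq> 0"
proof
  assume L0: "L s0 = 0"
  define t where "t = Im s0"
  have s0t: "s0 = Complex 1 t" using s0 by (simp add: t_def complex_eq_iff)
  let ?\<xi>2 = "\<lambda>n. \<xi> n * \<xi> n"
  have \<xi>2: "?\<xi>2 \<in> dchar m" using dchar_mult[OF \<xi> \<xi>] .
  have m0: "m > 0" using m by simp
  obtain L0' E0 where d0: "dchar_data m (chi0 m) L0' E0" using dchar_data_exists[OF m chi0_in_dchar[OF m0]] by blast
  obtain L2 E2 where d2: "dchar_data m ?\<xi>2 L2 E2" using dchar_data_exists[OF m \<xi>2] by blast
  obtain k0 where k0: "k0 = 0 \<longleftrightarrow> L0' 1 \<noteq> 0" "((\<lambda>x. of_real x * (\<Sum>n. prime_term (chi0 m) n (1 + of_real x)))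
      \<longlongrightarrow> (if chi0 m = chi0 m \<and> (1::complex) = 1 then 1 else 0) - of_nat k0) (at_right 0)"
    using prime_term_limit[OF d0 one_complex.simps(1)] by blast
  obtain k1 where k1: "k1 = 0 \<longleftrightarrow> L s0 \<noteq> 0" "((\<lambda>x. of_real x * (\<Sum>n. prime_term \<xi> n (s0 + of_real x))) \<longlongrightarrow> (if \<xi> = chi0 m
      \<and> s0 = 1 then 1 else 0) - of_nat k1) (at_right 0)"
    using prime_term_limit[OF d s0] by blast
  obtain k2 where k2: "((\<lambda>x. of_real x * (\<Sum>n. prime_term ?\<xi>2 n (Complex 1 (2 * t) + of_real x))) \<longlongrightarrow> (if ?\<xi>2 = chi0 m
      \<and> Complex 1 (2 * t) = 1 then 1 else 0) - of_nat k2) (at_right 0)"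
    using prime_term_limit[OF d2, of "Complex 1 (2 * t)"] by auto
  have "k0 = 0" using k0(1) dchar_dataD(4)[OF d0] by simp
  have nprinc: "\<not> (\<xi> = chi0 m \<and> s0 = 1)" using dchar_dataD(4)[OF d] L0 by auto
  have "k1 \<ge> 1" using k1(1) L0 by simp
  let ?d2 = "if ?\<xi>2 = chi0 m \<and> Complex 1 (2 * t) = 1 then 1 else 0 :: complex"
  let ?f = "\<lambda>x. 3 * (of_real x * (\<Sum>n. prime_term (chi0 m) n (1 + of_real x))) + 4 * (of_real x * (\<Sum>n. prime_term \<xi> n (s0
      + of_real x))) +
      of_real x * (\<Sum>n. prime_term ?\<xi>2 n (Complex 1 (2 * t) + of_real x))"
  have "(?f \<longlongrightarrow> 3 * (1 - of_nat k0) + 4 * (0 - of_nat k1) + (?d2 - of_nat k2)) (at_right 0)"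
    using k0(2) k1(2) k2 nprinc by (intro tendsto_intros) simp_all
  then have lim: "((\<lambda>x. Re (?f x)) \<longlongrightarrow> Re (3 * (1 - of_nat k0) + 4 * (0 - of_nat k1) + (?d2 - of_nat k2))) (at_right 0)"
    by (rule tendsto_Re)
  have "\<forall>\<^sub>F x in at_right 0. Re (?f x) \<ge> 0"
    using eventually_at_right_less[of 0]
  proof eventually_elim
    case (elim x)
    let ?g = "\<lambda>n. 3 * prime_term (chi0 m) n (1 + of_real x) + 4 * prime_term \<xi> n (Complex 1 t + of_real x) +
      prime_term ?\<xi>2 n (Complex 1 (2 * t) + of_real x)"
    have sm: "(\<lambda>n. prime_term (chi0 m) n (1 + of_real x)) sums (\<Sum>n. prime_term (chi0 m) n (1 + of_real x))"
      "(\<lambda>n. prime_term \<xi> n (s0 + of_real x)) sums (\<Sum>n. prime_term \<xi> n (s0 + of_real x))"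
      "(\<lambda>n. prime_term ?\<xi>2 n (Complex 1 (2 * t) + of_real x)) sums (\<Sum>n. prime_term ?\<xi>2 n (Complex 1 (2 * t) + of_real x))"
      using dchar_dataD(5)[OF d0, of "1 + of_real x"] dchar_dataD(5)[OF d, of "s0 + of_real x"]
        dchar_dataD(5)[OF d2, of "Complex 1 (2 * t) + of_real x"] elim s0
      by (auto simp: sums_iff)
    define S where "S = 3 * (\<Sum>n. prime_term (chi0 m) n (1 + of_real x)) + 4 * (\<Sum>n. prime_term \<xi> n (s0 + of_real x)) +
        (\<Sum>n. prime_term ?\<xi>2 n (Complex 1 (2 * t) + of_real x))"
    have "?g sums S"
      unfolding S_def s0t[symmetric] by (intro sums_add sums_mult sm)
    then have "(\<lambda>n. Re (?g n)) sums Re S" by (rule sums_Re)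
    then have "Re S \<ge> 0" by (rule sums_le[OF prime_term_341[OF m0 \<xi>] sums_zero])
    then have "x * Re S \<ge> 0" using elim by simp
    moreover have "?f x = of_real x * S" unfolding S_def by (simp only: algebra_simps)
    ultimately show ?case by simp
  qed
  then have "Re (3 * (1 - of_nat k0) + 4 * (0 - of_nat k1) + (?d2 - of_nat k2)) \<ge> 0"
    by (intro tendsto_lowerbound[OF lim]) auto
  \<comment> \<open>With \<open>?d2 = 0\<close> the inequality would read
    \<open>3 - 4 * k1 - k2 \<ge> 0\<close>. So only a real character at the point 1 is left, and
    there the combination is compatible with a simple zero; a separate argument is required.\<close>
  then have "?d2 \<noteq> 0" using \<open>k0 = 0\<close> \<open>k1 \<ge> 1\<close> by (auto split: if_splits)
  then have real: "?\<xi>2 = chi0 m" "Complex 1 (2 * t) = 1" by (auto split: if_splits)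
  then have "t = 0" by (simp add: complex_eq_iff)
  then have s01: "s0 = 1" by (simp add: s0t complex_eq_iff)
  have np: "\<xi> \<noteq> chi0 m" using nprinc s01 by auto
  define c where "c n = Re (\<xi> n)" for n
  have val: "\<xi> n \<in> {-1, 0, 1}" for n
  proof -
    have "\<xi> n * \<xi> n = 0 \<or> \<xi> n * \<xi> n = 1" using fun_cong[OF real(1), of n] by (auto simp: chi0_def)
    then have "\<xi> n = 0 \<or> \<xi> n = 1 \<or> \<xi> n = -1" using square_eq_1_iff[of "\<xi> n"] by auto
    then show ?thesis by auto
  qed
  have "\<not> (\<lambda>N. \<Sum>n\<in>{0<..N}. c n / real n) \<longlonglongrightarrow> 0"
  proof (rule real_character_sum_nonzero)
    show "c 1 = 1" using dcharD(1)[OF \<xi>] by (simp add: c_def)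
    show "c (a * b) = c a * c b" for a b using val[of a] val[of b] by (auto simp: c_def dcharD(2)[OF \<xi>])
    show "c a \<in> {-1, 0, 1}" for a using val[of a] by (auto simp: c_def)
    have per: "\<xi> (m + a) = \<xi> a" for a by (rule dcharD(3)[OF \<xi>]) (simp add: cong_def)
    have x0: "\<xi> 0 = 0" using dcharD(4)[OF \<xi>, of 0] m by simp
    show "\<bar>\<Sum>k\<in>{0<..n}. c k\<bar> \<le> (\<Sum>a<m. norm (\<xi> a))" for n
    proof -
      have "(\<Sum>k\<in>{0<..n}. c k) = Re (\<Sum>k<Suc n. \<xi> k)"
        using sum_lessThan_Suc_eq[of \<xi> n, OF x0] by (simp add: c_def)
      also have "\<bar>\<dots>\<bar> \<le> norm (\<Sum>k<Suc n. \<xi> k)" by (rule abs_Re_le_cmod)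
      also have "\<dots> \<le> (\<Sum>a<m. norm (\<xi> a))" by (rule periodic_partial_sums_bounded[OF per sum_dchar_eq_0[OF \<xi> np m0] m0])
      finally show ?thesis .
    qed
  qed
  moreover have "(\<lambda>N. \<Sum>n\<in>{0<..N}. c n / real n) \<longlonglongrightarrow> 0"
  proof -
    have "(\<lambda>n. \<xi> n * of_nat n powr (-1)) sums 0"
      using dchar_dataD(6)[OF d np, of 1] L0 s01 by simp
    then have "(\<lambda>N. \<Sum>n<Suc N. \<xi> n * of_nat n powr (-1)) \<longlonglongrightarrow> 0" unfolding sums_def by (rule LIMSEQ_Suc)
    then have "(\<lambda>N. Re (\<Sum>n<Suc N. \<xi> n * of_nat n powr (-1))) \<longlonglongrightarrow> Re 0" by (rule tendsto_Re)
    moreover have "Re (\<Sum>n<Suc N. \<xi> n * of_nat n powr (-1)) = (\<Sum>n\<in>{0<..N}. c n / real n)" for N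
    proof -
      have "(\<Sum>n<Suc N. \<xi> n * of_nat n powr (-1)) = (\<Sum>n\<in>{0<..N}. \<xi> n * of_nat n powr (-1))"
        by (rule sum_lessThan_Suc_eq) simp
      also have "\<dots> = (\<Sum>n\<in>{0<..N}. of_real (c n / real n))"
      proof (intro sum.cong refl)
        fix n assume "n \<in> {0<..N}"
        have "\<xi> n = of_real (c n)" using val[of n] by (auto simp: c_def)
        then show "\<xi> n * of_nat n powr (-1) = of_real (c n / real n)"
          using \<open>n \<in> _\<close> by (simp add: powr_minus divide_inverse)
      qed
      finally show ?thesis by simp
    qed
    ultimately show ?thesis by simp
  qed
  ultimately show False by contradiction
qed


text \<open>Newman's theorem is applied to the bounded coefficients \<open>A n / n\<close>. Abel
  summation expresses \<open>F\<close> through \<open>n powr (-s) - (n + 1) powr (-s)\<close>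
  instead of \<open>s * n powr (-1 - s)\<close>; the discrepancy \<open>K\<close> is of second
  order, hence holomorphic for \<open>Re s > 0\<close>, and the series of
  \<open>A n * n powr (-1 - s)\<close> is \<open>(F + K) / s\<close>.\<close>

lemma newman_tauberian:
  fixes a :: "nat \<Rightarrow> real"
  defines "A \<equiv> \<lambda>n. \<Sum>k\<in>{0<..n}. a k"
  assumes bound: "\<And>n. \<bar>A n\<bar> \<le> C * real n"
    and U: "open U" "{s. Re s \<ge> 1} \<subseteq> U" and hol: "F holomorphic_on U"
    and F: "\<And>s. Re s > 1 \<Longrightarrow> (\<lambda>n. of_real (a n) * of_nat n powr (-s)) sums F s"
  shows "convergent (\<lambda>N. \<Sum>n\<in>{0<..N}. A n / (real n)\<^sup>2)"
proof -
  have A: "complex_of_real (A n) = (\<Sum>k\<in>{0<..n}. of_real (a k))" for n by (simp add: A_def)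
  have bc: "norm (complex_of_real (A n)) \<le> C * real n powr 1" for n using bound[of n] by (cases "n = 0") auto
  have "\<exists>H. (\<forall>s. Re s > 1 \<longrightarrow> (\<lambda>n. of_real (a n) * of_nat n powr (-s)) sums H s) \<and>
      (\<forall>s. Re s > 1 \<longrightarrow> (\<lambda>n. of_real (A n) * (of_nat n powr (-s) - of_nat (Suc n) powr (-s))) sums H s)"
    unfolding A
    by (rule dirichlet_series_by_parts[OF zero_le_one bc[unfolded A]], rule_tac x = H in exI) (simp del: of_nat_Suc)
  then obtain H where H: "\<And>s. Re s > 1 \<Longrightarrow> (\<lambda>n. of_real (a n) * of_nat n powr (-s)) sums H s"
    "\<And>s. Re s > 1 \<Longrightarrow> (\<lambda>n. of_real (A n) * (of_nat n powr (-s) - of_nat (Suc n) powr (-s))) sums H s"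
    by blast
  have HF: "H s = F s" if "Re s > 1" for s using sums_unique2[OF H(1)[OF that] F[OF that]] .
  define h where "h n s = complex_of_real (A n) * (s * of_nat n powr (-1 - s) - of_nat n powr (-s)
      + of_nat (Suc n) powr (-s))" for n s
  define K where "K s = (\<Sum>n. h n s)" for s
  have K1: "(\<lambda>n. h n s) sums K s" if "Re s > 0" for s
    unfolding K_def h_def using taylor_series_holomorphic(1)[OF bc] that by simp
  have K2: "K holomorphic_on {s. Re s > 0}"
    unfolding K_def h_def using taylor_series_holomorphic(2)[OF bc] by simp
  define b where "b n = complex_of_real (A n / real n)" for n
  define G where "G z = (F (1 + z) + K (1 + z)) / (1 + z)" for z
  let ?V = "(\<lambda>z. 1 + z) -` (U \<inter> {s. Re s > 0})"
  have "(\<lambda>N. \<Sum>n\<in>{0<..N}. b n / of_nat n) \<longlonglongrightarrow> G 0"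
  proof (rule newman_series)
    show "norm (b n) \<le> C" for n
    proof (cases "n = 0")
      case True
      then show ?thesis using bound[of 1] by (simp add: b_def)
    next
      case False
      then show ?thesis using bound[of n] by (simp add: b_def norm_divide field_simps)
    qed
    show "open ?V" using U(1) open_halfspace_Re_gt[of 0]
      by (intro open_vimage open_Int continuous_intros)
    show "{z. Re z \<ge> 0} \<subseteq> ?V" using subsetD[OF U(2)] by auto
    show "G holomorphic_on ?V"
      unfolding G_def
    proof (intro holomorphic_intros)
      show "(\<lambda>z. F (1 + z)) holomorphic_on ?V"
        by (rule holomorphic_on_compose_gen[OF _ hol, unfolded o_def]) (auto intro!: holomorphic_intros)
      show "(\<lambda>z. K (1 + z)) holomorphic_on ?V"
        by (rule holomorphic_on_compose_gen[OF _ K2, unfolded o_def]) (auto intro!: holomorphic_intros)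
      show "1 + z \<noteq> 0" if "z \<in> ?V" for z using that by (auto simp: complex_eq_iff)
    qed
    fix z :: complex assume z: "Re z > 0"
    define s where "s = 1 + z"
    have s: "Re s > 1" "Re s > 0" "s \<noteq> 0" using z by (auto simp: s_def complex_eq_iff)
    have "(\<lambda>n. of_real (A n) * (of_nat n powr (-s) - of_nat (Suc n) powr (-s)) + h n s) sums (F s + K s)"
      using H(2)[OF s(1)] K1[OF s(2)] unfolding HF[OF s(1)] by (rule sums_add)
    then have "(\<lambda>n. (of_real (A n) * (of_nat n powr (-s) - of_nat (Suc n) powr (-s)) + h n s) / s) sums ((F s + K s) / s)"
      by (rule sums_divide)
    moreover have "(of_real (A n) * (of_nat n powr (-s) - of_nat (Suc n) powr (-s))
        + h n s) / s = b n * of_nat n powr (-1 - z)" for n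
    proof (cases "n = 0")
      case False
      have "(of_real (A n) * (of_nat n powr (-s) - of_nat (Suc n) powr (-s))
          + h n s) / s = of_real (A n) * of_nat n powr (-1 - s)"
        unfolding h_def using s(3) by (simp add: field_simps del: of_nat_Suc)
      also have "of_nat n powr (-1 - s) = of_nat n powr (-1 - z) / complex_of_nat n"
      proof -
        have "-1 - s = (-1 - z) - 1" by (simp add: s_def)
        then show ?thesis using False by (simp only: powr_diff) simp
      qed
      finally show ?thesis by (simp add: b_def)
    qed (simp add: h_def A_def b_def)
    ultimately show "(\<lambda>n. b n * of_nat n powr (-1 - z)) sums G z" by (simp add: G_def s_def)
  qed
  then have "(\<lambda>N. Re (\<Sum>n\<in>{0<..N}. b n / of_nat n)) \<longlonglongrightarrow> Re (G 0)" by (rule tendsto_Re)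
  moreover have "Re (\<Sum>n\<in>{0<..N}. b n / of_nat n) = (\<Sum>n\<in>{0<..N}. A n / (real n)\<^sup>2)" for N
  proof -
    have "b n / of_nat n = complex_of_real (A n / (real n)\<^sup>2)" for n by (simp add: b_def power2_eq_square)
    then show ?thesis by simp
  qed
  ultimately show ?thesis by (auto simp: convergent_def)
qed

text \<open>If \<open>T n / n\<close> were bounded away from 1 at some large \<open>N\<close>, monotonicity would keep it so on a block of
  length proportional to \<open>N\<close>, which contradicts the Cauchy criterion.\<close>
lemma monotone_tauberian:
  fixes T :: "nat \<Rightarrow> real"
  assumes mono: "mono T" and conv: "convergent (\<lambda>N. \<Sum>n\<in>{0<..N}. (T n - real n) / (real n)\<^sup>2)"
  shows "(\<lambda>n. T n / real n) \<longlonglongrightarrow> 1"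
proof -
  have block: "\<exists>N0. \<forall>N\<ge>N0. \<forall>M\<ge>N. \<bar>\<Sum>n\<in>{N<..M}. (T n - real n) / (real n)\<^sup>2\<bar> < e" if e: "e > 0" for e
  proof -
    let ?S = "\<lambda>N. \<Sum>n\<in>{0<..N}. (T n - real n) / (real n)\<^sup>2"
    have "Cauchy ?S" using conv by (rule convergent_Cauchy)
    then obtain N0 where N0: "\<And>m n. m \<ge> N0 \<Longrightarrow> n \<ge> N0 \<Longrightarrow> norm (?S m - ?S n) < e"
      using CauchyD[OF _ e] by blast
    have "\<bar>\<Sum>n\<in>{N<..M}. (T n - real n) / (real n)\<^sup>2\<bar> < e" if "N \<ge> N0" "M \<ge> N" for M N
    proof -
      have "{0<..M} = {0<..N} \<union> {N<..M}" using that by auto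
      then have "?S M - ?S N = (\<Sum>n\<in>{N<..M}. (T n - real n) / (real n)\<^sup>2)" by (simp add: sum.union_disjoint)
      then show ?thesis using N0[of M N] that by simp
    qed
    then show ?thesis by blast
  qed
  have ev: "\<forall>\<^sub>F N in sequentially. \<bar>T N / real N - 1\<bar> < e" if e: "0 < e" "e \<le> 1" for e
  proof -
    \<comment> \<open>A block has length at least \<open>e * N / 4\<close>, and its terms have size
      at least \<open>e / (8 * N)\<close> above \<open>N\<close> and \<open>e / (2 * N)\<close>
      below, so its sum has size at least \<open>e\<^sup>2 / 32\<close>.\<close>
    define \<delta> where "\<delta> = e\<^sup>2 / 64"
    have \<delta>: "\<delta> > 0" using e by (simp add: \<delta>_def)
    obtain N0 where N0: "\<And>N M. N \<ge> N0 \<Longrightarrow> M \<ge> N \<Longrightarrow> \<bar>\<Sum>n\<in>{N<..M}. (T n - real n) / (real n)\<^sup>2\<bar> < \<delta>"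
      using block[OF \<delta>] by blast
    \<comment> \<open>The first bound keeps the block that ends at \<open>N\<close> beyond
      \<open>N0\<close>, since it starts no lower than \<open>N / 2\<close>; the second makes
      \<open>e * N > 4\<close>, so that rounding the block endpoint costs at most half of its
      length.\<close>
    define N1 where "N1 = max (2 * N0 + 2) (nat \<lceil>4 / e\<rceil> + 1)"
    have "\<bar>T N / real N - 1\<bar> < e" if N: "N \<ge> N1" for N
    proof -
      have N': "N \<ge> 2 * N0 + 2" "N > 0" "N \<ge> nat \<lceil>4 / e\<rceil> + 1" using N by (auto simp: N1_def)
      then have N'': "real N > 4 / e" using real_nat_ceiling_ge[of "4 / e"] by linarith
      have Ne: "real N * e > 4" using N'' e by (simp add: field_simps)
      have "T N < (1 + e) * real N"
      proof (rule ccontr)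
        assume "\<not> T N < (1 + e) * real N"
        then have TN: "T N \<ge> (1 + e) * real N" by simp
        define M where "M = nat \<lfloor>(1 + e / 2) * real N\<rfloor>"
        have M: "real M \<le> (1 + e / 2) * real N" "real M > (1 + e / 2) * real N - 1"
          using e unfolding M_def by (simp_all add: of_nat_nat)
        have "real M > real N" using M(2) Ne by (simp add: algebra_simps)
        then have NM: "M \<ge> N" by simp
        have "real M \<le> 2 * real N" using M(1) e mult_right_mono[of "1 + e / 2" 2 "real N"] by linarith
        have "(\<Sum>n\<in>{N<..M}. e / (8 * real N)) \<le> (\<Sum>n\<in>{N<..M}. (T n - real n) / (real n)\<^sup>2)"
        proof (rule sum_mono)
          fix n assume n: "n \<in> {N<..M}"
          have "T n \<ge> T N" using mono n by (auto intro: monoD)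
          moreover have "real n \<le> (1 + e / 2) * real N" using n M(1) by (auto intro: order.trans[OF of_nat_mono])
          ultimately have d: "T n - real n \<ge> e / 2 * real N" using TN by (simp add: algebra_simps)
          have "real n \<le> 2 * real N" using n \<open>real M \<le> 2 * real N\<close> by (auto intro: order.trans[OF of_nat_mono])
          then have "(real n)\<^sup>2 \<le> (2 * real N)\<^sup>2" by (intro power_mono) auto
          then have "(e / 2 * real N) / (2 * real N)\<^sup>2 \<le> (T n - real n) / (real n)\<^sup>2"
            using d e n N'(2) by (intro frac_le order.trans[OF mult_nonneg_nonneg d]) auto
          moreover have "(e / 2 * real N) / (2 * real N)\<^sup>2 = e / (8 * real N)"
            using N'(2) by (simp add: power2_eq_square field_simps)
          ultimately show "e / (8 * real N) \<le> (T n - real n) / (real n)\<^sup>2" by simp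
        qed
        also have "\<dots> < \<delta>" using N0[of N M] NM N'(1) by auto
        finally have "(real M - real N) * (e / (8 * real N)) < \<delta>" using NM by (simp add: of_nat_diff)
        moreover have "real M - real N \<ge> e * real N / 4" using M(2) Ne by (simp add: algebra_simps)
        ultimately have "(e * real N / 4) * (e / (8 * real N)) < \<delta>"
          using e by (meson le_less_trans mult_right_mono divide_nonneg_nonneg less_imp_le mult_nonneg_nonneg of_nat_0_le_iff zero_le_numeral)
        then show False using N'(2) e by (simp add: \<delta>_def power2_eq_square field_simps)
      qed
      moreover have "T N > (1 - e) * real N"
      proof (rule ccontr)
        assume "\<not> T N > (1 - e) * real N"
        then have TN: "T N \<le> (1 - e) * real N" by simp
        define M where "M = nat \<lceil>(1 - e / 2) * real N\<rceil>"
        have "(1 - e / 2) * real N \<ge> 0" using e by (intro mult_nonneg_nonneg) auto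
        then have M: "real M \<ge> (1 - e / 2) * real N" "real M < (1 - e / 2) * real N + 1"
          unfolding M_def by (simp_all add: of_nat_nat) linarith
        have "real M < real N" using M(2) Ne by (simp add: algebra_simps)
        then have NM: "M \<le> N" by simp
        have "real M \<ge> real N / 2" using M(1) e mult_right_mono[of "1 / 2" "1 - e / 2" "real N"] by linarith
        then have "M \<ge> N0" using N'(1) by linarith
        have "(\<Sum>n\<in>{M<..N}. (T n - real n) / (real n)\<^sup>2) \<le> (\<Sum>n\<in>{M<..N}. - (e / (2 * real N)))"
        proof (rule sum_mono)
          fix n assume n: "n \<in> {M<..N}"
          have "T n \<le> T N" using mono n by (auto intro: monoD)
          moreover have "real n \<ge> (1 - e / 2) * real N" using n M(1) by (auto intro: order.trans[OF _ of_nat_mono])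
          ultimately have d: "real n - T n \<ge> e / 2 * real N" using TN by (simp add: algebra_simps)
          have "(real n)\<^sup>2 \<le> (real N)\<^sup>2" using n by (intro power_mono) auto
          then have "(e / 2 * real N) / (real N)\<^sup>2 \<le> (real n - T n) / (real n)\<^sup>2"
            using d e n N'(2) by (intro frac_le order.trans[OF mult_nonneg_nonneg d]) auto
          moreover have "(e / 2 * real N) / (real N)\<^sup>2 = e / (2 * real N)"
            using N'(2) by (simp add: power2_eq_square field_simps)
          moreover have "(real n - T n) / (real n)\<^sup>2 = - ((T n - real n) / (real n)\<^sup>2)"
            by (simp add: minus_divide_left)
          ultimately show "(T n - real n) / (real n)\<^sup>2 \<le> - (e / (2 * real N))" by linarith
        qed
        also have "\<dots> = - ((real N - real M) * (e / (2 * real N)))" using NM by (simp add: of_nat_diff)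
        finally have "(real N - real M) * (e / (2 * real N)) < \<delta>" using N0[of M N] NM \<open>M \<ge> N0\<close> by linarith
        moreover have "real N - real M \<ge> e * real N / 4" using M(2) Ne by (simp add: algebra_simps)
        ultimately have "(e * real N / 4) * (e / (2 * real N)) < \<delta>"
          using e by (meson le_less_trans mult_right_mono divide_nonneg_nonneg less_imp_le mult_nonneg_nonneg of_nat_0_le_iff zero_le_numeral)
        then show False using N'(2) e by (simp add: \<delta>_def power2_eq_square field_simps)
      qed
      ultimately show ?thesis using N'(2) by (simp add: abs_less_iff field_simps)
    qed
    then show ?thesis by (auto simp: eventually_sequentially)
  qed
  show ?thesis
  proof (rule tendstoI)
    fix e :: real assume "e > 0"
    have "\<forall>\<^sub>F N in sequentially. \<bar>T N / real N - 1\<bar> < min e 1" using \<open>e > 0\<close> by (intro ev) auto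
    then show "\<forall>\<^sub>F N in sequentially. dist (T N / real N) 1 < e" by eventually_elim (auto simp: dist_real_def)
  qed
qed

definition theta_ap :: "nat \<Rightarrow> nat \<Rightarrow> nat \<Rightarrow> real" where
  "theta_ap m r n = (\<Sum>p | prime p \<and> p \<le> n \<and> [p = r] (mod m). ln (real p))"

lemma theta_ap_nonneg: "theta_ap m r n \<ge> 0"
  unfolding theta_ap_def by (intro sum_nonneg) (auto dest: prime_gt_0_nat)

lemma theta_ap_le: "theta_ap m r n \<le> 2 * real n"
proof -
  have "theta_ap m r n \<le> (\<Sum>p | prime p \<and> p \<le> n. ln (real p))"
    unfolding theta_ap_def by (intro sum_mono2) (auto dest: prime_gt_0_nat)
  then show ?thesis using theta_le[of n] by linarith
qed

lemma mono_theta_ap: "mono (theta_ap m r)"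
  unfolding theta_ap_def by (intro monoI sum_mono2) (auto dest: prime_gt_0_nat)

lemma sum_prime_indicator:
  "(\<Sum>k\<in>{0<..n}. if prime k \<and> P k then f k else 0) = (\<Sum>p | prime p \<and> p \<le> n \<and> P p. f p)"
  for f :: "nat \<Rightarrow> 'a :: comm_monoid_add"
  by (subst sum.inter_filter[symmetric]) (auto intro!: sum.cong dest: prime_gt_0_nat)

text \<open>The Tauberian theorem is applied to \<open>\<phi>(m)\<close> times the weight
  \<open>ln p\<close> on the primes of the class, minus 1. Orthogonality writes the first part as a
  combination of prime series of characters, and the subtracted zeta cancels the only pole, which
  comes from the principal character.\<close>

theorem theta_ap_asymp:
  assumes m: "m > 1" and r: "coprime r m"
  shows "(\<lambda>n. theta_ap m r n / real n) \<longlonglongrightarrow> 1 / real (totient m)"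
proof -
  define \<phi> where "\<phi> = totient m"
  have \<phi>: "\<phi> > 0" using m by (simp add: \<phi>_def)
  have m0: "m > 0" using m by simp
  have fin: "finite (dchar m)" using finite_dchar[OF m0] .
  \<comment> \<open>\<open>r'\<close> is an inverse of \<open>r\<close>, so \<open>\<xi> r'\<close>
    plays the part of the complex conjugate of \<open>\<xi> r\<close> in the orthogonality
    relation.\<close>
  define r' where "r' = r ^ (totient m - 1)"
  have rr': "[r * r' = 1] (mod m)" unfolding r'_def using cong_power_totient_minus_1[OF r m0] .
  have r': "coprime r' m" using r by (simp add: r'_def)
  obtain L E where d: "\<And>\<xi>. \<xi> \<in> dchar m \<Longrightarrow> dchar_data m \<xi> (L \<xi>) (E \<xi>)"
    using dchar_data_exists[OF m] by metis
  obtain Z where Z: "Z holomorphic_on {s. Re s > 0}" "Z 1 = 1"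
    "\<And>s. Re s > 1 \<Longrightarrow> (\<lambda>n. of_nat n powr (-s)) sums (Z s / (s - 1))"
    using zeta_continuation by blast
  \<comment> \<open>As \<open>Z 1 = 1\<close>, the difference of zeta and \<open>1 / (s - 1)\<close>
    is this quotient, whose singularity at 1 is removable with the derivative as its value.\<close>
  define Zq where "Zq s = (if s = 1 then deriv Z 1 else (Z s - Z 1) / (s - 1))" for s
  have Zq: "Zq holomorphic_on {s. Re s > 0}"
    unfolding Zq_def by (intro pole_lemma_open Z open_halfspace_Re_gt)
  define F where "F s = (\<Sum>\<xi>\<in>dchar m. \<xi> r' * (- deriv (L \<xi>) s / L \<xi> s - E \<xi> s)) - Zq s" for s
  \<comment> \<open>Avoiding the zeros of the product of all \<open>L \<xi>\<close> keeps every
    logarithmic derivative holomorphic. Continuity makes \<open>U\<close> open, and non-vanishing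
    puts the closed half-plane \<open>Re s \<ge> 1\<close> into it.\<close>
  define U where "U = {s. Re s > 1/2} \<inter> {s. Re s > 1/2 \<and> (\<Prod>\<xi>\<in>dchar m. L \<xi> s) \<noteq> 0}"
  define a where "a n = (if prime n \<and> [n = r] (mod m) then real \<phi> * ln (real n) else 0) - (if n = 0 then 0 else 1)" for n
  have A: "(\<Sum>k\<in>{0<..n}. a k) = real \<phi> * theta_ap m r n - real n" for n
  proof -
    have "(\<Sum>k\<in>{0<..n}. a k) = (\<Sum>k\<in>{0<..n}. if prime k \<and> [k = r] (mod m) then real \<phi> * ln (real k) else 0) - (\<Sum>k\<in>{0<..n}. 1)"
      unfolding a_def sum_subtractf by (intro arg_cong2[where f = "(-)"] sum.cong) auto
    then show ?thesis by (simp add: sum_prime_indicator theta_ap_def sum_distrib_left)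
  qed
  have subH: "{s::complex. Re s > 1/2} \<subseteq> {s. Re s > 0}" by auto
  have "convergent (\<lambda>N. \<Sum>n\<in>{0<..N}. (\<Sum>k\<in>{0<..n}. a k) / (real n)\<^sup>2)"
  proof (rule newman_tauberian)
    show "\<bar>\<Sum>k\<in>{0<..n}. a k\<bar> \<le> (2 * real \<phi> + 1) * real n" for n
    proof -
      have "real \<phi> * theta_ap m r n \<le> real \<phi> * (2 * real n)" by (intro mult_left_mono theta_ap_le) auto
      moreover have "real \<phi> * theta_ap m r n \<ge> 0" by (intro mult_nonneg_nonneg theta_ap_nonneg) auto
      ultimately show ?thesis unfolding A by (simp add: algebra_simps abs_le_iff)
    qed
    have "continuous_on {s. Re s > 1/2} (\<lambda>s. \<Prod>\<xi>\<in>dchar m. L \<xi> s)"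
      using dchar_dataD(1)[OF d] subH
      by (intro continuous_on_prod holomorphic_on_imp_continuous_on) (auto intro: holomorphic_on_subset)
    then have "open ({s. Re s > 1/2} \<inter> (\<lambda>s. \<Prod>\<xi>\<in>dchar m. L \<xi> s) -` (- {0}))"
      by (intro continuous_open_preimage open_halfspace_Re_gt) auto
    also have "{s. Re s > 1/2} \<inter> (\<lambda>s. \<Prod>\<xi>\<in>dchar m. L \<xi> s) -` (- {0}) = U" by (auto simp: U_def)
    finally show "open U" .
    have Lnz: "L \<xi> s \<noteq> 0" if "\<xi> \<in> dchar m" "Re s \<ge> 1" for \<xi> s
      using dchar_nonzero_on_line[OF m that(1) d[OF that(1)], of s] dchar_dataD(3)[OF d[OF that(1)], of s] that(2)
      by (cases "Re s = 1") auto
    show "{s. Re s \<ge> 1} \<subseteq> U" using Lnz fin by (auto simp: U_def)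
    show "F holomorphic_on U"
      unfolding F_def
    proof (intro holomorphic_on_diff holomorphic_on_sum holomorphic_on_mult holomorphic_on_divide holomorphic_on_minus
        holomorphic_on_const)
      show "Zq holomorphic_on U" using Zq by (rule holomorphic_on_subset) (auto simp: U_def)
      fix \<xi> assume \<xi>: "\<xi> \<in> dchar m"
      note d' = dchar_dataD[OF d[OF \<xi>]]
      show "L \<xi> holomorphic_on U" using d'(1) by (rule holomorphic_on_subset) (auto simp: U_def)
      show "deriv (L \<xi>) holomorphic_on U"
        using holomorphic_deriv[OF d'(1) open_halfspace_Re_gt] by (rule holomorphic_on_subset) (auto simp: U_def)
      show "E \<xi> holomorphic_on U" using d'(2) by (rule holomorphic_on_subset) (auto simp: U_def)
      show "L \<xi> s \<noteq> 0" if "s \<in> U" for s using that \<xi> fin by (auto simp: U_def)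
    qed
    fix s :: complex assume s: "Re s > 1"
    have s1: "s - 1 \<noteq> 0" using s by auto
    have "(\<lambda>n. (\<Sum>\<xi>\<in>dchar m. \<xi> r' * prime_term \<xi> n s) - of_nat n powr (-s)) sums
        ((\<Sum>\<xi>\<in>dchar m. \<xi> r' * ((if \<xi> = chi0 m then 1 / (s - 1) else 0) - deriv (L \<xi>) s / L \<xi> s - E \<xi> s)) - Z s / (s - 1))"
      using s by (intro sums_diff sums_sum sums_mult Z dchar_dataD(5)[OF d]) auto
    moreover have "(\<Sum>\<xi>\<in>dchar m. \<xi> r' * ((if \<xi> = chi0 m then 1 / (s - 1) else 0) - deriv (L \<xi>) s / L \<xi> s - E \<xi> s)) - Z s / (s - 1) = F s"
    proof -
      have "(\<Sum>\<xi>\<in>dchar m. \<xi> r' * ((if \<xi> = chi0 m then 1 / (s - 1) else 0) - deriv (L \<xi>) s / L \<xi> s - E \<xi> s)) =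
          (\<Sum>\<xi>\<in>dchar m. (if \<xi> = chi0 m then \<xi> r' * (1 / (s - 1)) else 0) + \<xi> r' * (- deriv (L \<xi>) s / L \<xi> s - E \<xi> s))"
        by (intro sum.cong refl) (simp add: algebra_simps)
      also have "\<dots> = 1 / (s - 1) + (\<Sum>\<xi>\<in>dchar m. \<xi> r' * (- deriv (L \<xi>) s / L \<xi> s - E \<xi> s))"
        using fin chi0_in_dchar[OF m0] r' by (simp add: sum.distrib chi0_def[of m r'])
      finally show ?thesis using s1 Z(2) by (auto simp: F_def Zq_def diff_divide_distrib)
    qed
    moreover have "(\<Sum>\<xi>\<in>dchar m. \<xi> r' * prime_term \<xi> n s) - of_nat n powr (-s) = of_real (a n) * of_nat n powr (-s)" for n
    proof -
      have "(\<Sum>\<xi>\<in>dchar m. \<xi> r' * prime_term \<xi> n s) = (if prime n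
          \<and> [n = r] (mod m) then of_real (real \<phi> * ln (real n)) else 0) * of_nat n powr (-s)"
      proof (cases "prime n")
        case True
        have "(\<Sum>\<xi>\<in>dchar m. \<xi> r' * prime_term \<xi> n s) = (\<Sum>\<xi>\<in>dchar m. \<xi> (r' * n)) * (of_real (ln (real n)) * of_nat n powr (-s))"
          unfolding sum_distrib_right using True
          by (intro sum.cong refl) (simp add: prime_term_def dcharD(2) mult_ac)
        also have "(\<Sum>\<xi>\<in>dchar m. \<xi> (r' * n)) = (if [n = r] (mod m) then of_nat \<phi> else 0)"
        proof (cases "coprime n m")
          case True
          have "[r' * n = 1] (mod m) \<longleftrightarrow> [n = r] (mod m)"
          proof
            assume "[r' * n = 1] (mod m)"
            then have "[r * (r' * n) = r * 1] (mod m)" by (rule cong_scalar_left)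
            moreover have "[(r * r') * n = 1 * n] (mod m)" using rr' by (rule cong_scalar_right)
            ultimately show "[n = r] (mod m)" by (metis cong_sym cong_trans mult.assoc mult_1 mult.right_neutral)
          next
            assume "[n = r] (mod m)"
            then have "[r' * n = r' * r] (mod m)" by (rule cong_scalar_left)
            then show "[r' * n = 1] (mod m)" using rr' by (metis cong_trans mult.commute)
          qed
          then show ?thesis using sum_over_dchar[OF m0, of "r' * n"] True r' card_dchar[OF m] by (simp add: \<phi>_def)
        next
          case False
          then have "\<xi> (r' * n) = 0" if "\<xi> \<in> dchar m" for \<xi> using dcharD(4)[OF that] by simp
          moreover have "\<not> [n = r] (mod m)" using False r cong_imp_coprime cong_sym by blast
          ultimately show ?thesis by (simp add: sum.neutral)
        qed
        finally show ?thesis using True by simp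
      qed (simp add: prime_term_def)
      then show ?thesis by (auto simp: a_def algebra_simps)
    qed
    ultimately show "(\<lambda>n. of_real (a n) * of_nat n powr (-s)) sums F s" by simp
  qed
  then have "(\<lambda>n. (real \<phi> * theta_ap m r n) / real n) \<longlonglongrightarrow> 1"
    unfolding A by (intro monotone_tauberian) (auto intro!: monoI mult_left_mono monoD[OF mono_theta_ap])
  from tendsto_divide[OF this tendsto_const[of "real \<phi>"]] \<phi> show ?thesis by (simp add: \<phi>_def)
qed

section \<open>Reciprocals of primes\<close>

lemma weighted_cesaro:
  fixes d v :: "nat \<Rightarrow> real"
  assumes d: "d \<longlonglongrightarrow> 0" and v: "\<And>n. v n \<ge> 0" and W: "filterlim (\<lambda>N. \<Sum>n\<in>{0<..N}. v n) at_top sequentially"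
  shows "(\<lambda>N. (\<Sum>n\<in>{0<..N}. d n * v n) / (\<Sum>n\<in>{0<..N}. v n)) \<longlonglongrightarrow> 0"
proof (rule tendstoI)
  fix e :: real assume e: "e > 0"
  let ?W = "\<lambda>N. \<Sum>n\<in>{0<..N}. v n"
  obtain N0 where N0: "\<And>n. n \<ge> N0 \<Longrightarrow> \<bar>d n\<bar> < e / 2"
    using LIMSEQ_D[OF d, of "e / 2"] e by auto
  define c where "c = (\<Sum>n\<in>{0<..N0}. \<bar>d n\<bar> * v n)"
  have "\<forall>\<^sub>F N in sequentially. ?W N > 2 * c / e + 1" using W by (simp add: filterlim_at_top_dense)
  then show "\<forall>\<^sub>F N in sequentially. dist ((\<Sum>n\<in>{0<..N}. d n * v n) / ?W N) 0 < e"
    using eventually_ge_at_top[of N0]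
  proof eventually_elim
    case (elim N)
    have c: "c \<ge> 0" unfolding c_def using v by (intro sum_nonneg mult_nonneg_nonneg) auto
    have Wpos: "?W N > 0" using elim(1) c e by (smt (verit) divide_nonneg_pos)
    have "{0<..N} = {0<..N0} \<union> {N0<..N}" using elim(2) by auto
    then have "(\<Sum>n\<in>{0<..N}. \<bar>d n\<bar> * v n) = c + (\<Sum>n\<in>{N0<..N}. \<bar>d n\<bar> * v n)"
      unfolding c_def by (simp add: sum.union_disjoint)
    also have "(\<Sum>n\<in>{N0<..N}. \<bar>d n\<bar> * v n) \<le> (\<Sum>n\<in>{N0<..N}. e / 2 * v n)"
      using N0 v by (intro sum_mono mult_right_mono) (auto intro: less_imp_le)
    also have "\<dots> \<le> (\<Sum>n\<in>{0<..N}. e / 2 * v n)"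
      using v e by (intro sum_mono2) auto
    also have "\<dots> = e / 2 * ?W N" by (simp add: sum_distrib_left)
    finally have "(\<Sum>n\<in>{0<..N}. \<bar>d n\<bar> * v n) \<le> c + e / 2 * ?W N" by simp
    moreover have "\<bar>\<Sum>n\<in>{0<..N}. d n * v n\<bar> \<le> (\<Sum>n\<in>{0<..N}. \<bar>d n\<bar> * v n)"
      using sum_abs[of "\<lambda>n. d n * v n" "{0<..N}"] v by (simp add: abs_mult)
    moreover have "c < e / 2 * ?W N" using elim(1) e by (simp add: field_simps)
    ultimately have "\<bar>\<Sum>n\<in>{0<..N}. d n * v n\<bar> < e * ?W N" by linarith
    then show ?case using Wpos by (simp add: dist_real_def abs_divide field_simps)
  qed
qed

lemma ln_ln_step:
  assumes "n \<ge> 2"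
  shows "1 / (real (Suc n) * ln (real (Suc n))) \<le> ln (ln (real (Suc n))) - ln (ln (real n))"
    "ln (ln (real (Suc n))) - ln (ln (real n)) \<le> 1 / (real n * ln (real n))"
proof -
  have "\<exists>z>real n. z < real (Suc n) \<and> ln (ln (real (Suc n))) - ln (ln (real n)) = (real (Suc n) - real n) * (1 / (z * ln z))"
    using assms by (intro MVT2) (auto intro!: derivative_eq_intros simp: field_simps)
  then obtain z where z: "z > real n" "z < real (Suc n)" "ln (ln (real (Suc n))) - ln (ln (real n)) = 1 / (z * ln z)" by auto
  have ln: "0 < ln (real n)" "ln (real n) \<le> ln z" "ln z \<le> ln (real (Suc n))" "z > 0" using z assms by auto
  then have "real n * ln (real n) \<le> z * ln z" "z * ln z \<le> real (Suc n) * ln (real (Suc n))"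
    using z assms by (intro mult_mono; simp)+
  moreover have "real n * ln (real n) > 0" "z * ln z > 0" using ln assms by (auto intro: mult_pos_pos)
  ultimately show "1 / (real (Suc n) * ln (real (Suc n))) \<le> ln (ln (real (Suc n))) - ln (ln (real n))"
    "ln (ln (real (Suc n))) - ln (ln (real n)) \<le> 1 / (real n * ln (real n))"
    unfolding z(3) by (intro divide_left_mono; use ln in \<open>simp del: of_nat_Suc\<close>)+
qed

lemma sum_inverse_n_ln_n_asymp:
  "(\<lambda>N. (\<Sum>n\<in>{1<..N}. 1 / (real n * ln (real n))) / ln (ln (real N))) \<longlonglongrightarrow> 1"
proof -
  let ?W = "\<lambda>N. \<Sum>n\<in>{1<..N}. 1 / (real n * ln (real n))"
  have W_Suc: "?W (Suc N) = 1 / (real (Suc N) * ln (real (Suc N))) + ?W N" if "N \<ge> 1" for N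
  proof -
    have "{1<..Suc N} = insert (Suc N) {1<..N}" using that by auto
    then show ?thesis by simp
  qed
  have W2: "?W 2 = 1 / (2 * ln 2)"
  proof -
    have "{1<..2::nat} = {2}" by auto
    then show ?thesis by simp
  qed
  have bounds: "ln (ln (real (Suc N))) - ln (ln 2) \<le> ?W N \<and> ?W N \<le> 1 / (2 * ln 2) + ln (ln (real N)) - ln (ln 2)" if "N \<ge> 2"
      for N
    using that
  proof (induction N rule: dec_induct)
    case base
    then show ?case using ln_ln_step(2)[of 2] W2 by simp
  next
    case (step n)
    then show ?case using W_Suc[of n] ln_ln_step(1)[of n] ln_ln_step(2)[of "Suc n"] by (simp del: of_nat_Suc)
  qed
  have llpos: "\<forall>\<^sub>F N in sequentially. ln (ln (real N)) > 0" by real_asymp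
  show ?thesis
  proof (rule tendsto_sandwich)
    show "\<forall>\<^sub>F N in sequentially. (ln (ln (real (Suc N))) - ln (ln 2)) / ln (ln (real N)) \<le> ?W N / ln (ln (real N))"
      using llpos eventually_ge_at_top[of 2]
      by eventually_elim (use bounds in \<open>auto intro!: divide_right_mono\<close>)
    show "\<forall>\<^sub>F N in sequentially. ?W N / ln (ln (real N)) \<le> (1 / (2 * ln 2)
        + ln (ln (real N)) - ln (ln 2)) / ln (ln (real N))"
      using llpos eventually_ge_at_top[of 2]
      by eventually_elim (use bounds in \<open>auto intro!: divide_right_mono\<close>)
    show "(\<lambda>N. (ln (ln (real (Suc N))) - ln (ln 2)) / ln (ln (real N))) \<longlonglongrightarrow> 1" by real_asymp
    show "(\<lambda>N. (1 / (2 * ln 2) + ln (ln (real N)) - ln (ln 2)) / ln (ln (real N))) \<longlonglongrightarrow> 1" by real_asymp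
  qed
qed

text \<open>Partial summation with \<open>1 / p = ln p * u p\<close>. The constant weights
  \<open>g\<close> are summed by parts against the same \<open>u\<close>, so the two sums differ
  only by the weighted mean of \<open>d\<close>, which tends to 0 relative to
  \<open>ln (ln N)\<close>, and by boundary terms. Hence \<theta> is needed without a rate.\<close>

lemma mertens_from_theta:
  fixes C :: "nat set" and \<delta> :: real
  assumes C: "\<And>p. p \<in> C \<Longrightarrow> prime p"
    and th: "(\<lambda>n. (\<Sum>p | p \<in> C \<and> p \<le> n. ln (real p)) / real n) \<longlonglongrightarrow> \<delta>"
  shows "(\<lambda>N. (\<Sum>p | p \<in> C \<and> p \<le> N. 1 / real p) / ln (ln (real N))) \<longlonglongrightarrow> \<delta>"
proof -
  define \<theta> where "\<theta> n = (\<Sum>p | p \<in> C \<and> p \<le> n. ln (real p))" for n :: nat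
  define u where "u n = 1 / (real n * ln (real n))" for n
  define f where "f k = (if k \<in> C then ln (real k) else 0)" for k
  \<comment> \<open>The weights start at 2, because \<open>u 1 = 0\<close> by division by zero and
    \<open>u\<close> decreases only from 2 on. Their partial sums are \<open>n - 1\<close>, which
    explains this factor in \<open>v\<close> and \<open>d\<close>.\<close>
  define g :: "nat \<Rightarrow> real" where "g k = (if k > 1 then 1 else 0)" for k
  define v where "v n = (if n > 1 then real (n - 1) * (u n - u (Suc n)) else 0)" for n
  have sumC: "(\<Sum>k\<in>{0<..n}. if k \<in> C then h k else 0) = (\<Sum>p | p \<in> C \<and> p \<le> n. h p)" for n and h :: "nat \<Rightarrow> real"
  proof -
    have "(\<Sum>k\<in>{0<..n}. if k \<in> C then h k else 0) = sum h {k\<in>{0<..n}. k \<in> C}"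
      by (rule sum.inter_filter[symmetric]) simp
    also have "{k\<in>{0<..n}. k \<in> C} = {p. p \<in> C \<and> p \<le> n}" using C prime_gt_0_nat by auto
    finally show ?thesis .
  qed
  have F: "(\<Sum>k\<in>{0<..n}. f k) = \<theta> n" for n unfolding f_def \<theta>_def by (rule sumC)
  have G: "(\<Sum>k\<in>{0<..n}. g k) = real (n - 1)" for n
  proof -
    have "(\<Sum>k\<in>{0<..n}. g k) = real (card {k\<in>{0<..n}. k > 1})" unfolding g_def by (simp add: sum.If_cases Int_def)
    also have "{k\<in>{0<..n}. k > 1} = {1<..n}" by auto
    finally show ?thesis by simp
  qed
  have u_mono: "u (Suc n) \<le> u n" if "n > 1" for n
    using ln_ln_step[of n] that by (simp add: u_def)
  have v: "v n \<ge> 0" for n using u_mono[of n] by (simp add: v_def)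
  have \<theta>0: "\<theta> n = 0" if "n \<le> 1" for n
  proof -
    have "{p. p \<in> C \<and> p \<le> n} = {}" using that C by (auto dest!: C prime_gt_1_nat)
    then show ?thesis by (simp only: \<theta>_def sum.empty)
  qed
  define W where "W N = (\<Sum>n\<in>{1<..N}. 1 / (real n * ln (real n)))" for N
  have Wg: "(\<Sum>n\<in>{0<..N}. g n * u n) = W N" for N
    unfolding W_def g_def by (rule sum.mono_neutral_cong_right) (auto simp: u_def)
  have W: "(\<Sum>n\<in>{0<..N}. v n) = W N - real (N - 1) * u (Suc N)" for N
  proof -
    have "W N = (\<Sum>n\<in>{0<..N}. real (n - 1) * (u n - u (Suc n))) + real (N - 1) * u (Suc N)"
      unfolding Wg[symmetric] sum_by_parts[of g u N] G ..
    also have "(\<Sum>n\<in>{0<..N}. real (n - 1) * (u n - u (Suc n))) = (\<Sum>n\<in>{0<..N}. v n)"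
      by (intro sum.cong refl) (auto simp: v_def)
    finally show ?thesis by simp
  qed
  have Wlim: "(\<lambda>N. W N / ln (ln (real N))) \<longlonglongrightarrow> 1" unfolding W_def by (rule sum_inverse_n_ln_n_asymp)
  have tail: "(\<lambda>N. real (N - 1) * u (Suc N) / ln (ln (real N))) \<longlonglongrightarrow> 0"
    unfolding u_def by real_asymp
  have Vlim: "(\<lambda>N. (\<Sum>n\<in>{0<..N}. v n) / ln (ln (real N))) \<longlonglongrightarrow> 1"
    using tendsto_diff[OF Wlim tail] unfolding W by (simp add: diff_divide_distrib)
  have ll: "filterlim (\<lambda>N. ln (ln (real N))) at_top sequentially" by real_asymp
  have Vtop: "filterlim (\<lambda>N. \<Sum>n\<in>{0<..N}. v n) at_top sequentially"
  proof -
    have "filterlim (\<lambda>N. (\<Sum>n\<in>{0<..N}. v n) / ln (ln (real N)) * ln (ln (real N))) at_top sequentially"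
      by (rule filterlim_tendsto_pos_mult_at_top[OF Vlim _ ll]) simp
    moreover have "\<forall>\<^sub>F N in sequentially. (\<Sum>n\<in>{0<..N}. v n) / ln (ln (real N)) * ln (ln (real N)) = (\<Sum>n\<in>{0<..N}. v n)"
    proof -
      have "\<forall>\<^sub>F N in sequentially. ln (ln (real N)) > 0" by real_asymp
      then show ?thesis by eventually_elim simp
    qed
    ultimately show ?thesis by (rule filterlim_cong[THEN iffD1, rotated -1, OF _ refl refl])
  qed
  define d where "d n = \<theta> n / real (n - 1) - \<delta>" for n
  have d: "d \<longlonglongrightarrow> 0"
  proof -
    have "(\<lambda>n. \<theta> n / real n * (real n / real (n - 1)) - \<delta>) \<longlonglongrightarrow> \<delta> * 1 - \<delta>"
    proof (intro tendsto_intros)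
      show "(\<lambda>n. \<theta> n / real n) \<longlonglongrightarrow> \<delta>" using th unfolding \<theta>_def .
      show "(\<lambda>n. real n / real (n - 1)) \<longlonglongrightarrow> 1" by real_asymp
    qed
    moreover have "\<forall>\<^sub>F n in sequentially. \<theta> n / real n * (real n / real (n - 1)) - \<delta> = d n"
      using eventually_gt_at_top[of 0] by eventually_elim (simp add: d_def)
    ultimately show ?thesis using Lim_transform_eventually by fastforce
  qed
  have s: "(\<Sum>p | p \<in> C \<and> p \<le> N. 1 / real p) = (\<Sum>n\<in>{0<..N}. d n * v n) + \<delta> * (\<Sum>n\<in>{0<..N}. v n) + \<theta> N * u (Suc N)" for N
  proof -
    have "(\<Sum>p | p \<in> C \<and> p \<le> N. 1 / real p) = (\<Sum>n\<in>{0<..N}. f n * u n)"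
      unfolding sumC[symmetric]
    proof (intro sum.cong refl)
      show "(if k \<in> C then 1 / real k else 0) = f k * u k" for k
        using C[of k] prime_gt_1_nat[of k] by (auto simp: f_def u_def)
    qed
    also have "\<dots> = (\<Sum>n\<in>{0<..N}. \<theta> n * (u n - u (Suc n))) + \<theta> N * u (Suc N)"
      unfolding sum_by_parts[of f u N] F ..
    also have "(\<Sum>n\<in>{0<..N}. \<theta> n * (u n - u (Suc n))) = (\<Sum>n\<in>{0<..N}. d n * v n + \<delta> * v n)"
    proof (intro sum.cong refl)
      show "\<theta> n * (u n - u (Suc n)) = d n * v n + \<delta> * v n" for n
      proof (cases "n > 1")
        case True
        have "t * w = (t / y - \<delta>) * (y * w) + \<delta> * (y * w)" if "y \<noteq> 0" for t y w :: real
          using that by (simp add: field_simps)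
        from this[of "real (n - 1)" "\<theta> n" "u n - u (Suc n)"] True show ?thesis
          unfolding d_def v_def by (simp only: if_True)
      qed (use \<theta>0[of n] in \<open>simp add: v_def\<close>)
    qed
    finally show ?thesis by (simp add: sum.distrib sum_distrib_left)
  qed
  have t1: "(\<lambda>N. (\<Sum>n\<in>{0<..N}. d n * v n) / ln (ln (real N))) \<longlonglongrightarrow> 0"
  proof -
    have "(\<lambda>N. (\<Sum>n\<in>{0<..N}. d n * v n) / (\<Sum>n\<in>{0<..N}. v n) * ((\<Sum>n\<in>{0<..N}. v n) / ln (ln (real N)))) \<longlonglongrightarrow> 0 * 1"
      by (intro tendsto_mult weighted_cesaro d v Vtop Vlim)
    moreover have "\<forall>\<^sub>F N in sequentially. (\<Sum>n\<in>{0<..N}. d n * v n) / (\<Sum>n\<in>{0<..N}. v n) * ((\<Sum>n\<in>{0<..N}. v n) / ln (ln (real N))) =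
        (\<Sum>n\<in>{0<..N}. d n * v n) / ln (ln (real N))"
    proof -
      have "\<forall>\<^sub>F N in sequentially. (\<Sum>n\<in>{0<..N}. v n) > 0" using Vtop by (simp add: filterlim_at_top_dense)
      then show ?thesis by eventually_elim simp
    qed
    ultimately show ?thesis using Lim_transform_eventually by fastforce
  qed
  have t3: "(\<lambda>N. \<theta> N * u (Suc N) / ln (ln (real N))) \<longlonglongrightarrow> 0"
  proof -
    have "(\<lambda>N. \<theta> N / real N * (real N * u (Suc N) / ln (ln (real N)))) \<longlonglongrightarrow> \<delta> * 0"
      using th unfolding \<theta>_def[symmetric] by (intro tendsto_mult) (assumption, unfold u_def, real_asymp)
    moreover have "\<forall>\<^sub>F N in sequentially. \<theta> N / real N * (real N * u (Suc N) / ln (ln (real N))) = \<theta> N * u (Suc N) / ln (ln (real N))"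
      using eventually_gt_at_top[of 0] by eventually_elim simp
    ultimately show ?thesis using Lim_transform_eventually by fastforce
  qed
  have "(\<lambda>N. (\<Sum>n\<in>{0<..N}. d n * v n) / ln (ln (real N)) + \<delta> * ((\<Sum>n\<in>{0<..N}. v n) / ln (ln (real N)))
      + \<theta> N * u (Suc N) / ln (ln (real N))) \<longlonglongrightarrow> 0 + \<delta> * 1 + 0"
    by (intro tendsto_intros t1 t3 Vlim)
  then show ?thesis unfolding s by (simp add: add_divide_distrib)
qed

section \<open>Square-free numbers with a prescribed distribution of prime factors\<close>

text \<open>The residue classes modulo \<open>m\<close> enter the combinatorics only as finitely
  many disjoint sets of primes. The sets need not exhaust the primes, as the divisors of
  \<open>m\<close> lie in none of them.\<close>

locale prime_classes =
  fixes J :: "nat set" and C :: "nat \<Rightarrow> nat set"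
  assumes finite_J: "finite J"
    and prime_C: "\<And>j p. j \<in> J \<Longrightarrow> p \<in> C j \<Longrightarrow> prime p"
    and disjoint_C: "\<And>i j p. i \<in> J \<Longrightarrow> j \<in> J \<Longrightarrow> p \<in> C i \<Longrightarrow> p \<in> C j \<Longrightarrow> i = j"
begin

text \<open>The inclusion replaces the condition on \<open>omega n\<close> in the statement to be
  proved. It is the form that survives the removal of a prime factor; \<open>profile_iff\<close>
  translates back.\<close>

definition profile :: "(nat \<Rightarrow> nat) \<Rightarrow> nat \<Rightarrow> bool" where
  "profile a n \<longleftrightarrow> squarefree n \<and> prime_factors n \<subseteq> (\<Union>j\<in>J. C j) \<and> (\<forall>j\<in>J. card (prime_factors n \<inter> C j) = a j)"

definition profiled :: "(nat \<Rightarrow> nat) \<Rightarrow> real \<Rightarrow> nat set" where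
  "profiled a X = {n. n > 0 \<and> real n \<le> X \<and> profile a n}"

lemma finite_profiled [simp]: "finite (profiled a X)"
proof (rule finite_subset)
  show "profiled a X \<subseteq> {..nat \<lfloor>X\<rfloor>}"
    by (auto simp: profiled_def le_nat_floor)
qed simp

lemma card_prime_factors_profile:
  assumes "profile a n"
  shows "card (prime_factors n) = (\<Sum>j\<in>J. a j)"
proof -
  have "prime_factors n = (\<Union>j\<in>J. prime_factors n \<inter> C j)" using assms by (auto simp: profile_def)
  also have "card \<dots> = (\<Sum>j\<in>J. card (prime_factors n \<inter> C j))"
    using finite_J disjoint_C by (intro card_UN_disjoint) auto
  also have "\<dots> = (\<Sum>j\<in>J. a j)" using assms by (intro sum.cong) (auto simp: profile_def)
  finally show ?thesis .
qed

lemma profile_remove_prime: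
  assumes j: "j \<in> J" "a j > 0" and p: "p \<in> C j" and n: "\<not> p dvd n" "n > 0"
  shows "profile a (p * n) \<longleftrightarrow> profile (a(j := a j - 1)) n"
proof -
  have pr: "prime p" using prime_C j p by blast
  then have cop: "coprime p n" using n by (simp add: prime_imp_coprime)
  have sq: "squarefree (p * n) \<longleftrightarrow> squarefree n"
    using cop pr squarefree_prime[of p] by (metis squarefree_mono squarefree_mult_coprime dvd_triv_right)
  have pf: "prime_factors (p * n) = insert p (prime_factors n)"
    using pr n by (simp add: prime_factors_product prime_gt_0_nat prime_factorization_prime)
  have pn: "p \<notin> prime_factors n" using n by (auto dest: in_prime_factors_imp_dvd)
  have "card (insert p (prime_factors n) \<inter> C i) = (if i = j then Suc (card (prime_factors n \<inter> C i)) else card (prime_factors n \<inter> C i))"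
    if "i \<in> J" for i
  proof (cases "i = j")
    case True
    then show ?thesis using p pn by simp
  next
    case False
    then have "p \<notin> C i" using disjoint_C[OF that j(1) _ p] by blast
    then show ?thesis using False by simp
  qed
  then have "(\<forall>i\<in>J. card (insert p (prime_factors n) \<inter> C i) = a i) \<longleftrightarrow> (\<forall>i\<in>J. card (prime_factors n \<inter> C i) = (a(j := a j - 1)) i)"
    using j by (intro ball_cong refl) auto
  then show ?thesis unfolding profile_def sq pf using j p by auto
qed

definition cofactors :: "nat \<Rightarrow> real \<Rightarrow> nat \<Rightarrow> nat set" where
  "cofactors j X n = {p. p \<in> C j \<and> real (p * n) \<le> X \<and> \<not> p dvd n}"

lemma finite_primes_le [simp]: "finite {p. p \<in> C j \<and> real p \<le> X}"
  by (rule finite_subset[of _ "{..nat \<lfloor>X\<rfloor>}"]) (auto simp: le_nat_floor)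

lemma cofactors_subset:
  assumes "n > 0"
  shows "cofactors j X n \<subseteq> {p. p \<in> C j \<and> real p \<le> X}"
proof
  fix p assume p: "p \<in> cofactors j X n"
  have "p \<le> p * n" using assms by simp
  then have "real p \<le> real (p * n)" by (rule of_nat_mono)
  then show "p \<in> {p. p \<in> C j \<and> real p \<le> X}" using p by (simp add: cofactors_def)
qed

lemma finite_cofactors: "n > 0 \<Longrightarrow> finite (cofactors j X n)"
  using finite_subset[OF cofactors_subset finite_primes_le] .

text \<open>The pairs of a number and one of its primes from class \<open>j\<close> correspond to
  the pairs of quotient and prime. The weight \<open>g\<close> is left open since it is taken once
  as \<open>1 / n\<close> and once as \<open>ln p\<close>.\<close>

lemma sum_profiled_prime:
  fixes g :: "nat \<Rightarrow> nat \<Rightarrow> real"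
  assumes j: "j \<in> J" "a j > 0"
  shows "(\<Sum>n\<in>profiled a X. \<Sum>p\<in>prime_factors n \<inter> C j. g n p) =
    (\<Sum>n\<in>profiled (a(j := a j - 1)) X. \<Sum>p\<in>cofactors j X n. g (p * n) p)"
proof -
  have "(\<Sum>n\<in>profiled a X. \<Sum>p\<in>prime_factors n \<inter> C j. g n p) = (\<Sum>(n, p)\<in>Sigma (profiled a X) (\<lambda>n. prime_factors n \<inter> C j). g n p)"
    by (rule sum.Sigma) auto
  also have "\<dots> = (\<Sum>(n, p)\<in>Sigma (profiled (a(j := a j - 1)) X) (cofactors j X). g (p * n) p)"
  proof (rule sum.reindex_bij_witness[of _ "\<lambda>(n, p). (p * n, p)" "\<lambda>(n, p). (n div p, p)"])
    fix z assume "z \<in> Sigma (profiled a X) (\<lambda>n. prime_factors n \<inter> C j)"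
    then obtain n p where z: "z = (n, p)" "n > 0" "real n \<le> X" "profile a n" "p dvd n" "prime p" "p \<in> C j"
      by (auto simp: profiled_def in_prime_factors_iff)
    then obtain k where k: "n = p * k" by (auto elim: dvdE)
    have p0: "p > 0" "k > 0" using z k by (auto simp: prime_gt_0_nat)
    have "\<not> p dvd k"
    proof
      assume "p dvd k"
      then have "p ^ 2 dvd n" unfolding k by (auto simp: power2_eq_square)
      then show False using z(4,6) by (auto simp: profile_def squarefree_def dest: not_prime_unit)
    qed
    moreover have "real k \<le> X"
    proof -
      have "k \<le> n" using p0 k by simp
      then show ?thesis using z(3) by linarith
    qed
    ultimately show "(case z of (n, p) \<Rightarrow> (n div p, p)) \<in> Sigma (profiled (a(j := a j - 1)) X) (cofactors j X)"
      using z p0 profile_remove_prime[where a = a, OF j z(7) _ p0(2)] unfolding k z(1)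
          by (auto simp: profiled_def cofactors_def)
    show "(case (case z of (n, p) \<Rightarrow> (n div p, p)) of (n, p) \<Rightarrow> (p * n, p)) = z" using z(1) k p0 by simp
    show "(case (case z of (n, p) \<Rightarrow> (n div p, p)) of (n, p) \<Rightarrow> g (p * n) p) = (case z of (n, p) \<Rightarrow> g n p)" using z(1) k p0
        by simp
  next
    fix z assume "z \<in> Sigma (profiled (a(j := a j - 1)) X) (cofactors j X)"
    then obtain n p where z: "z = (n, p)" "n > 0" "profile (a(j := a j - 1)) n" "p \<in> C j" "real (p * n) \<le> X" "\<not> p dvd n"
      by (auto simp: profiled_def cofactors_def)
    have pr: "prime p" using prime_C j z by blast
    then have p0: "p > 0" by (rule prime_gt_0_nat)
    show "(case (case z of (n, p) \<Rightarrow> (p * n, p)) of (n, p) \<Rightarrow> (n div p, p)) = z" using z(1) p0 by simp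
    show "(case z of (n, p) \<Rightarrow> (p * n, p)) \<in> Sigma (profiled a X) (\<lambda>n. prime_factors n \<inter> C j)"
      using z p0 pr profile_remove_prime[where a = a, OF j z(4,6,2)] by (auto simp: profiled_def in_prime_factors_iff)
  qed
  also have "\<dots> = (\<Sum>n\<in>profiled (a(j := a j - 1)) X. \<Sum>p\<in>cofactors j X n. g (p * n) p)"
  proof (rule sum.Sigma[symmetric])
    show "\<forall>n\<in>profiled (a(j := a j - 1)) X. finite (cofactors j X n)"
      using finite_cofactors by (auto simp: profiled_def)
  qed simp
  finally show ?thesis .
qed

lemma sum_update:
  assumes "j \<in> J" "a j > 0"
  shows "(\<Sum>i\<in>J. (a(j := a j - 1)) i) = (\<Sum>i\<in>J. a i) - (1::nat)" "(\<Sum>i\<in>J. a i) > (0::nat)"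
    "(\<Prod>i\<in>J. fact (a i)) = real (a j) * (\<Prod>i\<in>J. fact ((a(j := a j - 1)) i))"
proof -
  have "(\<Sum>i\<in>J. a i) = a j + (\<Sum>i\<in>J - {j}. a i)" using assms finite_J by (simp add: sum.remove)
  moreover have "(\<Sum>i\<in>J. (a(j := a j - 1)) i) = (a j - 1) + (\<Sum>i\<in>J - {j}. a i)"
    using assms finite_J by (simp add: sum.remove)
  ultimately show "(\<Sum>i\<in>J. (a(j := a j - 1)) i) = (\<Sum>i\<in>J. a i) - (1::nat)" "(\<Sum>i\<in>J. a i) > (0::nat)"
    using assms by auto
  have "(\<Prod>i\<in>J. fact (a i)) = fact (a j) * (\<Prod>i\<in>J - {j}. fact (a i) :: real)" using assms finite_J by (simp add: prod.remove)
  moreover have "(\<Prod>i\<in>J. fact ((a(j := a j - 1)) i)) = fact (a j - 1) * (\<Prod>i\<in>J - {j}. fact (a i) :: real)"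
    using assms finite_J by (simp add: prod.remove)
  moreover have "fact (a j) = real (a j) * fact (a j - 1)" using assms by (simp add: fact_reduce)
  ultimately show "(\<Prod>i\<in>J. fact (a i)) = real (a j) * (\<Prod>i\<in>J. fact ((a(j := a j - 1)) i))" by simp
qed

section \<open>Sums of reciprocals\<close>

definition recip_sum :: "(nat \<Rightarrow> nat) \<Rightarrow> real \<Rightarrow> real" where
  "recip_sum a X = (\<Sum>n\<in>profiled a X. 1 / real n)"

definition prime_recip :: "nat \<Rightarrow> real \<Rightarrow> real" where
  "prime_recip j X = (\<Sum>p | p \<in> C j \<and> real p \<le> X. 1 / real p)"

definition theta :: "nat \<Rightarrow> real \<Rightarrow> real" where
  "theta j X = (\<Sum>p | p \<in> C j \<and> real p \<le> X. ln (real p))"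

lemma recip_sum_mono: "X \<le> Y \<Longrightarrow> recip_sum a X \<le> recip_sum a Y"
  unfolding recip_sum_def by (rule sum_mono2[OF finite_profiled]) (auto simp: profiled_def)

text \<open>Each \<open>n\<close> has exactly \<open>a j\<close> primes in class \<open>j\<close>,
  so removing one of them in all possible ways counts it \<open>a j\<close> times.\<close>

lemma recip_sum_recursion:
  assumes j: "j \<in> J" "a j > 0"
  defines "b \<equiv> a(j := a j - 1)"
  shows "real (a j) * recip_sum a X = (\<Sum>n\<in>profiled b X. 1 / real n * (\<Sum>p\<in>cofactors j X n. 1 / real p))"
proof -
  have "real (a j) * recip_sum a X = (\<Sum>n\<in>profiled a X. \<Sum>p\<in>prime_factors n \<inter> C j. 1 / real n)"
    unfolding recip_sum_def sum_distrib_left using j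
    by (intro sum.cong refl) (auto simp: profiled_def profile_def)
  also have "\<dots> = (\<Sum>n\<in>profiled b X. \<Sum>p\<in>cofactors j X n. 1 / real (p * n))"
    unfolding b_def by (rule sum_profiled_prime[where a = a, OF j])
  finally show ?thesis by (simp add: sum_distrib_left mult.commute)
qed

lemma recip_sum_upper:
  assumes j: "j \<in> J" "a j > 0"
  shows "real (a j) * recip_sum a X \<le> recip_sum (a(j := a j - 1)) X * prime_recip j X"
proof -
  have inner: "(\<Sum>p\<in>cofactors j X n. 1 / real p) \<le> prime_recip j X"
    if n: "n \<in> profiled (a(j := a j - 1)) X" for n
    unfolding prime_recip_def using n by (intro sum_mono2 cofactors_subset) (auto simp: profiled_def)
  show ?thesis
    unfolding recip_sum_recursion[where a = a, OF j] unfolding recip_sum_def sum_distrib_right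
    by (intro sum_mono mult_left_mono inner) auto
qed

text \<open>Any \<open>n, p \<le> \<surd>X\<close> satisfy \<open>p n \<le> X\<close>, and passing from \<open>X\<close> to \<open>\<surd>X\<close> does not change \<open>ln (ln X)\<close> asymptotically.\<close>
lemma recip_sum_lower:
  assumes j: "j \<in> J" "a j > 0" and X: "X \<ge> 1"
  shows "recip_sum (a(j := a j - 1)) (sqrt X) * (prime_recip j (sqrt X) - real (\<Sum>i\<in>J. a i)) \<le> real (a j) * recip_sum a X"
proof -
  let ?b = "a(j := a j - 1)" and ?K = "real (\<Sum>i\<in>J. a i)"
  have inner: "prime_recip j (sqrt X) - ?K \<le> (\<Sum>p\<in>cofactors j X n. 1 / real p)"
    if n: "n \<in> profiled ?b (sqrt X)" for n
  proof -
    let ?P = "{p. p \<in> C j \<and> real p \<le> sqrt X}"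
    have pn: "real (p * n) \<le> X" if "real p \<le> sqrt X" for p
    proof -
      have "real p * real n \<le> sqrt X * sqrt X" using that n X by (intro mult_mono) (auto simp: profiled_def)
      then show ?thesis using X by simp
    qed
    have "prime_recip j (sqrt X) = (\<Sum>p\<in>?P - prime_factors n. 1 / real p) + (\<Sum>p\<in>?P \<inter> prime_factors n. 1 / real p)"
      unfolding prime_recip_def by (subst sum.Int_Diff[of _ _ "prime_factors n"]) auto
    \<comment> \<open>The excluded primes are those dividing \<open>n\<close>; there are at most
      \<open>?K\<close> of them, and bounding each reciprocal by 1 is enough against a main term
      that tends to infinity.\<close>
    also have "(\<Sum>p\<in>?P \<inter> prime_factors n. 1 / real p) \<le> (\<Sum>p\<in>?P \<inter> prime_factors n. 1)"
      by (intro sum_mono) (auto dest!: in_prime_factors_imp_prime prime_gt_0_nat)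
    also have "\<dots> \<le> real (card (prime_factors n))" by (auto intro!: card_mono)
    also have "\<dots> \<le> ?K" using n card_prime_factors_profile[of ?b n] sum_update[where a = a, OF j] by (simp add: profiled_def)
    also have "(\<Sum>p\<in>?P - prime_factors n. 1 / real p) \<le> (\<Sum>p\<in>cofactors j X n. 1 / real p)"
    proof (rule sum_mono2)
      show "finite (cofactors j X n)" using n by (simp add: finite_cofactors profiled_def)
      show "?P - prime_factors n \<subseteq> cofactors j X n"
        using pn n prime_C[OF j(1)] by (auto simp: in_prime_factors_iff profiled_def cofactors_def)
    qed auto
    finally show ?thesis by simp
  qed
  have sX: "sqrt X \<le> X" using X real_sqrt_le_mono[of 1 X] mult_left_mono[of 1 "sqrt X" "sqrt X"] by simp
  have "recip_sum ?b (sqrt X) * (prime_recip j (sqrt X) - ?K) = (\<Sum>n\<in>profiled ?b (sqrt X). 1 / real n * (prime_recip j (sqrt X) - ?K))"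
    by (simp add: recip_sum_def sum_distrib_right)
  also have "\<dots> \<le> (\<Sum>n\<in>profiled ?b (sqrt X). 1 / real n * (\<Sum>p\<in>cofactors j X n. 1 / real p))"
    by (intro sum_mono mult_left_mono inner) auto
  also have "\<dots> \<le> (\<Sum>n\<in>profiled ?b X. 1 / real n * (\<Sum>p\<in>cofactors j X n. 1 / real p))"
  proof (rule sum_mono2[OF finite_profiled])
    show "profiled ?b (sqrt X) \<subseteq> profiled ?b X" using sX by (auto simp: profiled_def)
  qed (intro mult_nonneg_nonneg sum_nonneg; simp)
  also have "\<dots> = real (a j) * recip_sum a X" by (rule recip_sum_recursion[where a = a, OF j, symmetric])
  finally show ?thesis .
qed

lemma recip_sum_zero:
  assumes "\<And>j. j \<in> J \<Longrightarrow> a j = 0" "X \<ge> 1"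
  shows "recip_sum a X = 1"
proof -
  have "profiled a X = {1}"
  proof (intro equalityI subsetI)
    fix n assume n: "n \<in> profiled a X"
    then have "card (prime_factors n) = 0"
      using card_prime_factors_profile[of a n] assms(1) by (simp add: profiled_def)
    then have "prime_factors n = {}" by simp
    then have "n = 1" using n by (auto simp: profiled_def prime_factorization_empty_iff)
    then show "n \<in> {1}" by simp
  qed (use assms in \<open>auto simp: profiled_def profile_def\<close>)
  then show ?thesis by (simp add: recip_sum_def)
qed

end

locale prime_classes_density = prime_classes +
  fixes \<delta> :: real
  assumes theta_lim: "\<And>j. j \<in> J \<Longrightarrow> ((\<lambda>X. theta j X / X) \<longlongrightarrow> \<delta>) at_top"
    and prime_recip_lim: "\<And>j. j \<in> J \<Longrightarrow> ((\<lambda>X. prime_recip j X / ln (ln X)) \<longlongrightarrow> \<delta>) at_top"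
begin

lemma theta_bounds:
  assumes "j \<in> J" "X \<ge> 0"
  shows "theta j X \<ge> 0" "theta j X \<le> 2 * X"
proof -
  show "theta j X \<ge> 0"
    unfolding theta_def
  proof (rule sum_nonneg)
    fix p assume "p \<in> {p. p \<in> C j \<and> real p \<le> X}"
    then have "p > 0" using prime_C[OF assms(1)] prime_gt_0_nat by blast
    then show "ln (real p) \<ge> 0" by simp
  qed
  have "theta j X \<le> (\<Sum>p | prime p \<and> p \<le> nat \<lfloor>X\<rfloor>. ln (real p))"
    unfolding theta_def using prime_C[OF assms(1)]
    by (intro sum_mono2) (auto simp: le_nat_floor dest!: prime_gt_0_nat)
  also have "\<dots> \<le> 2 * real (nat \<lfloor>X\<rfloor>)" by (rule theta_le)
  also have "\<dots> \<le> 2 * X" using assms by simp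
  finally show "theta j X \<le> 2 * X" .
qed

text \<open>Each prime contributes a factor \<open>\<delta> * ln (ln X)\<close> to the reciprocal
  sum; the factorials undo the ordering of the primes within each class.\<close>

definition limit_const :: "(nat \<Rightarrow> nat) \<Rightarrow> real" where
  "limit_const a = \<delta> ^ (\<Sum>j\<in>J. a j) / (\<Prod>j\<in>J. fact (a j))"

lemma limit_const_update:
  assumes j: "j \<in> J" "a j > 0"
  shows "limit_const (a(j := a j - 1)) * \<delta> = real (a j) * limit_const a"
proof -
  have "\<delta> ^ (\<Sum>i\<in>J. a i) = \<delta> ^ (\<Sum>i\<in>J. (a(j := a j - 1)) i) * \<delta>"
    unfolding sum_update(1)[where a = a, OF j] using sum_update(2)[where a = a, OF j] by (metis power_minus_mult)
  then show ?thesis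
    unfolding limit_const_def sum_update(3)[where a = a, OF j] using j by (simp del: fun_upd_apply)
qed

text \<open>Induction on the number of prime factors: a class with \<open>a j > 0\<close> is
  lowered, and \<open>recip_sum_lower\<close> and \<open>recip_sum_upper\<close> squeeze the sum.
  Dividing by \<open>a j\<close> at each step builds up the factorials.\<close>

lemma recip_sum_asymp:
  "((\<lambda>X. recip_sum a X / ln (ln X) ^ (\<Sum>j\<in>J. a j)) \<longlongrightarrow> limit_const a) at_top"
proof (induction "\<Sum>j\<in>J. a j" arbitrary: a)
  case 0
  then have z: "a j = 0" if "j \<in> J" for j using that finite_J by simp
  have ev: "\<forall>\<^sub>F X in at_top. 1 = recip_sum a X / ln (ln X) ^ (\<Sum>j\<in>J. a j)"
    using eventually_ge_at_top[of 1] by eventually_elim (use z in \<open>simp add: recip_sum_zero\<close>)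
  have "limit_const a = 1" using z by (simp add: limit_const_def)
  then show ?case using Lim_transform_eventually[OF tendsto_const ev] by simp
next
  case (Suc k)
  have "\<exists>j\<in>J. a j > 0"
  proof (rule ccontr)
    assume "\<not> (\<exists>j\<in>J. a j > 0)"
    then have "(\<Sum>j\<in>J. a j) = 0" by simp
    then show False using Suc.hyps(2) by simp
  qed
  then obtain j where j: "j \<in> J" "a j > 0" by blast
  define b where "b = a(j := a j - 1)"
  define K where "K = real (\<Sum>i\<in>J. a i)"
  have kb: "k = (\<Sum>i\<in>J. b i)" using sum_update(1)[where a = a, OF j] Suc.hyps(2) by (simp add: b_def)
  have IH: "((\<lambda>X. recip_sum b X / ln (ln X) ^ k) \<longlongrightarrow> limit_const b) at_top"
    using Suc.hyps(1)[OF kb] by (simp only: kb)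
  have P: "((\<lambda>X. prime_recip j X / ln (ln X)) \<longlongrightarrow> \<delta>) at_top" by (rule prime_recip_lim[OF j(1)])
  have sq: "filterlim sqrt at_top at_top" by (rule sqrt_at_top)
  have llr: "((\<lambda>X. ln (ln (sqrt X)) / ln (ln X)) \<longlongrightarrow> 1) at_top" by real_asymp
  have llpos: "\<forall>\<^sub>F X in at_top. ln (ln X) > (0::real)" by real_asymp
  have llspos: "\<forall>\<^sub>F X in at_top. ln (ln (sqrt X)) > (0::real)" by real_asymp
  have lower: "((\<lambda>X. recip_sum b (sqrt X) * (prime_recip j (sqrt X) - K) / ln (ln X) ^ Suc k) \<longlongrightarrow> limit_const b * \<delta>) at_top"
  proof -
    have "((\<lambda>X. (recip_sum b (sqrt X) / ln (ln (sqrt X)) ^ k) * (ln (ln (sqrt X)) / ln (ln X)) ^ k *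
        ((prime_recip j (sqrt X) / ln (ln (sqrt X))) * (ln (ln (sqrt X)) / ln (ln X)) - K * (1 / ln (ln X)))) \<longlongrightarrow>
        limit_const b * 1 ^ k * (\<delta> * 1 - K * 0)) at_top"
    proof (intro tendsto_mult tendsto_diff tendsto_power tendsto_const llr)
      show "((\<lambda>X. recip_sum b (sqrt X) / ln (ln (sqrt X)) ^ k) \<longlongrightarrow> limit_const b) at_top"
        by (rule filterlim_compose[OF IH sq])
      show "((\<lambda>X. prime_recip j (sqrt X) / ln (ln (sqrt X))) \<longlongrightarrow> \<delta>) at_top"
        by (rule filterlim_compose[OF P sq])
      show "((\<lambda>X::real. 1 / ln (ln X)) \<longlongrightarrow> 0) at_top" by real_asymp
    qed
    moreover have "\<forall>\<^sub>F X in at_top. (recip_sum b (sqrt X) / ln (ln (sqrt X)) ^ k) * (ln (ln (sqrt X)) / ln (ln X)) ^ k *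
        ((prime_recip j (sqrt X) / ln (ln (sqrt X))) * (ln (ln (sqrt X)) / ln (ln X)) - K * (1 / ln (ln X))) =
        recip_sum b (sqrt X) * (prime_recip j (sqrt X) - K) / ln (ln X) ^ Suc k"
      using llpos llspos
    proof eventually_elim
      case (elim X)
      have "r / y ^ k * (y / x) ^ k * (p / y * (y / x) - K * (1 / x)) = r * (p - K) / x ^ Suc k"
        if "x > 0" "y > 0" for r p x y :: real
        using that by (simp add: field_simps)
      from this[OF elim] show ?case .
    qed
    ultimately show ?thesis using Lim_transform_eventually by fastforce
  qed
  have upper: "((\<lambda>X. recip_sum b X * prime_recip j X / ln (ln X) ^ Suc k) \<longlongrightarrow> limit_const b * \<delta>) at_top"
    using tendsto_mult[OF IH P] by (simp add: mult_ac)
  have "((\<lambda>X. real (a j) * recip_sum a X / ln (ln X) ^ Suc k) \<longlongrightarrow> limit_const b * \<delta>) at_top"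
  proof (rule tendsto_sandwich[OF _ _ lower upper])
    show "\<forall>\<^sub>F X in at_top. recip_sum b (sqrt X) * (prime_recip j (sqrt X) - K) / ln (ln X) ^ Suc k
        \<le> real (a j) * recip_sum a X / ln (ln X) ^ Suc k"
      using llpos eventually_ge_at_top[of 1]
    proof eventually_elim
      case (elim X)
      show ?case unfolding b_def K_def
        using elim by (intro divide_right_mono recip_sum_lower[where a = a, OF j]) auto
    qed
    show "\<forall>\<^sub>F X in at_top. real (a j) * recip_sum a X / ln (ln X) ^ Suc k
        \<le> recip_sum b X * prime_recip j X / ln (ln X) ^ Suc k"
      using llpos
    proof eventually_elim
      case (elim X)
      show ?case unfolding b_def
        using elim by (intro divide_right_mono recip_sum_upper[where a = a, OF j]) auto
    qed
  qed
  then have "((\<lambda>X. 1 / real (a j) * (real (a j) * recip_sum a X / ln (ln X) ^ Suc k))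
      \<longlongrightarrow> 1 / real (a j) * (limit_const b * \<delta>)) at_top"
    by (rule tendsto_mult_left)
  moreover have "1 / real (a j) * (limit_const b * \<delta>) = limit_const a"
    unfolding b_def limit_const_update[where a = a, OF j] using j by simp
  ultimately show ?case using j Suc.hyps(2)[symmetric] by simp
qed

text \<open>The log-weighted count is accessible by the distribution of the primes alone: peel off one prime factor \<open>p\<close>
  of \<open>n = p n'\<close> in all possible ways and sum \<open>ln p\<close> over \<open>p \<le> X / n'\<close>.\<close>
definition log_count :: "(nat \<Rightarrow> nat) \<Rightarrow> real \<Rightarrow> real" where
  "log_count a X = (\<Sum>n\<in>profiled a X. ln (real n))"

definition log_part :: "nat \<Rightarrow> (nat \<Rightarrow> nat) \<Rightarrow> real \<Rightarrow> real" where
  "log_part j b X = (\<Sum>n\<in>profiled b X. \<Sum>p\<in>cofactors j X n. ln (real p))"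

lemma ln_squarefree:
  assumes "squarefree (n::nat)"
  shows "ln (real n) = (\<Sum>p\<in>prime_factors n. ln (real p))"
proof -
  have n0: "n \<noteq> 0" using assms by (cases "n = 0") auto
  have "n = (\<Prod>p\<in>prime_factors n. p ^ multiplicity p n)"
    using prime_factorization_nat[of n] n0 by simp
  also have "\<dots> = (\<Prod>p\<in>prime_factors n. p)"
  proof (intro prod.cong refl)
    fix p assume "p \<in> prime_factors n"
    then have "prime p" "multiplicity p n > 0" using n0 by (auto simp: in_prime_factors_iff prime_multiplicity_gt_zero_iff)
    moreover from this assms n0 have "multiplicity p n \<le> 1" by (auto simp: squarefree_factorial_semiring'')
    ultimately have "multiplicity p n = 1" by linarith
    then show "p ^ multiplicity p n = p" by simp
  qed
  finally have "real n = real (\<Prod>p\<in>prime_factors n. p)" by (rule arg_cong)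
  then have "ln (real n) = ln (\<Prod>p\<in>prime_factors n. real p)" by simp
  also have "\<dots> = (\<Sum>p\<in>prime_factors n. ln (real p))"
    by (rule ln_prod) (auto dest!: in_prime_factors_imp_prime prime_gt_0_nat)
  finally show ?thesis .
qed

text \<open>The logarithm of a square-free number splits over its primes, which are grouped by
  class. Classes with \<open>a j = 0\<close> contribute nothing; leaving them out avoids the
  truncated value of \<open>a j - 1\<close>.\<close>

lemma log_count_eq: "log_count a X = (\<Sum>j\<in>{j\<in>J. a j > 0}. log_part j (a(j := a j - 1)) X)"
proof -
  have "log_count a X = (\<Sum>n\<in>profiled a X. \<Sum>j\<in>J. \<Sum>p\<in>prime_factors n \<inter> C j. ln (real p))"
    unfolding log_count_def
  proof (intro sum.cong refl)
    fix n assume "n \<in> profiled a X"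
    then have n: "squarefree n" "prime_factors n \<subseteq> (\<Union>j\<in>J. C j)" by (auto simp: profiled_def profile_def)
    then have "prime_factors n = (\<Union>j\<in>J. prime_factors n \<inter> C j)" by auto
    then have "(\<Sum>p\<in>prime_factors n. ln (real p)) = (\<Sum>p\<in>(\<Union>j\<in>J. prime_factors n \<inter> C j). ln (real p))" by simp
    also have "\<dots> = (\<Sum>j\<in>J. \<Sum>p\<in>prime_factors n \<inter> C j. ln (real p))"
      using finite_J disjoint_C by (intro sum.UNION_disjoint) auto
    finally show "ln (real n) = (\<Sum>j\<in>J. \<Sum>p\<in>prime_factors n \<inter> C j. ln (real p))"
      using ln_squarefree[OF n(1)] by simp
  qed
  also have "\<dots> = (\<Sum>j\<in>J. \<Sum>n\<in>profiled a X. \<Sum>p\<in>prime_factors n \<inter> C j. ln (real p))" by (rule sum.swap)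
  also have "\<dots> = (\<Sum>j\<in>{j\<in>J. a j > 0}. \<Sum>n\<in>profiled a X. \<Sum>p\<in>prime_factors n \<inter> C j. ln (real p))"
  proof (rule sum.mono_neutral_right)
    show "\<forall>j\<in>J - {j\<in>J. a j > 0}. (\<Sum>n\<in>profiled a X. \<Sum>p\<in>prime_factors n \<inter> C j. ln (real p)) = 0"
    proof
      fix j assume j: "j \<in> J - {j\<in>J. a j > 0}"
      have "prime_factors n \<inter> C j = {}" if "n \<in> profiled a X" for n
      proof -
        have "card (prime_factors n \<inter> C j) = 0" using j that by (auto simp: profiled_def profile_def)
        then show ?thesis by (simp only: card_eq_0_iff) simp
      qed
      then show "(\<Sum>n\<in>profiled a X. \<Sum>p\<in>prime_factors n \<inter> C j. ln (real p)) = 0" by (intro sum.neutral) simp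
    qed
  qed (use finite_J in auto)
  also have "\<dots> = (\<Sum>j\<in>{j\<in>J. a j > 0}. log_part j (a(j := a j - 1)) X)"
    unfolding log_part_def by (intro sum.cong refl sum_profiled_prime) auto
  finally show ?thesis .
qed

text \<open>The difference from \<theta> consists of the primes up to \<open>y\<close> that divide
  \<open>n\<close>: at most \<open>K\<close> of them, each contributing at most
  \<open>ln y\<close>.\<close>

lemma inner_log_sum_bounds:
  assumes j: "j \<in> J" and n: "n \<in> profiled b X"
  defines "y \<equiv> X / real n" and "K \<equiv> real (\<Sum>i\<in>J. b i)"
  shows "\<bar>(\<Sum>p\<in>cofactors j X n. ln (real p)) - theta j y\<bar> \<le> K * ln y"
proof -
  have n0: "n > 0" "real n \<le> X" using n by (auto simp: profiled_def)
  then have y: "y \<ge> 1" by (simp add: y_def)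
  let ?P = "{p. p \<in> C j \<and> real p \<le> y}"
  have eq: "cofactors j X n = ?P - prime_factors n"
    using n0 prime_C[OF j] by (auto simp: cofactors_def y_def field_simps in_prime_factors_iff)
  have "theta j y = (\<Sum>p\<in>?P \<inter> prime_factors n. ln (real p)) + (\<Sum>p\<in>?P - prime_factors n. ln (real p))"
    unfolding theta_def by (rule sum.Int_Diff) simp
  moreover have "(\<Sum>p\<in>?P \<inter> prime_factors n. ln (real p)) \<ge> 0"
    by (intro sum_nonneg) (auto dest!: in_prime_factors_imp_prime prime_gt_0_nat)
  moreover have "(\<Sum>p\<in>?P \<inter> prime_factors n. ln (real p)) \<le> K * ln y"
  proof -
    have "(\<Sum>p\<in>?P \<inter> prime_factors n. ln (real p)) \<le> (\<Sum>p\<in>?P \<inter> prime_factors n. ln y)"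
      by (intro sum_mono) (auto dest!: in_prime_factors_imp_prime prime_gt_0_nat)
    also have "\<dots> = real (card (?P \<inter> prime_factors n)) * ln y" by simp
    also have "\<dots> \<le> K * ln y"
    proof (rule mult_right_mono)
      have "card (?P \<inter> prime_factors n) \<le> card (prime_factors n)" by (intro card_mono) auto
      also have "card (prime_factors n) = (\<Sum>i\<in>J. b i)"
        using n by (intro card_prime_factors_profile) (simp add: profiled_def)
      finally show "real (card (?P \<inter> prime_factors n)) \<le> K" unfolding K_def by (rule of_nat_mono)
    qed (use y in simp)
    finally show ?thesis .
  qed
  ultimately show ?thesis unfolding eq by linarith
qed

text \<open>For \<open>n \<le> X / Y\<close> the argument \<open>X / n\<close> is large and the
  error is at most \<open>e * X / n\<close>. For the remaining \<open>n\<close> only the bound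
  \<open>M * X / n\<close> is available, but their reciprocals sum to
  \<open>recip_sum b X - recip_sum b (X / Y)\<close>, and both terms have the same leading
  asymptotics.\<close>

lemma log_part_asymp:
  assumes j: "j \<in> J"
  shows "((\<lambda>X. log_part j b X / (X * ln (ln X) ^ (\<Sum>i\<in>J. b i))) \<longlongrightarrow> \<delta> * limit_const b) at_top"
proof -
  define k where "k = (\<Sum>i\<in>J. b i)"
  define K where "K = real k"
  \<comment> \<open>The 2 comes from Chebyshev's bound, \<open>\<bar>\<delta>\<bar>\<close> from the
    main term \<open>\<delta> * y\<close>, and \<open>K\<close> from
    \<open>ln y \<le> y\<close>.\<close>
  define M where "M = 2 + \<bar>\<delta>\<bar> + K"
  have M: "M > 0" by (simp add: M_def K_def add_pos_nonneg)
  define err where "err y = \<bar>theta j y - \<delta> * y\<bar> + K * ln y" for y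
  have R: "((\<lambda>X. recip_sum b X / ln (ln X) ^ k) \<longlongrightarrow> limit_const b) at_top"
    unfolding k_def by (rule recip_sum_asymp)
  have llpos: "\<forall>\<^sub>F X in at_top. ln (ln X) > (0::real)" by real_asymp
  have err_le: "err y \<le> M * y" if "y \<ge> 1" for y
  proof -
    have "ln y \<le> y" using ln_le_minus_one[of y] that by simp
    then have "K * ln y \<le> K * y" by (intro mult_left_mono) (auto simp: K_def)
    moreover have "\<bar>theta j y - \<delta> * y\<bar> \<le> 2 * y + \<bar>\<delta>\<bar> * y"
      using theta_bounds[OF j, of y] that abs_triangle_ineq4[of "theta j y" "\<delta> * y"] by (simp add: abs_mult)
    ultimately show ?thesis by (simp add: err_def M_def algebra_simps)
  qed
  have err_small: "\<forall>\<^sub>F y in at_top. err y \<le> e * y" if e: "e > 0" for e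
  proof -
    have "((\<lambda>y. \<bar>theta j y / y - \<delta>\<bar> + K * (ln y / y)) \<longlongrightarrow> \<bar>\<delta> - \<delta>\<bar> + K * 0) at_top"
      by (intro tendsto_intros theta_lim[OF j]) real_asymp
    then have "\<forall>\<^sub>F y in at_top. \<bar>theta j y / y - \<delta>\<bar> + K * (ln y / y) < e"
      using e by (intro order_tendstoD(2)) auto
    then show ?thesis using eventually_gt_at_top[of 0]
    proof eventually_elim
      case (elim y)
      have "err y = (\<bar>theta j y / y - \<delta>\<bar> + K * (ln y / y)) * y"
      proof -
        have "\<bar>theta j y - \<delta> * y\<bar> = \<bar>theta j y / y - \<delta>\<bar> * y"
          using elim(2) abs_mult_pos[of y "theta j y / y - \<delta>"] by (simp add: left_diff_distrib)
        then show ?thesis using elim(2) by (simp add: err_def distrib_right)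
      qed
      also have "\<dots> \<le> e * y" using elim by (intro mult_right_mono) auto
      finally show ?case .
    qed
  qed
  have main: "\<bar>log_part j b X - \<delta> * X * recip_sum b X\<bar> \<le> (\<Sum>n\<in>profiled b X. err (X / real n))" for X
  proof -
    have "log_part j b X - \<delta> * X * recip_sum b X =
        (\<Sum>n\<in>profiled b X. (\<Sum>p\<in>cofactors j X n. ln (real p)) - \<delta> * (X / real n))"
      unfolding log_part_def recip_sum_def sum_subtractf by (simp add: sum_distrib_left)
    also have "\<bar>\<dots>\<bar> \<le> (\<Sum>n\<in>profiled b X. err (X / real n))"
    proof (intro order.trans[OF sum_abs] sum_mono)
      fix n assume n: "n \<in> profiled b X"
      show "\<bar>(\<Sum>p\<in>cofactors j X n. ln (real p)) - \<delta> * (X / real n)\<bar> \<le> err (X / real n)"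
        using inner_log_sum_bounds[OF j n] unfolding err_def K_def k_def by linarith
    qed
    finally show ?thesis .
  qed
  have split: "(\<Sum>n\<in>profiled b X. err (X / real n)) \<le> e * X * recip_sum b X + M * X * (recip_sum b X - recip_sum b (X / Y))"
    if Y: "Y \<ge> 1" "\<And>y. y \<ge> Y \<Longrightarrow> err y \<le> e * y" and X: "X > 0" and e: "e > 0" for X Y e
  proof -
    have sub: "profiled b (X / Y) \<subseteq> profiled b X"
    proof -
      have "X / Y \<le> X" using Y X by (simp add: divide_le_eq)
      then show ?thesis by (auto simp: profiled_def)
    qed
    have diff: "(\<Sum>n\<in>profiled b X - profiled b (X / Y). 1 / real n) = recip_sum b X - recip_sum b (X / Y)"
      unfolding recip_sum_def using sub by (intro sum_diff) auto
    have "(\<Sum>n\<in>profiled b X. err (X / real n)) =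
        (\<Sum>n\<in>profiled b X - profiled b (X / Y). err (X / real n)) + (\<Sum>n\<in>profiled b (X / Y). err (X / real n))"
      using sub by (intro sum.subset_diff) auto
    also have "(\<Sum>n\<in>profiled b X - profiled b (X / Y). err (X / real n))
        \<le> (\<Sum>n\<in>profiled b X - profiled b (X / Y). M * (X / real n))"
      by (intro sum_mono err_le) (auto simp: profiled_def)
    also have "\<dots> = M * X * (recip_sum b X - recip_sum b (X / Y))"
      unfolding diff[symmetric] by (simp add: sum_distrib_left)
    also have "(\<Sum>n\<in>profiled b (X / Y). err (X / real n)) \<le> (\<Sum>n\<in>profiled b (X / Y). e * (X / real n))"
      using Y(1) by (intro sum_mono Y(2)) (auto simp: profiled_def field_simps)
    also have "\<dots> = e * X * recip_sum b (X / Y)" by (simp add: recip_sum_def sum_distrib_left)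
    also have "\<dots> \<le> e * X * recip_sum b X"
      using Y X e by (intro mult_left_mono recip_sum_mono) (auto simp: divide_le_eq)
    finally show ?thesis by linarith
  qed
  have E: "((\<lambda>X. (\<Sum>n\<in>profiled b X. err (X / real n)) / (X * ln (ln X) ^ k)) \<longlongrightarrow> 0) at_top"
  proof (rule tendstoI)
    fix e0 :: real assume e0: "e0 > 0"
    \<comment> \<open>The bound \<open>?u\<close> tends to \<open>e * limit_const b\<close>, which
      has to stay strictly below \<open>e0\<close>; the \<open>+ 1\<close> prevents a zero
      denominator.\<close>
    define e where "e = e0 / (2 * (\<bar>limit_const b\<bar> + 1))"
    have e: "e > 0" using e0 by (simp add: e_def add_nonneg_pos)
    obtain Y0 where Y0: "\<And>y. y \<ge> Y0 \<Longrightarrow> err y \<le> e * y"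
      using err_small[OF e] by (auto simp: eventually_at_top_linorder)
    define Y where "Y = max 1 Y0"
    have Y: "Y \<ge> 1" "\<And>y. y \<ge> Y \<Longrightarrow> err y \<le> e * y" using Y0 by (auto simp: Y_def)
    let ?u = "\<lambda>X. e * (recip_sum b X / ln (ln X) ^ k)
        + M * (recip_sum b X / ln (ln X) ^ k - (recip_sum b (X / Y) / ln (ln (X / Y)) ^ k) * (ln (ln (X / Y)) / ln (ln X)) ^ k)"
    have XY: "filterlim (\<lambda>X. X / Y) at_top at_top" using Y(1) by real_asymp
    have "(?u \<longlongrightarrow> e * limit_const b + M * (limit_const b - limit_const b * 1 ^ k)) at_top"
    proof (intro tendsto_intros R)
      show "((\<lambda>X. recip_sum b (X / Y) / ln (ln (X / Y)) ^ k) \<longlongrightarrow> limit_const b) at_top"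
        by (rule filterlim_compose[OF R XY])
      show "((\<lambda>X. ln (ln (X / Y)) / ln (ln X)) \<longlongrightarrow> 1) at_top" using Y(1) by real_asymp
    qed
    moreover have "e * limit_const b + M * (limit_const b - limit_const b * 1 ^ k) < e0"
    proof -
      have "e * limit_const b \<le> e * \<bar>limit_const b\<bar>" using e by (intro mult_left_mono) auto
      also have "\<dots> < e * (2 * (\<bar>limit_const b\<bar> + 1))" using e by (intro mult_strict_left_mono) auto
      also have "\<dots> = e0" by (simp add: e_def)
      finally show ?thesis by simp
    qed
    ultimately have ev: "\<forall>\<^sub>F X in at_top. ?u X < e0" by (rule order_tendstoD(2))
    have llYpos: "\<forall>\<^sub>F X in at_top. ln (ln (X / Y)) > 0" using Y(1) by real_asymp
    show "\<forall>\<^sub>F X in at_top. dist ((\<Sum>n\<in>profiled b X. err (X / real n)) / (X * ln (ln X) ^ k)) 0 < e0"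
      using ev llpos llYpos eventually_gt_at_top[of 0]
    proof eventually_elim
      case (elim X)
      have pos: "X * ln (ln X) ^ k > 0" using elim by simp
      have nn: "(\<Sum>n\<in>profiled b X. err (X / real n)) \<ge> 0" using main[of X] by linarith
      have "(\<Sum>n\<in>profiled b X. err (X / real n)) / (X * ln (ln X) ^ k) \<le>
          (e * X * recip_sum b X + M * X * (recip_sum b X - recip_sum b (X / Y))) / (X * ln (ln X) ^ k)"
        using split[OF Y elim(4) e] pos by (intro divide_right_mono) auto
      also have "\<dots> = ?u X"
      proof -
        have "(e * X * r + M * X * (r - r')) / (X * l ^ k) = e * (r / l ^ k)
            + M * (r / l ^ k - (r' / l' ^ k) * (l' / l) ^ k)"
          if "X > 0" "l > 0" "l' > 0" for r r' l l' :: real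
          using that by (simp add: field_simps)
        from this[OF elim(4,2,3)] show ?thesis .
      qed
      finally show ?case using elim(1) nn pos by (simp add: dist_real_def)
    qed
  qed
  have D: "((\<lambda>X. (log_part j b X - \<delta> * X * recip_sum b X) / (X * ln (ln X) ^ k)) \<longlongrightarrow> 0) at_top"
  proof (rule Lim_null_comparison[OF _ E])
    show "\<forall>\<^sub>F X in at_top. norm ((log_part j b X - \<delta> * X * recip_sum b X) / (X * ln (ln X) ^ k))
        \<le> (\<Sum>n\<in>profiled b X. err (X / real n)) / (X * ln (ln X) ^ k)"
      using llpos eventually_gt_at_top[of 0]
    proof eventually_elim
      case (elim X)
      have pos: "X * ln (ln X) ^ k > 0" using elim by simp
      then show ?case using main[of X] by (simp add: abs_divide divide_right_mono)
    qed
  qed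
  have "((\<lambda>X. (log_part j b X - \<delta> * X * recip_sum b X) / (X * ln (ln X) ^ k) + \<delta> * (recip_sum b X / ln (ln X) ^ k)) \<longlongrightarrow> 0
      + \<delta> * limit_const b) at_top"
    by (intro tendsto_intros D R)
  moreover have "\<forall>\<^sub>F X in at_top. (log_part j b X - \<delta> * X * recip_sum b X) / (X * ln (ln X) ^ k)
      + \<delta> * (recip_sum b X / ln (ln X) ^ k) =
      log_part j b X / (X * ln (ln X) ^ k)"
    using eventually_gt_at_top[of 0] by eventually_elim (simp add: diff_divide_distrib)
  ultimately show ?thesis unfolding k_def[symmetric] using Lim_transform_eventually by fastforce
qed

text \<open>By \<open>limit_const_update\<close> class \<open>j\<close> contributes
  \<open>a j\<close> times \<open>limit_const a\<close>, and the sum of the \<open>a j\<close> is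
  the factor \<open>Suc k\<close>.\<close>

lemma log_count_asymp:
  assumes k: "(\<Sum>j\<in>J. a j) = Suc k"
  shows "((\<lambda>X. log_count a X / (X * ln (ln X) ^ k)) \<longlongrightarrow> real (Suc k) * limit_const a) at_top"
proof -
  have "((\<lambda>X. \<Sum>j\<in>{j\<in>J. a j > 0}. log_part j (a(j := a j - 1)) X / (X * ln (ln X) ^ k)) \<longlongrightarrow>
      (\<Sum>j\<in>{j\<in>J. a j > 0}. real (a j) * limit_const a)) at_top"
  proof (rule tendsto_sum)
    fix j assume "j \<in> {j\<in>J. a j > 0}"
    then have j: "j \<in> J" "a j > 0" by auto
    have "(\<Sum>i\<in>J. (a(j := a j - 1)) i) = k" using sum_update(1)[where a = a, OF j] k by simp
    then show "((\<lambda>X. log_part j (a(j := a j - 1)) X / (X * ln (ln X) ^ k)) \<longlongrightarrow> real (a j) * limit_const a) at_top"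
      using log_part_asymp[OF j(1), of "a(j := a j - 1)"] limit_const_update[where a = a, OF j] by (simp only: mult.commute)
  qed
  moreover have "(\<Sum>j\<in>{j\<in>J. a j > 0}. real (a j) * limit_const a) = real (Suc k) * limit_const a"
  proof -
    have "(\<Sum>j\<in>{j\<in>J. a j > 0}. a j) = (\<Sum>j\<in>J. a j)"
      using finite_J by (intro sum.mono_neutral_left) auto
    then show ?thesis unfolding k[symmetric] sum_distrib_right[symmetric] by (simp flip: of_nat_sum)
  qed
  ultimately show ?thesis unfolding log_count_eq by (simp only: sum_divide_distrib)
qed

text \<open>From below, \<open>ln n \<le> ln X\<close> for every counted \<open>n\<close>. From
  above, the numbers up to \<open>X / (ln X)\<^sup>2\<close> are too few to matter, and all others
  have \<open>ln n \<ge> ln X - 2 * ln (ln X)\<close>.\<close>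

theorem card_profiled_asymp:
  assumes k: "(\<Sum>j\<in>J. a j) = Suc k"
  shows "((\<lambda>X. real (card (profiled a X)) * ln X / (X * ln (ln X) ^ k)) \<longlongrightarrow> real (Suc k) * limit_const a) at_top"
proof (rule tendsto_sandwich)
  let ?c = "real (Suc k) * limit_const a"
  have llpos: "\<forall>\<^sub>F X in at_top. ln (ln X) > (0::real)" by real_asymp
  show "((\<lambda>X. log_count a X / (X * ln (ln X) ^ k)) \<longlongrightarrow> ?c) at_top" by (rule log_count_asymp[OF k])
  show "\<forall>\<^sub>F X in at_top. log_count a X / (X * ln (ln X) ^ k) \<le> real (card (profiled a X)) * ln X / (X * ln (ln X) ^ k)"
    using llpos eventually_gt_at_top[of 0]
  proof eventually_elim
    case (elim X)
    have "log_count a X \<le> (\<Sum>n\<in>profiled a X. ln X)"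
      unfolding log_count_def by (intro sum_mono) (auto simp: profiled_def)
    then show ?case using elim by (intro divide_right_mono) auto
  qed
  let ?u = "\<lambda>X. 1 / (ln X * ln (ln X) ^ k) + log_count a X / (X * ln (ln X) ^ k) * (ln X / (ln X - 2 * ln (ln X)))"
  have "(?u \<longlongrightarrow> 0 + ?c * 1) at_top"
  proof (intro tendsto_add tendsto_mult log_count_asymp[OF k])
    show "((\<lambda>X::real. ln X / (ln X - 2 * ln (ln X))) \<longlongrightarrow> 1) at_top" by real_asymp
    have "((\<lambda>X::real. 1 / ln X * (1 / ln (ln X)) ^ k) \<longlongrightarrow> 0) at_top"
    proof (cases k)
      case 0
      have "((\<lambda>X::real. 1 / ln X) \<longlongrightarrow> 0) at_top" by real_asymp
      then show ?thesis using 0 by simp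
    next
      case (Suc l)
      have "((\<lambda>X::real. 1 / ln X * (1 / ln (ln X)) ^ k) \<longlongrightarrow> 0 * 0 ^ k) at_top"
        by (intro tendsto_mult tendsto_power; real_asymp)
      then show ?thesis by simp
    qed
    then show "((\<lambda>X::real. 1 / (ln X * ln (ln X) ^ k)) \<longlongrightarrow> 0) at_top" by (simp add: power_one_over)
  qed
  then show "(?u \<longlongrightarrow> ?c) at_top" by simp
  have ev: "\<forall>\<^sub>F X in at_top. ln X - 2 * ln (ln X) > (0::real)" by real_asymp
  show "\<forall>\<^sub>F X in at_top. real (card (profiled a X)) * ln X / (X * ln (ln X) ^ k) \<le> ?u X"
    using llpos ev eventually_gt_at_top[of 1]
  proof eventually_elim
    case (elim X)
    \<comment> \<open>The exponent 2 makes \<open>Y\<close> negligible against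
      \<open>X / ln X\<close> even when \<open>k = 0\<close>, while \<open>ln Y\<close> stays
      asymptotic to \<open>ln X\<close>.\<close>
    define Y where "Y = X / (ln X)\<^sup>2"
    have lnX: "ln X > 0" using elim by simp
    have Y: "Y > 0" using elim lnX by (simp add: Y_def)
    have lnY: "ln Y = ln X - 2 * ln (ln X)" using elim lnX by (simp add: Y_def ln_div ln_realpow)
    let ?A = "{n\<in>profiled a X. real n \<le> Y}" and ?B = "{n\<in>profiled a X. real n > Y}"
    have "card (profiled a X) = card (?A \<union> ?B)" by (rule arg_cong[where f = card]) auto
    also have "\<dots> = card ?A + card ?B" by (rule card_Un_disjoint) auto
    finally have card: "real (card (profiled a X)) = real (card ?A) + real (card ?B)" by simp
    have "card ?A \<le> card {0<..nat \<lfloor>Y\<rfloor>}" by (intro card_mono) (auto simp: profiled_def le_nat_floor)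
    then have A: "real (card ?A) \<le> Y" using Y by (simp add: le_nat_floor) linarith
    have "real (card ?B) * ln Y = (\<Sum>n\<in>?B. ln Y)" by simp
    also have "\<dots> \<le> (\<Sum>n\<in>?B. ln (real n))" using Y by (intro sum_mono) auto
    also have "\<dots> \<le> log_count a X"
      unfolding log_count_def by (rule sum_mono2[OF finite_profiled]) (auto simp: profiled_def)
    finally have B: "real (card ?B) \<le> log_count a X / (ln X - 2 * ln (ln X))"
      using elim(2) unfolding lnY by (simp add: field_simps)
    have "real (card (profiled a X)) * ln X / (X * ln (ln X) ^ k) \<le>
        (Y + log_count a X / (ln X - 2 * ln (ln X))) * ln X / (X * ln (ln X) ^ k)"
      unfolding card using A B lnX elim by (intro divide_right_mono mult_right_mono add_mono) auto
    also have "\<dots> = ?u X"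
    proof -
      have "(X / x\<^sup>2 + t / z) * x / (X * w) = 1 / (x * w) + t / (X * w) * (x / z)"
        if "x > 0" "w > 0" "z > 0" "X > 0" for x w z t X :: real
        using that by (simp add: field_simps power2_eq_square)
      from this[of "ln X" "ln (ln X) ^ k"] show ?thesis unfolding Y_def using elim lnX by simp
    qed
    finally show ?case .
  qed
qed

end

section \<open>Specialization to the residue classes modulo m\<close>

lemma limit_at_floor:
  fixes f :: "nat \<Rightarrow> real" and g :: "real \<Rightarrow> real"
  assumes f: "(\<lambda>n. f n / g (real n)) \<longlonglongrightarrow> l" and g: "((\<lambda>X. g (real (nat \<lfloor>X\<rfloor>)) / g X) \<longlongrightarrow> 1) at_top"
    and pos: "\<forall>\<^sub>F X in at_top. g (real (nat \<lfloor>X::real\<rfloor>)) \<noteq> 0"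
  shows "((\<lambda>X. f (nat \<lfloor>X\<rfloor>) / g X) \<longlongrightarrow> l) at_top"
proof -
  have "filterlim (\<lambda>X::real. nat \<lfloor>X\<rfloor>) sequentially at_top"
    by (rule filterlim_compose[OF filterlim_nat_sequentially filterlim_floor_sequentially])
  then have "((\<lambda>X. f (nat \<lfloor>X\<rfloor>) / g (real (nat \<lfloor>X\<rfloor>)) * (g (real (nat \<lfloor>X\<rfloor>)) / g X)) \<longlongrightarrow> l * 1) at_top"
    by (intro tendsto_mult g filterlim_compose[OF f])
  then have lim: "((\<lambda>X. f (nat \<lfloor>X\<rfloor>) / g (real (nat \<lfloor>X\<rfloor>)) * (g (real (nat \<lfloor>X\<rfloor>)) / g X)) \<longlongrightarrow> l) at_top" by simp
  have "\<forall>\<^sub>F X in at_top. f (nat \<lfloor>X\<rfloor>) / g (real (nat \<lfloor>X\<rfloor>)) * (g (real (nat \<lfloor>X\<rfloor>)) / g X) = f (nat \<lfloor>X\<rfloor>) / g X"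
    using pos by eventually_elim simp
  with lim show ?thesis by (rule Lim_transform_eventually)
qed

lemma prime_classes_unit_rep:
  assumes m: "m > 1"
  shows "prime_classes {1..totient m} (\<lambda>j. {p. prime p \<and> [p = unit_rep m j] (mod m)})"
proof
  fix i j p
  assume i: "i \<in> {1..totient m}" and j: "j \<in> {1..totient m}"
    and p: "p \<in> {p. prime p \<and> [p = unit_rep m i] (mod m)}" "p \<in> {p. prime p \<and> [p = unit_rep m j] (mod m)}"
  have "unit_rep m i \<in> totatives m" "unit_rep m j \<in> totatives m" using image_unit_rep[of m] i j by blast+
  then have "unit_rep m i < m" "unit_rep m j < m" using totatives_less[OF _ m] by blast+
  moreover have "[unit_rep m i = unit_rep m j] (mod m)" using p by (auto intro: cong_trans cong_sym)
  ultimately have "unit_rep m i = unit_rep m j" by (simp add: cong_def)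
  then show "i = j" by (rule inj_onD[OF strict_mono_on_imp_inj_on[OF strict_mono_on_unit_rep] _ i j])
qed auto

lemma prime_classes_density_unit_rep:
  assumes m: "m > 1"
  shows "prime_classes_density {1..totient m} (\<lambda>j. {p. prime p \<and> [p = unit_rep m j] (mod m)}) (1 / real (totient m))"
proof -
  let ?C = "\<lambda>j. {p. prime p \<and> [p = unit_rep m j] (mod m)}"
  interpret prime_classes "{1..totient m}" ?C by (rule prime_classes_unit_rep[OF m])
  show ?thesis
  proof
    fix j assume j: "j \<in> {1..totient m}"
    define r where "r = unit_rep m j"
    have "r \<in> totatives m" using image_unit_rep[of m] j unfolding r_def by blast
    then have "coprime r m" by (simp add: totatives_def)
    then have ap: "(\<lambda>n. theta_ap m r n / real n) \<longlonglongrightarrow> 1 / real (totient m)" by (rule theta_ap_asymp[OF m])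
    \<comment> \<open>For negative \<open>X\<close> the conversion to \<open>nat\<close> yields 0;
      positivity of \<open>p\<close> rules this case out.\<close>
    have floor: "real p \<le> X \<longleftrightarrow> p \<le> nat \<lfloor>X\<rfloor>" if "prime p" for p X
    proof
      assume "p \<le> nat \<lfloor>X\<rfloor>"
      then have "int p \<le> \<lfloor>X\<rfloor>" using prime_gt_0_nat[OF that] by linarith
      then show "real p \<le> X" by (simp add: le_floor_iff)
    qed (rule le_nat_floor)
    have set: "{p. p \<in> ?C j \<and> real p \<le> X} = {p. prime p \<and> p \<le> nat \<lfloor>X\<rfloor> \<and> [p = r] (mod m)}" for X
      using floor by (auto simp: r_def)
    have "theta j X = theta_ap m r (nat \<lfloor>X\<rfloor>)" for X
      unfolding theta_def theta_ap_def set ..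
    moreover have "((\<lambda>X. theta_ap m r (nat \<lfloor>X\<rfloor>) / X) \<longlongrightarrow> 1 / real (totient m)) at_top"
    proof (rule limit_at_floor[where g = "\<lambda>x. x", OF ap])
      show "((\<lambda>X. real (nat \<lfloor>X\<rfloor>) / X) \<longlongrightarrow> 1) at_top" by real_asymp
      show "\<forall>\<^sub>F X in at_top. real (nat \<lfloor>X::real\<rfloor>) \<noteq> 0"
        using eventually_ge_at_top[of 1] by eventually_elim (simp, linarith)
    qed
    ultimately show "((\<lambda>X. theta j X / X) \<longlongrightarrow> 1 / real (totient m)) at_top" by simp
    have "{p. p \<in> ?C j \<and> p \<le> n} = {p. prime p \<and> p \<le> n \<and> [p = r] (mod m)}" for n by (auto simp: r_def)
    then have "(\<lambda>n. (\<Sum>p | p \<in> ?C j \<and> p \<le> n. ln (real p)) / real n) \<longlonglongrightarrow> 1 / real (totient m)"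
      using ap by (simp only: theta_ap_def)
    then have "(\<lambda>N. (\<Sum>p | p \<in> ?C j \<and> p \<le> N. 1 / real p) / ln (ln (real N))) \<longlonglongrightarrow> 1 / real (totient m)"
      by (intro mertens_from_theta) auto
    then have "((\<lambda>X. (\<Sum>p | p \<in> ?C j \<and> p \<le> nat \<lfloor>X\<rfloor>. 1 / real p) / ln (ln X)) \<longlongrightarrow> 1 / real (totient m)) at_top"
    proof (rule limit_at_floor)
      show "((\<lambda>X. ln (ln (real (nat \<lfloor>X\<rfloor>))) / ln (ln X)) \<longlongrightarrow> 1) at_top" by real_asymp
      show "\<forall>\<^sub>F X in at_top. ln (ln (real (nat \<lfloor>X::real\<rfloor>))) \<noteq> 0"
      proof -
        have "\<forall>\<^sub>F X in at_top. ln (ln (real (nat \<lfloor>X::real\<rfloor>))) > 0" by real_asymp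
        then show ?thesis by eventually_elim simp
      qed
    qed
    moreover have "prime_recip j X = (\<Sum>p | p \<in> ?C j \<and> p \<le> nat \<lfloor>X\<rfloor>. 1 / real p)" for X
      unfolding prime_recip_def using floor by (intro sum.cong) auto
    ultimately show "((\<lambda>X. prime_recip j X / ln (ln X)) \<longlongrightarrow> 1 / real (totient m)) at_top" by simp
  qed
qed

text \<open>The classes are disjoint, so once the prescribed numbers add up to the number of all
  prime factors, no prime factor is left outside the classes; in particular, none divides the
  modulus in the application.\<close>

lemma (in prime_classes) profile_iff:
  "profile a n \<longleftrightarrow> squarefree n \<and> card (prime_factors n) = (\<Sum>j\<in>J. a j) \<and> (\<forall>j\<in>J. card (prime_factors n \<inter> C j) = a j)"
proof
  assume "profile a n"
  then show "squarefree n \<and> card (prime_factors n) = (\<Sum>j\<in>J. a j) \<and> (\<forall>j\<in>J. card (prime_factors n \<inter> C j) = a j)"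
    using card_prime_factors_profile by (auto simp: profile_def)
next
  assume n: "squarefree n \<and> card (prime_factors n) = (\<Sum>j\<in>J. a j) \<and> (\<forall>j\<in>J. card (prime_factors n \<inter> C j) = a j)"
  have "card (\<Union>j\<in>J. prime_factors n \<inter> C j) = (\<Sum>j\<in>J. card (prime_factors n \<inter> C j))"
    using finite_J disjoint_C by (intro card_UN_disjoint) auto
  also have "\<dots> = card (prime_factors n)" using n by simp
  finally have "(\<Union>j\<in>J. prime_factors n \<inter> C j) = prime_factors n"
    by (intro card_subset_eq) auto
  then show "profile a n" using n by (auto simp: profile_def)
qed

theorem theorem3p1:
  fixes k m :: nat and a :: "nat \<Rightarrow> nat"
  assumes "k > 0" and "m > 1"
    and "\<And>j. j \<in> {1..totient m} \<Longrightarrow> a j \<le> k"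
    and "(\<Sum>j = 1..totient m. a j) = k"
  shows "(\<lambda>X::real. real (pi_count k X m a)) \<sim>[at_top]
         (\<lambda>X::real. fact k / (\<Prod>j = 1..totient m. fact (a j)) *
            (1 / (real (totient m) ^ k * fact (k - 1))) *
            (X * ln (ln X) ^ (k - 1) / ln X))"
proof -
  let ?J = "{1..totient m}" and ?C = "\<lambda>j. {p. prime p \<and> [p = unit_rep m j] (mod m)}"
  interpret prime_classes_density ?J ?C "1 / real (totient m)"
    by (rule prime_classes_density_unit_rep[OF assms(2)])
  obtain l where l: "k = Suc l" using assms(1) by (cases k) auto
  then have km: "k - 1 = l" by simp
  have "prime_factors n \<inter> ?C j = {p \<in> prime_factors n. [p = unit_rep m j] (mod m)}" for n j by auto
  then have count: "pi_count k X m a = card (profiled a X)" for X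
    unfolding pi_count_def profiled_def profile_iff omega_def assms(4) by (simp only: conj_assoc)
  define c where "c = real (Suc l) * limit_const a"
  have c: "c = fact k / (\<Prod>j = 1..totient m. fact (a j)) * (1 / (real (totient m) ^ k * fact (k - 1)))"
  proof -
    \<comment> \<open>Here \<open>k! / (k - 1)! = k\<close> reconciles the multinomial form of the
      statement with the factor \<open>Suc l\<close> of the count.\<close>
    have "fact k / P * (1 / (q ^ k * fact (k - 1))) = real (Suc l) * ((1 / q) ^ k / P)" for P q :: real
      by (simp add: l power_one_over divide_simps)
    then show ?thesis unfolding c_def limit_const_def assms(4) by simp
  qed
  have "totient m > 0" using assms(2) by simp
  then have c0: "c \<noteq> 0" unfolding c by simp
  have "((\<lambda>X. real (card (profiled a X)) * ln X / (X * ln (ln X) ^ l)) \<longlongrightarrow> c) at_top"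
    unfolding c_def using assms(4) l by (intro card_profiled_asymp) simp
  then have "((\<lambda>X. real (card (profiled a X)) * ln X / (X * ln (ln X) ^ l) / c) \<longlongrightarrow> c / c) at_top"
    using c0 by (intro tendsto_intros)
  then have lim: "((\<lambda>X. real (card (profiled a X)) * ln X / (X * ln (ln X) ^ l) / c) \<longlongrightarrow> 1) at_top"
    using c0 by simp
  have "\<forall>\<^sub>F X in at_top. real (card (profiled a X)) * ln X / (X * ln (ln X) ^ l) / c =
      real (pi_count k X m a) / (c * (X * ln (ln X) ^ (k - 1) / ln X))"
  proof (intro always_eventually allI)
    fix X :: real
    \<comment> \<open>Valid without side conditions, since both sides are 0 whenever one of
      \<open>L\<close>, \<open>X\<close>, \<open>w\<close>, \<open>c\<close> is 0.\<close>
    have "A * L / (X * w) / c = A / (c * (X * w / L))" for A L w :: real by simp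
    then show "real (card (profiled a X)) * ln X / (X * ln (ln X) ^ l) / c =
        real (pi_count k X m a) / (c * (X * ln (ln X) ^ (k - 1) / ln X))"
      unfolding count km .
  qed
  from Lim_transform_eventually[OF lim this] show ?thesis
    unfolding c[symmetric] by (rule asymp_equivI')
qed

end
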